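(* Let $a:\mathbb{N}\to\mathbb{C}$ be a multiplicative arithmetic function and, for $N\in\mathbb{N}$, set $$D_N(s)=\sum_{n=1}^N a(n)\,n^{-1/2-s},\qquad \lambda_a(N)=\sum_{p\le N}\frac{|a(p)|^2}{p}.$$ (1) Suppose $a(n)$ satisfies condition (A): there exist constants $C>0$ and $\theta<1/4$ such that $|a(p^m)|\le C p^{\theta m}$ for all primes $p$ and all positive integers $m$. Then $$\|D_N\|_q\ll_q \begin{cases} e^{q\lambda_a(N)/4}, & q>1,\\ \lambda_a(N)\,e^{\lambda_a(N)/4}, & q=1,\\ e^{\lambda_a(N)/4}, & 0<q<1.\end{cases}$$ (2) Suppose $a(n)$ satisfies condition (B): there exists a constant $\theta<1/2$ such that $a(p)\ll p^{\theta}$ for all primes $p$ and, for every real number $r$, $$\prod_{p\le x}\left(1+2^r|a(p)|^2p^{-1}\right)\ll_r \sum_{n\le x}|\mu(n)|\,|a(n)|^2 n^{-1}[d(n)]^r .$$ Then, for every $0<q<\infty$, $$\|D_N\|_q\gg_q e^{q\lambda_a(N)/4}.$$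
   Context: For a Dirichlet polynomial $F(s)=\sum_{n=1}^N a_n n^{-s}$ with complex coefficients and $0<q<\infty$, $$\|F\|_q:=\left(\lim_{T\to\infty}\frac1T\int_0^T|F(it)|^q\,dt\right)^{1/q}.$$ $\mu$ is the Möbius function and $d(n)$ is the number of positive divisors of $n$. The letter $p$ always denotes a prime, so sums and products over $p\le x$ run over primes. Multiplicative means $a(1)=1$ and $a(mn)=a(m)a(n)$ whenever $\gcd(m,n)=1$. The notation $f\ll g$ (equivalently $g\gg f$) means $|f|\le K g$ for some constant $K>0$; subscripts indicate parameters on which $K$ may depend. $K$ may also depend on the function $a$, but in the bounds for $\|D_N\|_q$ it is independent of $N$ (the bounds being for all sufficiently large $N$), and in condition (B) it is independent of $p$, respectively of $x$ (for $x\ge 1$).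
   Formalization: In the case q = 1 of (1), it is additionally assumed that a(p) ≠ 0 for some prime p; otherwise λ_a(N) = 0 for all N and the printed bound would say ‖D_N‖_1 ≪ 0, which is false since a(1) = 1 (for example a(n) = 0 for all n > 1, where D_N = 1). *)

theory Defs
  imports "HOL-Analysis.Analysis" "HOL-Library.Landau_Symbols"
    "HOL-Computational_Algebra.Squarefree"
begin

text \<open>
  The value of an arithmetic function at 0 is junk: no definition below depends on it.
\<close>

definition multiplicative_fun :: "(nat \<Rightarrow> complex) \<Rightarrow> bool" where
  "multiplicative_fun a \<longleftrightarrow>
     a 1 = 1 \<and> (\<forall>m n. m > 0 \<longrightarrow> n > 0 \<longrightarrow> coprime m n \<longrightarrow> a (m * n) = a m * a n)"

definition moebius :: "nat \<Rightarrow> int" where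
  "moebius n = (if squarefree n then (-1) ^ card (prime_factors n) else 0)"

definition num_divisors :: "nat \<Rightarrow> nat" where
  "num_divisors n = card {k. k dvd n}"

text \<open>
  The limit exists for every Dirichlet polynomial \<open>F\<close> and \<open>q > 0\<close>; a proof of any
  bound on this norm has to establish that, as \<^const>\<open>Lim\<close> is unspecified otherwise.
\<close>

definition mean_norm :: "real \<Rightarrow> (complex \<Rightarrow> complex) \<Rightarrow> real" where
  "mean_norm q F =
     (Lim at_top (\<lambda>T::real. 1 / T * integral {0..T} (\<lambda>t. norm (F (\<i> * of_real t)) powr q)))
       powr (1 / q)"

definition dirichlet_poly :: "(nat \<Rightarrow> complex) \<Rightarrow> nat \<Rightarrow> complex \<Rightarrow> complex" where
  "dirichlet_poly a N s = (\<Sum>n = 1..N. a n * of_nat n powr (- 1 / 2 - s))"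

definition prime_energy :: "(nat \<Rightarrow> complex) \<Rightarrow> nat \<Rightarrow> real" where
  "prime_energy a N = (\<Sum>p | prime p \<and> p \<le> N. (norm (a p))\<^sup>2 / real p)"

definition condition_A :: "(nat \<Rightarrow> complex) \<Rightarrow> bool" where
  "condition_A a \<longleftrightarrow>
     (\<exists>C>0. \<exists>\<theta><1/4. \<forall>p m. prime p \<longrightarrow> m > 0 \<longrightarrow>
        norm (a (p ^ m)) \<le> C * real p powr (\<theta> * real m))"

definition condition_B :: "(nat \<Rightarrow> complex) \<Rightarrow> bool" where
  "condition_B a \<longleftrightarrow>
     (\<exists>\<theta><1/2. \<exists>K>0. \<forall>p. prime p \<longrightarrow> norm (a p) \<le> K * real p powr \<theta>) \<and>
     (\<forall>r::real. \<exists>K>0. \<forall>x::real. x \<ge> 1 \<longrightarrow>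
        (\<Prod>p | prime p \<and> real p \<le> x. 1 + 2 powr r * (norm (a p))\<^sup>2 / real p)
        \<le> K * (\<Sum>n | n \<ge> 1 \<and> real n \<le> x.
                 real_of_int \<bar>moebius n\<bar> * (norm (a n))\<^sup>2 / real n * real (num_divisors n) powr r))"

end

theory Submission
  imports Defs "HOL-Complex_Analysis.Complex_Analysis" "HOL-Real_Asymp.Real_Asymp"
begin

text \<open>
  The polynomial \<open>D_N(it)\<close> is a polynomial in the unimodular variables \<open>p\<^sup>-\<^sup>i\<^sup>t\<close>, which for the
  purpose of mean values over \<open>t\<close> behave like independent uniformly distributed points of the unit
  circle. All bounds come from this product structure, one prime at a time. Write
  \<open>x_p = |a(p)|\<^sup>2/p\<close>, so that \<open>\<lambda>_a(N)\<close> is the sum of \<open>x_p\<close> over \<open>p \<le> N\<close>, and \<open>s = q/2\<close>; in terms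
  of the moment (the mean of the \<open>q\<close>-th power) the expected size is \<open>exp (s\<^sup>2 \<lambda>_a(N))\<close>.

  Independence is obtained without a measure on the torus. By Weierstrass, \<open>|F|^q\<close> is a uniform limit
  of polynomials in \<open>|F|\<^sup>2\<close>, hence of trigonometric polynomials; and the mean of a trigonometric
  polynomial does not change if the phase of \<open>p\<^sup>-\<^sup>i\<^sup>t\<close> is averaged first. So the mean of \<open>|F|^q\<close> exists,
  and equals the mean over \<open>t\<close> of circle means in the variable of \<open>p\<close> (\<open>has_mean_moment_avg\<close>).

  Upper bounds. \<open>D_N\<close> is the part \<open>n \<le> N\<close> of the product \<open>F_N\<close> over \<open>p \<le> N\<close> of the truncated local
  factors \<open>f_p\<close>. Raised to the power \<open>s\<close>, a local factor is \<open>1 + s a(p) p\<^sup>-\<^sup>1\<^sup>/\<^sup>2 z\<close> plus terms in \<open>z\<^sup>2\<close>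
  and higher powers of \<open>z\<close>, so orthogonality gives a local mean \<open>1 + s\<^sup>2 x_p + O(p^(-4(1/2 - \<theta>)))\<close>
  (\<open>local_upper_bound\<close>), and the error is summable exactly because \<open>\<theta> < 1/4\<close>. Hence the moment of
  \<open>F_N\<close> is at most a constant times \<open>exp (s\<^sup>2 \<lambda>_a(N))\<close> (\<open>euler_product_moment_le\<close>). Cutting \<open>F_N\<close> at
  \<open>N\<close> is a projection onto positive frequencies, so the theorem of M. Riesz applies for \<open>q > 1\<close>, with a
  constant of order \<open>1/(q - 1)\<close> near \<open>1\<close>, and Kolmogorov's theorem for \<open>q < 1\<close>. Both are proved on the
  line by the method of P. Stein: a suitable function \<open>G\<close> on the plane is subharmonic, so the mean of
  \<open>G(f)\<close> is at least \<open>G(0)\<close> if all frequencies of \<open>f\<close> are positive (\<open>subharmonic_mean_ge\<close>). For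
  \<open>q = 1\<close> the exponent \<open>1 + 1/\<lambda>_a(N)\<close> is used, which costs the factor \<open>\<lambda>_a(N)\<close>.

  Lower bounds. In one variable, the functional \<open>f \<mapsto> f_0 + e f_1\<close> on polynomials satisfies
  \<open>|f_0 + e f_1|^q \<le> (1 + |e|\<^sup>2 + O(|e|\<^sup>4))\<close> times the circle mean of \<open>|f|^q\<close> (\<open>local_lower_bound\<close>): its
  size agrees to this order with that of the evaluation of \<open>f\<close> at \<open>e\<close>, but it does not see the
  coefficients from \<open>z\<^sup>2\<close> on, about which condition (B) says nothing. Applying it in every prime with
  \<open>e_p = s cnj (a(p)) p\<^sup>-\<^sup>1\<^sup>/\<^sup>2\<close> turns \<open>D_N\<close> into the sum of \<open>s^\<omega>(n) |a(n)|\<^sup>2/n\<close> over squarefree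
  \<open>n \<le> N\<close>. By (B), with \<open>2\<^sup>r = s\<close>, this sum is of order \<open>exp (s \<lambda>_a(N))\<close>, and the exponents combine to
  \<open>q s - s\<^sup>2 = s\<^sup>2\<close>. The accumulated errors are bounded because the sum of \<open>x_p\<^sup>2\<close> over all primes
  converges; for \<open>\<theta> \<ge> 1/4\<close> this is not a consequence of the growth bound alone, but it follows from (B)
  with \<open>r = 0\<close> and Rankin's trick (\<open>upper_half_sum_bounded\<close>, \<open>sum_squares_bounded\<close>).
\<close>

section \<open>Mean values of trigonometric polynomials\<close>

definition has_mean :: "(real \<Rightarrow> 'a::euclidean_space) \<Rightarrow> 'a \<Rightarrow> bool" where
  "has_mean \<phi> m \<longleftrightarrow> ((\<lambda>T. (1 / T) *\<^sub>R integral {0..T} \<phi>) \<longlongrightarrow> m) at_top"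

lemma has_mean_unique: "has_mean \<phi> m \<Longrightarrow> has_mean \<phi> n \<Longrightarrow> m = n"
  unfolding has_mean_def by (rule tendsto_unique) auto

lemma has_mean_add:
  assumes "has_mean \<phi> m" "has_mean \<psi> n" "continuous_on UNIV \<phi>" "continuous_on UNIV \<psi>"
  shows "has_mean (\<lambda>t. \<phi> t + \<psi> t) (m + n)"
proof -
  have "integral {0..T} (\<lambda>t. \<phi> t + \<psi> t) = integral {0..T} \<phi> + integral {0..T} \<psi>" for T
    by (intro integral_add integrable_continuous_real continuous_on_subset[OF assms(3)]
        continuous_on_subset[OF assms(4)]) auto
  then show ?thesis
    using tendsto_add[OF assms(1,2)[unfolded has_mean_def]]
    by (simp add: has_mean_def scaleR_add_right)
qed

lemma has_mean_cmult:
  fixes \<phi> :: "real \<Rightarrow> 'a::{euclidean_space,real_normed_field}"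
  assumes "has_mean \<phi> m"
  shows "has_mean (\<lambda>t. c * \<phi> t) (c * m)"
  using tendsto_mult_left[OF assms[unfolded has_mean_def], of c]
  by (simp add: has_mean_def scaleR_conv_of_real mult.left_commute)

lemma has_mean_const: "has_mean (\<lambda>t. c) c"
proof -
  have "eventually (\<lambda>T::real. (1 / T) *\<^sub>R integral {0..T} (\<lambda>t. c) = c) at_top"
    using eventually_gt_at_top[of 0] by eventually_elim simp
  then show ?thesis
    unfolding has_mean_def by (rule tendsto_eventually)
qed

lemma has_mean_cis:
  assumes "l \<noteq> 0"
  shows "has_mean (\<lambda>t. cis (l * t)) 0"
proof -
  have int: "integral {0..T} (\<lambda>t. cis (l * t)) = (cis (l * T) - 1) / (\<i> * l)" if "T > 0" for T
  proof -
    have "((\<lambda>t. cis (l * t)) has_integral cis (l * T) / (\<i> * l) - cis (l * 0) / (\<i> * l)) {0..T}"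
    proof (intro fundamental_theorem_of_calculus)
      fix t :: real
      have "((\<lambda>z. exp (\<i> * (l * z)) / (\<i> * l)) has_field_derivative exp (\<i> * (l * of_real t))) (at (of_real t))"
        using assms by (auto intro!: derivative_eq_intros simp: field_simps)
      from has_vector_derivative_real_field[OF this]
      show "((\<lambda>t. cis (l * t) / (\<i> * l)) has_vector_derivative cis (l * t)) (at t within {0..T})"
        by (simp add: cis_conv_exp)
    qed (use that in auto)
    then show ?thesis
      by (simp add: integral_unique diff_divide_distrib)
  qed
  have le: "norm ((1 / T) *\<^sub>R integral {0..T} (\<lambda>t. cis (l * t))) \<le> (2 / \<bar>l\<bar>) / T" if "T > 0" for T
  proof -
    have "norm (cis (l * T) - 1) \<le> 2"
      using norm_triangle_ineq4[of "cis (l * T)" 1] by simp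
    then have "norm (cis (l * T) - 1) / (T * \<bar>l\<bar>) \<le> 2 / (T * \<bar>l\<bar>)"
      using that by (intro divide_right_mono) auto
    then show ?thesis
      unfolding norm_scaleR int[OF that] using that by (simp add: norm_mult norm_divide field_simps)
  qed
  have "((\<lambda>T::real. (2 / \<bar>l\<bar>) / T) \<longlongrightarrow> 0) at_top"
    by (intro real_tendsto_divide_at_top[where c = "2 / \<bar>l\<bar>"] filterlim_ident) auto
  then show ?thesis
    unfolding has_mean_def
    by (intro Lim_null_comparison[OF eventually_mono[OF eventually_gt_at_top[of 0] le]])
qed

lemma mean_dist_le:
  fixes \<phi> \<psi> :: "real \<Rightarrow> 'a::euclidean_space"
  assumes "continuous_on UNIV \<phi>" "continuous_on UNIV \<psi>"
    and "\<And>t. norm (\<phi> t - \<psi> t) \<le> e" "T > 0"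
  shows "norm ((1 / T) *\<^sub>R integral {0..T} \<phi> - (1 / T) *\<^sub>R integral {0..T} \<psi>) \<le> e"
proof -
  have i: "\<phi> integrable_on {0..T}" "\<psi> integrable_on {0..T}"
    by (auto intro!: integrable_continuous_real continuous_on_subset[OF assms(1)]
        continuous_on_subset[OF assms(2)])
  have "norm (integral {0..T} \<phi> - integral {0..T} \<psi>) = norm (integral {0..T} (\<lambda>t. \<phi> t - \<psi> t))"
    using i by (simp add: integral_diff)
  also have "\<dots> \<le> e * (T - 0)"
    using assms by (intro integral_bound continuous_on_diff)
      (auto intro: continuous_on_subset[OF assms(1)] continuous_on_subset[OF assms(2)])
  finally have "norm (integral {0..T} \<phi> - integral {0..T} \<psi>) \<le> e * T" by simp
  then show ?thesis
    using assms(4) unfolding scaleR_diff_right[symmetric] norm_scaleR by (simp add: divide_le_eq)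
qed

lemma has_mean_dist_le:
  assumes "has_mean \<phi> m" "has_mean \<psi> n" "continuous_on UNIV \<phi>" "continuous_on UNIV \<psi>"
    and "\<And>t. norm (\<phi> t - \<psi> t) \<le> e"
  shows "norm (m - n) \<le> e"
proof (rule tendsto_upperbound)
  show "((\<lambda>T. norm ((1 / T) *\<^sub>R integral {0..T} \<phi> - (1 / T) *\<^sub>R integral {0..T} \<psi>)) \<longlongrightarrow> norm (m - n)) at_top"
    using assms(1,2) unfolding has_mean_def by (intro tendsto_norm tendsto_diff)
  show "\<forall>\<^sub>F T in at_top. norm ((1 / T) *\<^sub>R integral {0..T} \<phi> - (1 / T) *\<^sub>R integral {0..T} \<psi>) \<le> e"
    using eventually_gt_at_top[of 0] by eventually_elim (intro mean_dist_le assms)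
qed simp

lemma has_mean_mono:
  fixes \<phi> \<psi> :: "real \<Rightarrow> real"
  assumes "has_mean \<phi> m" "has_mean \<psi> n" "continuous_on UNIV \<phi>" "continuous_on UNIV \<psi>"
    and "\<And>t. \<phi> t \<le> \<psi> t"
  shows "m \<le> n"
proof (rule tendsto_le)
  show "((\<lambda>T. (1 / T) *\<^sub>R integral {0..T} \<psi>) \<longlongrightarrow> n) at_top"
    "((\<lambda>T. (1 / T) *\<^sub>R integral {0..T} \<phi>) \<longlongrightarrow> m) at_top"
    by (fact assms(1,2)[unfolded has_mean_def])+
  show "\<forall>\<^sub>F T in at_top. (1 / T) *\<^sub>R integral {0..T} \<phi> \<le> (1 / T) *\<^sub>R integral {0..T} \<psi>"
    using eventually_gt_at_top[of 0]
  proof eventually_elim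
    case (elim T)
    have "integral {0..T} \<phi> \<le> integral {0..T} \<psi>"
      by (intro integral_le integrable_continuous_real continuous_on_subset[OF assms(3)]
          continuous_on_subset[OF assms(4)] assms(5)) auto
    then show ?case using elim by (intro scaleR_left_mono) auto
  qed
qed simp

text \<open>
  Two functions with arbitrarily good approximants that share their mean value have equal means, and
  the means exist. Below, the second function is obtained from the first by averaging a phase.
\<close>
lemma has_mean_uniform_limit:
  fixes \<Phi> \<Psi> :: "real \<Rightarrow> 'a::euclidean_space"
  assumes cont: "continuous_on UNIV \<Phi>" "continuous_on UNIV \<Psi>"
    and appr: "\<And>e. e > 0 \<Longrightarrow> \<exists>\<phi> \<psi> m. continuous_on UNIV \<phi> \<and> continuous_on UNIV \<psi> \<and>
      has_mean \<phi> m \<and> has_mean \<psi> m \<and> (\<forall>t. norm (\<Phi> t - \<phi> t) \<le> e) \<and> (\<forall>t. norm (\<Psi> t - \<psi> t) \<le> e)"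
  shows "\<exists>m. has_mean \<Phi> m \<and> has_mean \<Psi> m"
proof -
  have "\<forall>k. \<exists>\<phi> \<psi> m. continuous_on UNIV \<phi> \<and> continuous_on UNIV \<psi> \<and>
      has_mean \<phi> m \<and> has_mean \<psi> m \<and> (\<forall>t. norm (\<Phi> t - \<phi> t) \<le> 1 / Suc k) \<and> (\<forall>t. norm (\<Psi> t - \<psi> t) \<le> 1 / Suc k)"
    by (intro allI appr) auto
  then obtain \<phi> \<psi> m where *: "\<And>k. continuous_on UNIV (\<phi> k)" "\<And>k. continuous_on UNIV (\<psi> k)"
    "\<And>k. has_mean (\<phi> k) (m k)" "\<And>k. has_mean (\<psi> k) (m k)"
    "\<And>k t. norm (\<Phi> t - \<phi> k t) \<le> 1 / Suc k" "\<And>k t. norm (\<Psi> t - \<psi> k t) \<le> 1 / Suc k"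
    by metis
  have small: "\<exists>k. \<forall>l\<ge>k. 1 / real (Suc l) < e" if pos: "e > 0" for e
  proof -
    obtain k where k: "1 / real (Suc k) < e"
      by (rule nat_approx_posE[OF pos])
    have "1 / real (Suc l) \<le> 1 / real (Suc k)" if "l \<ge> k" for l
      using that by (intro divide_left_mono) auto
    then show ?thesis using k by (meson le_less_trans)
  qed
  have "norm (m k - m l) \<le> 1 / Suc k + 1 / Suc l" for k l
  proof (rule has_mean_dist_le[OF *(3)[of k] *(3)[of l] *(1)[of k] *(1)[of l]])
    fix t
    show "norm (\<phi> k t - \<phi> l t) \<le> 1 / Suc k + 1 / Suc l"
      using *(5)[of t k] *(5)[of t l] norm_triangle_ineq4[of "\<Phi> t - \<phi> l t" "\<Phi> t - \<phi> k t"] by simp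
  qed
  then have mm: "norm (m k - m l) \<le> 1 / Suc k + 1 / Suc l" for k l by blast
  have "Cauchy m"
  proof (rule CauchyI)
    fix e :: real assume "e > 0"
    then obtain k0 where k0: "\<forall>l\<ge>k0. 1 / real (Suc l) < e / 2" using small[of "e/2"] by auto
    show "\<exists>M. \<forall>i\<ge>M. \<forall>j\<ge>M. norm (m i - m j) < e"
    proof (intro exI[of _ k0] allI impI)
      fix i j assume "k0 \<le> i" "k0 \<le> j"
      then show "norm (m i - m j) < e"
        using mm[of i j] k0[rule_format, of i] k0[rule_format, of j] by linarith
    qed
  qed
  then obtain L where L: "m \<longlonglongrightarrow> L"
    using Cauchy_convergent convergent_def by blast
  have conv: "has_mean F L"
    if "continuous_on UNIV F" "\<And>k. continuous_on UNIV (f k)" "\<And>k. has_mean (f k) (m k)"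
      "\<And>k t. norm (F t - f k t) \<le> 1 / Suc k" for F f
    unfolding has_mean_def
  proof (rule tendstoI)
    fix e :: real assume "e > 0"
    then obtain k0 where k0: "\<forall>l\<ge>k0. 1 / real (Suc l) < e / 3" using small[of "e/3"] by auto
    have "\<forall>\<^sub>F k in sequentially. dist (m k) L < e / 3"
      using L \<open>e > 0\<close> by (intro tendstoD) auto
    then have "\<forall>\<^sub>F k in sequentially. dist (m k) L < e / 3 \<and> k \<ge> k0"
      using eventually_ge_at_top by (rule eventually_conj)
    then obtain k where k: "dist (m k) L < e / 3" "k \<ge> k0"
      using eventually_happens'[OF sequentially_bot] by blast
    have "\<forall>\<^sub>F T in at_top. dist ((1 / T) *\<^sub>R integral {0..T} (f k)) (m k) < e / 3"
      using that(3)[of k] \<open>e > 0\<close> unfolding has_mean_def by (intro tendstoD) auto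
    then show "\<forall>\<^sub>F T in at_top. dist ((1 / T) *\<^sub>R integral {0..T} F) L < e"
      using eventually_gt_at_top[of 0]
    proof eventually_elim
      case (elim T)
      have "dist ((1 / T) *\<^sub>R integral {0..T} F) ((1 / T) *\<^sub>R integral {0..T} (f k)) \<le> 1 / Suc k"
        unfolding dist_norm by (rule mean_dist_le[OF that(1) that(2) that(4) elim(2)])
      moreover have "1 / real (Suc k) < e / 3" using k0 k by auto
      ultimately show ?case using elim(1) k(1)
        using dist_triangle[of "(1 / T) *\<^sub>R integral {0..T} F" L "m k"]
          dist_triangle[of "(1 / T) *\<^sub>R integral {0..T} F" "m k" "(1 / T) *\<^sub>R integral {0..T} (f k)"]
        by linarith
    qed
  qed
  show ?thesis
    using conv[OF cont(1) *(1,3,5)] conv[OF cont(2) *(2,4,6)] by blast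
qed

text \<open>
  The character \<open>(m/n)\<^sup>-\<^sup>i\<^sup>t\<close> after the substitution \<open>p\<^sup>-\<^sup>i\<^sup>t \<mapsto> exp (2\<pi>ix) p\<^sup>-\<^sup>i\<^sup>t\<close>.
\<close>
definition marked_char :: "nat \<Rightarrow> nat \<Rightarrow> nat \<Rightarrow> real \<Rightarrow> real \<Rightarrow> complex" where
  "marked_char p m n t x = cis (2 * pi * x * (real (multiplicity p m) - real (multiplicity p n)) - t * (ln m - ln n))"

inductive_set marked_trigs :: "nat \<Rightarrow> (real \<Rightarrow> real \<Rightarrow> complex) set" for p where
  char: "prime p \<Longrightarrow> m > 0 \<Longrightarrow> n > 0 \<Longrightarrow> (\<lambda>t x. c * marked_char p m n t x) \<in> marked_trigs p"
| add: "f \<in> marked_trigs p \<Longrightarrow> g \<in> marked_trigs p \<Longrightarrow> (\<lambda>t x. f t x + g t x) \<in> marked_trigs p"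

lemma marked_trigs_prime: "f \<in> marked_trigs p \<Longrightarrow> prime p"
  by (induction rule: marked_trigs.induct) auto

lemma marked_trigs_const: "prime p \<Longrightarrow> (\<lambda>t x. c) \<in> marked_trigs p"
  using marked_trigs.char[of p 1 1 c] by (simp add: marked_char_def)

lemma marked_char_mult:
  assumes "prime p" "m > 0" "n > 0" "m' > 0" "n' > 0"
  shows "marked_char p m n t x * marked_char p m' n' t x = marked_char p (m * m') (n * n') t x"
  using assms by (simp add: marked_char_def cis_mult ln_mult prime_elem_multiplicity_mult_distrib algebra_simps)

lemma marked_trigs_mult_char:
  assumes "f \<in> marked_trigs p" "m > 0" "n > 0"
  shows "(\<lambda>t x. f t x * (c * marked_char p m n t x)) \<in> marked_trigs p"
  using assms(1)
proof induction
  case (char m' n' d)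
  have "(\<lambda>t x. (d * c) * marked_char p (m' * m) (n' * n) t x) \<in> marked_trigs p"
    using char assms by (intro marked_trigs.char) auto
  then show ?case
    using char assms by (simp add: marked_char_mult[symmetric] mult_ac)
qed (auto simp: distrib_right intro: marked_trigs.add)

lemma marked_trigs_mult:
  assumes "f \<in> marked_trigs p" "g \<in> marked_trigs p"
  shows "(\<lambda>t x. f t x * g t x) \<in> marked_trigs p"
  using assms(2)
proof induction
  case (char m n c)
  then show ?case using marked_trigs_mult_char[OF assms(1)] by simp
qed (auto simp: distrib_left intro: marked_trigs.add)

lemma marked_trigs_cnj:
  assumes "f \<in> marked_trigs p"
  shows "(\<lambda>t x. cnj (f t x)) \<in> marked_trigs p"
  using assms
proof induction
  case (char m n c)
  have "(\<lambda>t x. cnj c * marked_char p n m t x) \<in> marked_trigs p"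
    using char by (intro marked_trigs.char) auto
  moreover have "cnj (marked_char p m n t x) = marked_char p n m t x" for t x
    by (simp add: marked_char_def cis_cnj algebra_simps)
  ultimately show ?case by simp
qed (auto intro: marked_trigs.add)

lemma marked_trigs_sum:
  assumes "finite J" "\<And>j. j \<in> J \<Longrightarrow> f j \<in> marked_trigs p" "prime p"
  shows "(\<lambda>t x. \<Sum>j\<in>J. f j t x) \<in> marked_trigs p"
  using assms
proof (induction J rule: finite_induct)
  case empty
  then show ?case using marked_trigs_const[of p 0] by simp
qed (auto intro: marked_trigs.add)

lemma marked_trigs_continuous:
  assumes "f \<in> marked_trigs p"
  shows "continuous_on UNIV (\<lambda>(t, x). f t x)"
  using assms
proof induction
  case (char m n c)
  then show ?case
    unfolding marked_char_def split_beta by (intro continuous_intros)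
qed (simp add: split_beta continuous_on_add)

lemma marked_trigs_bounded:
  assumes "f \<in> marked_trigs p"
  shows "\<exists>B. \<forall>t x. norm (f t x) \<le> B"
  using assms
proof induction
  case (char m n c)
  then show ?case by (intro exI[of _ "norm c"]) (simp add: norm_mult marked_char_def)
next
  case (add f g)
  then obtain B C where "\<forall>t x. norm (f t x) \<le> B" "\<forall>t x. norm (g t x) \<le> C" by blast
  then show ?case
    by (intro exI[of _ "B + C"]) (auto intro!: norm_triangle_le add_mono)
qed

lemma continuous_section:
  fixes f :: "real \<Rightarrow> real \<Rightarrow> 'a::euclidean_space"
  assumes "continuous_on UNIV (\<lambda>(t, x). f t x)"
  shows "continuous_on UNIV (\<lambda>t. f t x)" "continuous_on UNIV (f t)"
    "continuous_on UNIV (\<lambda>t. integral {0..1} (f t))"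
proof -
  have c: "continuous_on UNIV (\<lambda>z. f (fst z) (snd z))"
    using assms by (simp add: split_beta)
  show "continuous_on UNIV (\<lambda>t. f t x)"
    using continuous_on_compose2[OF c, of UNIV "\<lambda>t. (t, x)"] by (simp add: continuous_on_Pair)
  show "continuous_on UNIV (f t)"
    using continuous_on_compose2[OF c, of UNIV "\<lambda>x. (t, x)"] by (simp add: continuous_on_Pair)
  show "continuous_on UNIV (\<lambda>t. integral {0..1} (f t))"
    using integral_continuous_on_param[of UNIV 0 1 f] continuous_on_subset[OF assms]
    by (simp add: cbox_interval)
qed

text \<open>
  A character with \<open>m \<noteq> n\<close> has mean zero in \<open>t\<close> because \<open>ln m \<noteq> ln n\<close>, whatever the phase; for
  \<open>m = n\<close> it does not depend on the phase. Hence averaging the phase does not affect the mean.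
\<close>
lemma marked_trigs_mean:
  assumes "f \<in> marked_trigs p"
  shows "\<exists>m. has_mean (\<lambda>t. f t 0) m \<and> has_mean (\<lambda>t. integral {0..1} (f t)) m"
  using assms
proof induction
  case (char m n c)
  show ?case
  proof (cases "m = n")
    case True
    then show ?thesis
      by (intro exI[of _ c]) (simp add: marked_char_def has_mean_const)
  next
    case False
    then have l: "- (ln (real m) - ln (real n)) \<noteq> 0" using char by auto
    define I where "I = integral {0..1} (\<lambda>x. cis (2 * pi * x * (real (multiplicity p m) - real (multiplicity p n))))"
    have 1: "marked_char p m n t x = cis (- (ln (real m) - ln (real n)) * t) *
        cis (2 * pi * x * (real (multiplicity p m) - real (multiplicity p n)))" for t x
      by (simp add: marked_char_def cis_mult algebra_simps)
    have 2: "integral {0..1} (\<lambda>x. c * marked_char p m n t x) = (c * I) * cis (- (ln (real m) - ln (real n)) * t)" for t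
      unfolding 1 I_def by simp
    have 3: "c * marked_char p m n t 0 = c * cis (- (ln (real m) - ln (real n)) * t)" for t
      unfolding 1 by simp
    show ?thesis
      unfolding 2 3 using has_mean_cmult[OF has_mean_cis[OF l]] by (metis mult_zero_right)
  qed
next
  case (add f g)
  then obtain m n where mn: "has_mean (\<lambda>t. f t 0) m" "has_mean (\<lambda>t. integral {0..1} (f t)) m"
    "has_mean (\<lambda>t. g t 0) n" "has_mean (\<lambda>t. integral {0..1} (g t)) n" by blast
  note cf = continuous_section[OF marked_trigs_continuous[OF add.hyps(1)]]
  note cg = continuous_section[OF marked_trigs_continuous[OF add.hyps(2)]]
  have "integral {0..1} (\<lambda>x. f t x + g t x) = integral {0..1} (f t) + integral {0..1} (g t)" for t
    by (intro integral_add integrable_continuous_real continuous_on_subset[OF cf(2)]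
        continuous_on_subset[OF cg(2)]) auto
  then show ?case
    using has_mean_add[OF mn(1,3) cf(1) cg(1)] has_mean_add[OF mn(2,4) cf(3) cg(3)] by auto
qed

lemma marked_trigs_polynomial:
  assumes "f \<in> marked_trigs p" "real_polynomial_function (g :: real \<Rightarrow> real)"
  shows "(\<lambda>t x. of_real (g ((norm (f t x))\<^sup>2))) \<in> marked_trigs p"
  using assms(2)
proof induction
  case (linear g)
  have "g y = y * g 1" for y
    using linear.hyps by (metis linear_scale bounded_linear.linear real_scaleR_def mult.right_neutral)
  then have "(\<lambda>t x. of_real (g ((norm (f t x))\<^sup>2))) = (\<lambda>t x. (f t x * cnj (f t x)) * of_real (g 1))"
    by (metis (no_types, lifting) complex_norm_square of_real_mult)
  then show ?case
    using marked_trigs_mult[OF marked_trigs_mult[OF assms(1) marked_trigs_cnj[OF assms(1)]] marked_trigs_const[OF marked_trigs_prime[OF assms(1)], of "of_real (g 1)"]]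
    by simp
qed (auto intro: marked_trigs_const[OF marked_trigs_prime[OF assms(1)]] marked_trigs.add marked_trigs_mult)

lemma continuous_on_powr_norm:
  fixes f :: "'b::topological_space \<Rightarrow> 'a::real_normed_vector"
  assumes "continuous_on S f" "q > 0"
  shows "continuous_on S (\<lambda>x. norm (f x) powr q)"
  using assms by (intro continuous_on_powr' continuous_intros) auto

lemma integral_complex_of_real_continuous:
  fixes \<phi> :: "real \<Rightarrow> real"
  assumes "continuous_on {a..b} \<phi>"
  shows "integral {a..b} (\<lambda>x. complex_of_real (\<phi> x)) = of_real (integral {a..b} \<phi>)"
  using integral_linear[OF integrable_continuous_real[OF assms] bounded_linear_of_real[where 'a=complex]]
  by (simp add: o_def)

text \<open>
  \<open>|f|^q = (|f|\<^sup>2)^(q/2)\<close> is a continuous function of the bounded quantity \<open>|f|\<^sup>2\<close>, so it is a uniform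
  limit of polynomials in \<open>|f|\<^sup>2\<close>. These are trigonometric polynomials, to which the previous
  computation applies.
\<close>
lemma marked_trigs_power_mean:
  assumes f: "f \<in> marked_trigs p" and q: "q > 0"
  shows "\<exists>m. has_mean (\<lambda>t. norm (f t 0) powr q) m \<and> has_mean (\<lambda>t. integral {0..1} (\<lambda>x. norm (f t x) powr q)) m"
proof -
  obtain B where B: "\<And>t x. norm (f t x) \<le> B" using marked_trigs_bounded[OF f] by blast
  then have "B \<ge> 0" using norm_ge_zero[of "f 0 0"] order_trans by blast
  have cont: "continuous_on UNIV (\<lambda>(t, x). norm (f t x) powr q)"
    using continuous_on_powr_norm[OF marked_trigs_continuous[OF f] q] by (simp add: split_beta)
  have "\<exists>m::complex. has_mean (\<lambda>t. of_real (norm (f t 0) powr q)) m \<and>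
      has_mean (\<lambda>t. of_real (integral {0..1} (\<lambda>x. norm (f t x) powr q))) m"
  proof (rule has_mean_uniform_limit)
    show "continuous_on UNIV (\<lambda>t. complex_of_real (norm (f t 0) powr q))"
      "continuous_on UNIV (\<lambda>t. complex_of_real (integral {0..1} (\<lambda>x. norm (f t x) powr q)))"
      by (intro continuous_on_of_real continuous_section[OF cont])+
  next
    fix e :: real assume e: "e > 0"
    have pc: "continuous_on {0..B\<^sup>2} (\<lambda>y::real. y powr (q / 2))"
      using q by (intro continuous_on_powr' continuous_intros) auto
    obtain g where g: "real_polynomial_function g" "\<And>y. y \<in> {0..B\<^sup>2} \<Longrightarrow> \<bar>y powr (q / 2) - g y\<bar> < e"
      by (rule Stone_Weierstrass_real_polynomial_function[OF compact_Icc pc e]) blast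
    define h where "h = (\<lambda>t x. complex_of_real (g ((norm (f t x))\<^sup>2)))"
    have h: "h \<in> marked_trigs p" unfolding h_def by (rule marked_trigs_polynomial[OF f g(1)])
    have pw: "\<bar>norm (f t x) powr q - g ((norm (f t x))\<^sup>2)\<bar> \<le> e" for t x
    proof -
      have "(norm (f t x))\<^sup>2 \<in> {0..B\<^sup>2}" using B by (auto intro: power_mono)
      moreover have "((norm (f t x))\<^sup>2) powr (q / 2) = norm (f t x) powr q"
        by (simp add: powr_powr flip: powr_numeral)
      ultimately show ?thesis using g(2)[of "(norm (f t x))\<^sup>2"] by simp
    qed
    have d0: "norm (complex_of_real (norm (f t x) powr q) - h t x) \<le> e" for t x
      using pw[of t x] unfolding h_def by (simp flip: of_real_diff)
    have d1: "norm (complex_of_real (integral {0..1} (\<lambda>x. norm (f t x) powr q)) - integral {0..1} (h t)) \<le> e" for t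
    proof -
      have ch: "continuous_on {0..1} (h t)" "continuous_on {0..1} (\<lambda>x. norm (f t x) powr q)"
        using continuous_section(2)[OF marked_trigs_continuous[OF h]] continuous_section(2)[OF cont]
        by (auto intro: continuous_on_subset)
      have ch': "continuous_on {0..1} (\<lambda>x. complex_of_real (norm (f t x) powr q))"
        using ch by (intro continuous_on_of_real)
      have "complex_of_real (integral {0..1} (\<lambda>x. norm (f t x) powr q)) = integral {0..1} (\<lambda>x. complex_of_real (norm (f t x) powr q))"
        by (rule integral_complex_of_real_continuous[OF ch(2), symmetric])
      then have "complex_of_real (integral {0..1} (\<lambda>x. norm (f t x) powr q)) - integral {0..1} (h t)
          = integral {0..1} (\<lambda>x. complex_of_real (norm (f t x) powr q) - h t x)"
        using ch ch' by (simp add: integral_diff integrable_continuous_real)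
      also have "norm \<dots> \<le> e * (1 - 0)"
        using ch ch' d0 by (intro integral_bound continuous_on_diff) auto
      finally show ?thesis by simp
    qed
    obtain m where "has_mean (\<lambda>t. h t 0) m" "has_mean (\<lambda>t. integral {0..1} (h t)) m"
      using marked_trigs_mean[OF h] by blast
    then show "\<exists>\<phi> \<psi> m. continuous_on UNIV \<phi> \<and> continuous_on UNIV \<psi> \<and> has_mean \<phi> m \<and> has_mean \<psi> m \<and>
        (\<forall>t. norm (complex_of_real (norm (f t 0) powr q) - \<phi> t) \<le> e) \<and>
        (\<forall>t. norm (complex_of_real (integral {0..1} (\<lambda>x. norm (f t x) powr q)) - \<psi> t) \<le> e)"
      using d0 d1 continuous_section[OF marked_trigs_continuous[OF h]] by blast
  qed
  then obtain m :: complex where m: "has_mean (\<lambda>t. of_real (norm (f t 0) powr q)) m"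
      "has_mean (\<lambda>t. of_real (integral {0..1} (\<lambda>x. norm (f t x) powr q))) m" by blast
  have re: "has_mean \<phi> (Re m)" if "has_mean (\<lambda>t. complex_of_real (\<phi> t)) m" "continuous_on UNIV \<phi>" for \<phi>
  proof -
    have "integral {0..T} (\<lambda>t. complex_of_real (\<phi> t)) = of_real (integral {0..T} \<phi>)" for T
      by (intro integral_complex_of_real_continuous continuous_on_subset[OF that(2)]) auto
    then show ?thesis
      using tendsto_Re[OF that(1)[unfolded has_mean_def]] by (simp add: has_mean_def)
  qed
  show ?thesis
    using re[OF m(1) continuous_section(1)[OF cont]] re[OF m(2) continuous_section(3)[OF cont]] by blast
qed

section \<open>Moments of Dirichlet polynomials\<close>

definition dirichlet_sum :: "(nat \<Rightarrow> complex) \<Rightarrow> nat set \<Rightarrow> real \<Rightarrow> complex" where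
  "dirichlet_sum c J t = (\<Sum>n\<in>J. c n * cis (- (t * ln (real n))))"

text \<open>
  The coefficients after the substitution \<open>p\<^sup>-\<^sup>i\<^sup>t \<mapsto> exp (2\<pi>ix) p\<^sup>-\<^sup>i\<^sup>t\<close>.
\<close>
definition twist :: "nat \<Rightarrow> real \<Rightarrow> (nat \<Rightarrow> complex) \<Rightarrow> nat \<Rightarrow> complex" where
  "twist p x c n = c n * cis (2 * pi * x * real (multiplicity p n))"

definition moment :: "real \<Rightarrow> (nat \<Rightarrow> complex) \<Rightarrow> nat set \<Rightarrow> real" where
  "moment q c J = Lim at_top (\<lambda>T. 1 / T * integral {0..T} (\<lambda>t. norm (dirichlet_sum c J t) powr q))"

lemma dirichlet_sum_trigs:
  assumes "finite J" "0 \<notin> J" "prime p"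
  shows "(\<lambda>t x. dirichlet_sum (twist p x c) J t) \<in> marked_trigs p"
proof -
  have "(\<lambda>t x. \<Sum>n\<in>J. c n * marked_char p n 1 t x) \<in> marked_trigs p"
    using assms by (intro marked_trigs_sum marked_trigs.char) (auto intro: gr0I)
  then show ?thesis
    by (simp add: dirichlet_sum_def twist_def marked_char_def cis_mult mult.assoc)
qed

lemma continuous_dirichlet_sum: "continuous_on S (dirichlet_sum c J)"
  unfolding dirichlet_sum_def by (intro continuous_intros)

lemma continuous_dirichlet_sum_powr: "q > 0 \<Longrightarrow> continuous_on S (\<lambda>t. norm (dirichlet_sum c J t) powr q)"
  by (intro continuous_on_powr_norm continuous_dirichlet_sum)

lemma
  assumes "finite J" "0 \<notin> J" "q > 0"
  shows has_mean_moment: "has_mean (\<lambda>t. norm (dirichlet_sum c J t) powr q) (moment q c J)"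
    and has_mean_moment_avg: "prime p \<Longrightarrow> has_mean (\<lambda>t. integral {0..1} (\<lambda>x. norm (dirichlet_sum (twist p x c) J t) powr q)) (moment q c J)"
proof -
  have tw: "twist p 0 c = c" for p by (simp add: twist_def fun_eq_iff)
  have *: "\<exists>m. has_mean (\<lambda>t. norm (dirichlet_sum c J t) powr q) m \<and>
      has_mean (\<lambda>t. integral {0..1} (\<lambda>x. norm (dirichlet_sum (twist p x c) J t) powr q)) m" if "prime p" for p
    using marked_trigs_power_mean[OF dirichlet_sum_trigs[OF assms(1,2) that] assms(3), of c] unfolding tw .
  have mom: "m = moment q c J" if "has_mean (\<lambda>t. norm (dirichlet_sum c J t) powr q) m" for m
    using that unfolding has_mean_def moment_def
    by (intro tendsto_Lim[symmetric]) auto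
  show "has_mean (\<lambda>t. norm (dirichlet_sum c J t) powr q) (moment q c J)"
    using *[OF two_is_prime_nat] mom by blast
  show "has_mean (\<lambda>t. integral {0..1} (\<lambda>x. norm (dirichlet_sum (twist p x c) J t) powr q)) (moment q c J)" if "prime p"
    using *[OF that] mom by blast
qed

lemma continuous_dirichlet_sum_avg:
  assumes "finite J" "0 \<notin> J" "q > 0" "prime p"
  shows "continuous_on UNIV (\<lambda>t. integral {0..1} (\<lambda>x. norm (dirichlet_sum (twist p x c) J t) powr q))"
proof -
  have "continuous_on UNIV (\<lambda>(t, x). norm (dirichlet_sum (twist p x c) J t) powr q)"
    using continuous_on_powr_norm[OF marked_trigs_continuous[OF dirichlet_sum_trigs[OF assms(1,2,4)]] assms(3)]
    by (simp add: split_beta)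
  from continuous_section(3)[OF this] show ?thesis .
qed

lemma moment_nonneg:
  assumes "finite J" "0 \<notin> J" "q > 0"
  shows "moment q c J \<ge> 0"
proof (rule has_mean_mono)
  show "has_mean (\<lambda>t. 0) (0 :: real)" by (rule has_mean_const)
  show "has_mean (\<lambda>t. norm (dirichlet_sum c J t) powr q) (moment q c J)"
    by (rule has_mean_moment[OF assms])
qed (simp_all add: continuous_dirichlet_sum_powr assms(3))

lemma mean_norm_dirichlet_poly:
  "mean_norm q (dirichlet_poly a N) = moment q (\<lambda>n. a n / of_real (sqrt n)) {1..N} powr (1 / q)"
proof -
  have "dirichlet_poly a N (\<i> * of_real t) = dirichlet_sum (\<lambda>n. a n / of_real (sqrt n)) {1..N} t" for t
    unfolding dirichlet_poly_def dirichlet_sum_def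
  proof (rule sum.cong)
    fix n assume n: "n \<in> {1..N}"
    have "of_nat n powr (- 1 / 2 - \<i> * of_real t) =
        exp (of_real (- (ln n / 2))) * exp (- \<i> * of_real (t * ln n) :: complex)"
      using n by (simp add: powr_def Ln_of_nat flip: exp_add) (simp add: algebra_simps)
    also have "exp (of_real (- (ln n / 2))) = complex_of_real (inverse (sqrt n))"
    proof -
      have "exp (ln n / 2) = sqrt n"
        using n exp_ln[of "sqrt n"] ln_sqrt[of "real n"] by simp
      then show ?thesis
        unfolding exp_of_real by (simp only: exp_minus)
    qed
    also have "exp (- \<i> * of_real (t * ln n)) = cis (- (t * ln n))"
      by (simp add: cis_conv_exp)
    finally show "a n * of_nat n powr (- 1 / 2 - \<i> * of_real t) = a n / of_real (sqrt n) * cis (- (t * ln n))"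
      by (simp only: divide_inverse of_real_inverse mult.assoc)
  qed simp
  then show ?thesis
    by (simp add: mean_norm_def moment_def)
qed

section \<open>Subharmonic functions on the plane\<close>

text \<open>
  Partial derivatives, expressed through the derivative of \<open>G\<close> along differentiable curves. The chain
  rule is thus built in, and the product and power rules follow from the one-variable rules.
\<close>
definition has_gradient :: "(real \<Rightarrow> real \<Rightarrow> real) \<Rightarrow> (real \<Rightarrow> real \<Rightarrow> real) \<Rightarrow> (real \<Rightarrow> real \<Rightarrow> real) \<Rightarrow> bool" where
  "has_gradient G gu gv \<longleftrightarrow> (\<forall>u v u' v' t. (u has_real_derivative u') (at t) \<longrightarrow> (v has_real_derivative v') (at t) \<longrightarrow>
     ((\<lambda>t. G (u t) (v t)) has_real_derivative gu (u t) (v t) * u' + gv (u t) (v t) * v') (at t))"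

definition plane_continuous :: "(real \<Rightarrow> real \<Rightarrow> real) \<Rightarrow> bool" where
  "plane_continuous g \<longleftrightarrow> continuous_on UNIV (\<lambda>z. g (fst z) (snd z))"

text \<open>
  \<open>G\<close> is twice continuously differentiable with Laplacian \<open>L\<close>. The mixed derivatives enter
  as two functions, whose contributions cancel along conformal maps.
\<close>
definition has_laplacian :: "(real \<Rightarrow> real \<Rightarrow> real) \<Rightarrow> (real \<Rightarrow> real \<Rightarrow> real) \<Rightarrow> bool" where
  "has_laplacian G L \<longleftrightarrow> (\<exists>gu gv guu guv gvu gvv.
     has_gradient G gu gv \<and> has_gradient gu guu guv \<and> has_gradient gv gvu gvv \<and>
     plane_continuous G \<and> plane_continuous gu \<and> plane_continuous gv \<and>
     plane_continuous guu \<and> plane_continuous guv \<and> plane_continuous gvu \<and> plane_continuous gvv \<and>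
     (\<forall>u v. L u v = guu u v + gvv u v))"

lemma has_gradientD:
  assumes "has_gradient G gu gv" "(u has_real_derivative u') (at t)" "(v has_real_derivative v') (at t)"
  shows "((\<lambda>t. G (u t) (v t)) has_real_derivative gu (u t) (v t) * u' + gv (u t) (v t) * v') (at t)"
  using assms unfolding has_gradient_def by blast

lemma plane_continuousD:
  assumes "plane_continuous g" "continuous_on S f" "continuous_on S h"
  shows "continuous_on S (\<lambda>x. g (f x) (h x))"
  using continuous_on_compose2[OF assms(1)[unfolded plane_continuous_def], of S "\<lambda>x. (f x, h x)"] assms(2,3)
  by (simp add: continuous_on_Pair)

lemma has_gradient_const: "has_gradient (\<lambda>u v. c) (\<lambda>u v. 0) (\<lambda>u v. 0)"
  by (simp add: has_gradient_def)

lemma has_gradient_fst: "has_gradient (\<lambda>u v. u) (\<lambda>u v. 1) (\<lambda>u v. 0)"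
  by (simp add: has_gradient_def)

lemma has_gradient_snd: "has_gradient (\<lambda>u v. v) (\<lambda>u v. 0) (\<lambda>u v. 1)"
  by (simp add: has_gradient_def)

lemma has_gradient_add:
  assumes "has_gradient G gu gv" "has_gradient H hu hv"
  shows "has_gradient (\<lambda>u v. G u v + H u v) (\<lambda>u v. gu u v + hu u v) (\<lambda>u v. gv u v + hv u v)"
  unfolding has_gradient_def
proof (intro allI impI)
  fix u v :: "real \<Rightarrow> real" and u' v' t
  assume d: "(u has_real_derivative u') (at t)" "(v has_real_derivative v') (at t)"
  show "((\<lambda>t. G (u t) (v t) + H (u t) (v t)) has_real_derivative
      (gu (u t) (v t) + hu (u t) (v t)) * u' + (gv (u t) (v t) + hv (u t) (v t)) * v') (at t)"
    by (rule DERIV_cong[OF DERIV_add[OF has_gradientD[OF assms(1) d] has_gradientD[OF assms(2) d]]])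
       (simp add: algebra_simps)
qed

lemma has_gradient_mult:
  assumes "has_gradient G gu gv" "has_gradient H hu hv"
  shows "has_gradient (\<lambda>u v. G u v * H u v) (\<lambda>u v. gu u v * H u v + G u v * hu u v)
     (\<lambda>u v. gv u v * H u v + G u v * hv u v)"
  unfolding has_gradient_def
proof (intro allI impI)
  fix u v :: "real \<Rightarrow> real" and u' v' t
  assume d: "(u has_real_derivative u') (at t)" "(v has_real_derivative v') (at t)"
  show "((\<lambda>t. G (u t) (v t) * H (u t) (v t)) has_real_derivative
      (gu (u t) (v t) * H (u t) (v t) + G (u t) (v t) * hu (u t) (v t)) * u' +
      (gv (u t) (v t) * H (u t) (v t) + G (u t) (v t) * hv (u t) (v t)) * v') (at t)"
    by (rule DERIV_cong[OF DERIV_mult[OF has_gradientD[OF assms(1) d] has_gradientD[OF assms(2) d]]])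
       (simp add: algebra_simps)
qed

lemma has_gradient_powr:
  assumes "has_gradient H hu hv" "\<And>u v. H u v > 0"
  shows "has_gradient (\<lambda>u v. H u v powr s) (\<lambda>u v. s * H u v powr (s - 1) * hu u v)
    (\<lambda>u v. s * H u v powr (s - 1) * hv u v)"
  unfolding has_gradient_def
proof (intro allI impI)
  fix u v :: "real \<Rightarrow> real" and u' v' t
  assume d: "(u has_real_derivative u') (at t)" "(v has_real_derivative v') (at t)"
  show "((\<lambda>t. H (u t) (v t) powr s) has_real_derivative
      s * H (u t) (v t) powr (s - 1) * hu (u t) (v t) * u' + s * H (u t) (v t) powr (s - 1) * hv (u t) (v t) * v') (at t)"
    by (rule DERIV_cong[OF DERIV_fun_powr[OF has_gradientD[OF assms(1) d] assms(2)]])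
       (simp add: algebra_simps)
qed

lemma has_gradient_cong:
  assumes "has_gradient G gu gv" "\<And>u v. gu u v = gu' u v" "\<And>u v. gv u v = gv' u v"
  shows "has_gradient G gu' gv'"
proof -
  have "gu = gu'" "gv = gv'" using assms(2,3) by (auto simp: fun_eq_iff)
  then show ?thesis using assms(1) by simp
qed

lemmas has_gradient_intros = has_gradient_const has_gradient_fst has_gradient_snd
  has_gradient_add has_gradient_mult has_gradient_powr

lemma has_laplacian_add:
  assumes "has_laplacian G L" "has_laplacian H M"
  shows "has_laplacian (\<lambda>u v. G u v + H u v) (\<lambda>u v. L u v + M u v)"
proof -
  from assms(1) obtain gu gv guu guv gvu gvv where G: "has_gradient G gu gv" "has_gradient gu guu guv" "has_gradient gv gvu gvv"
     "plane_continuous G" "plane_continuous gu" "plane_continuous gv"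
     "plane_continuous guu" "plane_continuous guv" "plane_continuous gvu" "plane_continuous gvv"
     "\<forall>u v. L u v = guu u v + gvv u v" unfolding has_laplacian_def by blast
  from assms(2) obtain hu hv huu huv hvu hvv where H: "has_gradient H hu hv" "has_gradient hu huu huv" "has_gradient hv hvu hvv"
     "plane_continuous H" "plane_continuous hu" "plane_continuous hv"
     "plane_continuous huu" "plane_continuous huv" "plane_continuous hvu" "plane_continuous hvv"
     "\<forall>u v. M u v = huu u v + hvv u v" unfolding has_laplacian_def by blast
  show ?thesis
    unfolding has_laplacian_def
  proof (intro exI conjI allI)
    show "has_gradient (\<lambda>u v. G u v + H u v) (\<lambda>u v. gu u v + hu u v) (\<lambda>u v. gv u v + hv u v)"
      "has_gradient (\<lambda>u v. gu u v + hu u v) (\<lambda>u v. guu u v + huu u v) (\<lambda>u v. guv u v + huv u v)"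
      "has_gradient (\<lambda>u v. gv u v + hv u v) (\<lambda>u v. gvu u v + hvu u v) (\<lambda>u v. gvv u v + hvv u v)"
      by (intro has_gradient_add G H)+
    show "L u v + M u v = (guu u v + huu u v) + (gvv u v + hvv u v)" for u v
      using G(11) H(11) by simp
  qed (use G(4-10) H(4-10) in \<open>simp_all add: plane_continuous_def continuous_on_add\<close>)
qed

lemma has_laplacian_cmult:
  assumes "has_laplacian G L"
  shows "has_laplacian (\<lambda>u v. c * G u v) (\<lambda>u v. c * L u v)"
proof -
  from assms(1) obtain gu gv guu guv gvu gvv where G: "has_gradient G gu gv" "has_gradient gu guu guv" "has_gradient gv gvu gvv"
     "plane_continuous G" "plane_continuous gu" "plane_continuous gv"
     "plane_continuous guu" "plane_continuous guv" "plane_continuous gvu" "plane_continuous gvv"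
     "\<forall>u v. L u v = guu u v + gvv u v" unfolding has_laplacian_def by blast
  have g: "has_gradient (\<lambda>u v. c * F u v) (\<lambda>u v. c * fu u v) (\<lambda>u v. c * fv u v)" if "has_gradient F fu fv" for F fu fv
    by (rule has_gradient_cong[OF has_gradient_mult[OF has_gradient_const that]]) auto
  show ?thesis
    unfolding has_laplacian_def
  proof (intro exI conjI allI)
    show "has_gradient (\<lambda>u v. c * G u v) (\<lambda>u v. c * gu u v) (\<lambda>u v. c * gv u v)"
      "has_gradient (\<lambda>u v. c * gu u v) (\<lambda>u v. c * guu u v) (\<lambda>u v. c * guv u v)"
      "has_gradient (\<lambda>u v. c * gv u v) (\<lambda>u v. c * gvu u v) (\<lambda>u v. c * gvv u v)"
      by (intro g G)+
    show "c * L u v = c * guu u v + c * gvv u v" for u v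
      using G(11) by (simp add: algebra_simps)
  qed (use G(4-10) in \<open>simp_all add: plane_continuous_def continuous_on_mult_left\<close>)
qed

text \<open>
  The next three functions are the building blocks of the subharmonic functions used for the
  inequalities of M. Riesz and Kolmogorov; \<open>e > 0\<close> removes the singularity on the line \<open>u = 0\<close> or at
  the origin.
\<close>
lemma has_laplacian_real_powr:
  assumes e: "e > 0"
  shows "has_laplacian (\<lambda>u v. (e + u * u) powr s)
    (\<lambda>u v. 2 * s * (e + u * u) powr (s - 1) + 4 * s * (s - 1) * (u * u) * (e + u * u) powr (s - 2))"
proof -
  have pos: "e + u * u > 0" for u :: real using e by (simp add: add_pos_nonneg)
  then have nz: "e + u * u \<noteq> 0" for u :: real by (metis less_irrefl)
  show ?thesis
    unfolding has_laplacian_def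
  proof (intro exI conjI allI)
    show "has_gradient (\<lambda>u v. (e + u * u) powr s) (\<lambda>u v. 2 * s * u * (e + u * u) powr (s - 1)) (\<lambda>u v. 0)"
      by (rule has_gradient_cong, (rule has_gradient_intros pos)+) (simp_all add: algebra_simps)
    show "has_gradient (\<lambda>u v. 2 * s * u * (e + u * u) powr (s - 1))
        (\<lambda>u v. 2 * s * (e + u * u) powr (s - 1) + 4 * s * (s - 1) * (u * u) * (e + u * u) powr (s - 2)) (\<lambda>u v. 0)"
      by (rule has_gradient_cong, (rule has_gradient_intros pos)+) (simp_all add: algebra_simps)
    show "has_gradient (\<lambda>u v. 0) (\<lambda>u v. 0) (\<lambda>u v. 0)" by (rule has_gradient_const)
  qed (auto simp: plane_continuous_def intro!: continuous_intros nz)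
qed

lemma has_laplacian_norm_powr:
  assumes e: "e > 0"
  shows "has_laplacian (\<lambda>u v. (e + u * u + v * v) powr s)
    (\<lambda>u v. 4 * s * (e + u * u + v * v) powr (s - 1) + 4 * s * (s - 1) * (u * u + v * v) * (e + u * u + v * v) powr (s - 2))"
proof -
  have pos: "e + u * u + v * v > 0" for u v :: real using e by (simp add: add_pos_nonneg)
  then have nz: "e + u * u + v * v \<noteq> 0" for u v :: real by (metis less_irrefl)
  show ?thesis
    unfolding has_laplacian_def
  proof (intro exI conjI allI)
    show "has_gradient (\<lambda>u v. (e + u * u + v * v) powr s) (\<lambda>u v. 2 * s * u * (e + u * u + v * v) powr (s - 1))
        (\<lambda>u v. 2 * s * v * (e + u * u + v * v) powr (s - 1))"
      by (rule has_gradient_cong, (rule has_gradient_intros pos)+) (simp_all add: algebra_simps)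
    show "has_gradient (\<lambda>u v. 2 * s * u * (e + u * u + v * v) powr (s - 1))
        (\<lambda>u v. 2 * s * (e + u * u + v * v) powr (s - 1) + 4 * s * (s - 1) * (u * u) * (e + u * u + v * v) powr (s - 2))
        (\<lambda>u v. 4 * s * (s - 1) * (u * v) * (e + u * u + v * v) powr (s - 2))"
      by (rule has_gradient_cong, (rule has_gradient_intros pos)+) (simp_all add: algebra_simps)
    show "has_gradient (\<lambda>u v. 2 * s * v * (e + u * u + v * v) powr (s - 1))
        (\<lambda>u v. 4 * s * (s - 1) * (u * v) * (e + u * u + v * v) powr (s - 2))
        (\<lambda>u v. 2 * s * (e + u * u + v * v) powr (s - 1) + 4 * s * (s - 1) * (v * v) * (e + u * u + v * v) powr (s - 2))"
      by (rule has_gradient_cong, (rule has_gradient_intros pos)+) (simp_all add: algebra_simps)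
  qed (auto simp: plane_continuous_def algebra_simps intro!: continuous_intros nz[simplified algebra_simps])
qed

lemma has_laplacian_mixed_powr:
  assumes e: "e > 0"
  shows "has_laplacian (\<lambda>u v. (u * u) * (e + u * u + v * v) powr s)
    (\<lambda>u v. 2 * (e + u * u + v * v) powr s + 12 * s * (u * u) * (e + u * u + v * v) powr (s - 1)
       + 4 * s * (s - 1) * (u * u) * (u * u + v * v) * (e + u * u + v * v) powr (s - 2))"
proof -
  have pos: "e + u * u + v * v > 0" for u v :: real using e by (simp add: add_pos_nonneg)
  then have nz: "e + u * u + v * v \<noteq> 0" for u v :: real by (metis less_irrefl)
  show ?thesis
    unfolding has_laplacian_def
  proof (intro exI conjI allI)
    show "has_gradient (\<lambda>u v. (u * u) * (e + u * u + v * v) powr s)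
        (\<lambda>u v. 2 * u * (e + u * u + v * v) powr s + 2 * s * (u * u * u) * (e + u * u + v * v) powr (s - 1))
        (\<lambda>u v. 2 * s * (u * u * v) * (e + u * u + v * v) powr (s - 1))"
      by (rule has_gradient_cong, (rule has_gradient_intros pos)+) (simp_all add: algebra_simps)
    show "has_gradient (\<lambda>u v. 2 * u * (e + u * u + v * v) powr s + 2 * s * (u * u * u) * (e + u * u + v * v) powr (s - 1))
        (\<lambda>u v. 2 * (e + u * u + v * v) powr s + 10 * s * (u * u) * (e + u * u + v * v) powr (s - 1)
           + 4 * s * (s - 1) * (u * u * u * u) * (e + u * u + v * v) powr (s - 2))
        (\<lambda>u v. 4 * s * (u * v) * (e + u * u + v * v) powr (s - 1)
           + 4 * s * (s - 1) * (u * u * u * v) * (e + u * u + v * v) powr (s - 2))"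
      by (rule has_gradient_cong, (rule has_gradient_intros pos)+) (simp_all add: algebra_simps)
    show "has_gradient (\<lambda>u v. 2 * s * (u * u * v) * (e + u * u + v * v) powr (s - 1))
        (\<lambda>u v. 4 * s * (u * v) * (e + u * u + v * v) powr (s - 1)
           + 4 * s * (s - 1) * (u * u * u * v) * (e + u * u + v * v) powr (s - 2))
        (\<lambda>u v. 2 * s * (u * u) * (e + u * u + v * v) powr (s - 1)
           + 4 * s * (s - 1) * (u * u * v * v) * (e + u * u + v * v) powr (s - 2))"
      by (rule has_gradient_cong, (rule has_gradient_intros pos)+) (simp_all add: algebra_simps)
  qed (auto simp: plane_continuous_def algebra_simps intro!: continuous_intros nz[simplified algebra_simps])
qed

section \<open>Means of subharmonic functions along the line\<close>

text \<open>
  The \<open>k\<close>-th derivative, at \<open>t + iy\<close>, of the sum of \<open>c_j exp (i l_j z)\<close>.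
\<close>
definition upper_extension :: "'j set \<Rightarrow> ('j \<Rightarrow> complex) \<Rightarrow> ('j \<Rightarrow> real) \<Rightarrow> nat \<Rightarrow> real \<Rightarrow> real \<Rightarrow> complex" where
  "upper_extension J c l k y t = (\<Sum>j\<in>J. (\<i> * l j) ^ k * c j * of_real (exp (- l j * y)) * cis (l j * t))"

lemma DERIV_Re_Im_of_complex:
  assumes "(f has_vector_derivative d) (at x)"
  shows "((\<lambda>x. Re (f x)) has_real_derivative Re d) (at x)" "((\<lambda>x. Im (f x)) has_real_derivative Im d) (at x)"
  using bounded_linear.has_vector_derivative[OF bounded_linear_Re assms]
    bounded_linear.has_vector_derivative[OF bounded_linear_Im assms]
  by (simp_all add: has_real_derivative_iff_has_vector_derivative)

lemma upper_extension_deriv_t: "((\<lambda>t. upper_extension J c l k y t) has_vector_derivative upper_extension J c l (Suc k) y t) (at t)"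
  unfolding upper_extension_def
proof (rule has_vector_derivative_sum)
  fix j
  define C where "C = (\<i> * l j) ^ k * c j * of_real (exp (- l j * y))"
  have "((\<lambda>z. C * exp (\<i> * (l j * z))) has_field_derivative
      C * (exp (\<i> * (l j * of_real t)) * (\<i> * l j))) (at (of_real t))"
    by (auto intro!: derivative_eq_intros)
  from has_vector_derivative_real_field[OF this]
  show "((\<lambda>t. (\<i> * l j) ^ k * c j * of_real (exp (- l j * y)) * cis (l j * t)) has_vector_derivative
      (\<i> * l j) ^ Suc k * c j * of_real (exp (- l j * y)) * cis (l j * t)) (at t)"
    unfolding C_def by (simp add: cis_conv_exp mult_ac)
qed

lemma upper_extension_deriv_y: "((\<lambda>y. upper_extension J c l k y t) has_vector_derivative \<i> * upper_extension J c l (Suc k) y t) (at y)"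
  unfolding upper_extension_def sum_distrib_left
proof (rule has_vector_derivative_sum)
  fix j
  have "((\<lambda>z. (\<i> * l j) ^ k * c j * exp (complex_of_real (- l j) * z) * cis (l j * t)) has_field_derivative
      \<i> * ((\<i> * l j) ^ Suc k * c j * exp (complex_of_real (- l j) * of_real y) * cis (l j * t))) (at (of_real y))"
    by (auto intro!: derivative_eq_intros simp: algebra_simps)
  from has_vector_derivative_real_field[OF this]
  show "((\<lambda>y. (\<i> * l j) ^ k * c j * of_real (exp (- l j * y)) * cis (l j * t)) has_vector_derivative
      \<i> * ((\<i> * l j) ^ Suc k * c j * of_real (exp (- l j * y)) * cis (l j * t))) (at y)"
    by (simp flip: exp_of_real)
qed

lemmas upper_extension_Re_t = DERIV_Re_Im_of_complex(1)[OF upper_extension_deriv_t]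
lemmas upper_extension_Im_t = DERIV_Re_Im_of_complex(2)[OF upper_extension_deriv_t]
lemmas upper_extension_Re_y = DERIV_Re_Im_of_complex(1)[OF upper_extension_deriv_y]
lemmas upper_extension_Im_y = DERIV_Re_Im_of_complex(2)[OF upper_extension_deriv_y]

lemma continuous_upper_extension: "continuous_on S (\<lambda>z. upper_extension J c l k (fst z) (snd z))"
  unfolding upper_extension_def by (intro continuous_intros)

lemma norm_upper_extension_le:
  assumes "\<And>j. j \<in> J \<Longrightarrow> m \<le> l j" "m \<ge> 0" "y \<ge> 0"
  shows "norm (upper_extension J c l k y t) \<le> (\<Sum>j\<in>J. l j ^ k * norm (c j)) * exp (- m * y)"
  unfolding upper_extension_def sum_distrib_right
proof (rule order_trans[OF norm_sum sum_mono])
  fix j assume j: "j \<in> J"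
  have "exp (- l j * y) \<le> exp (- m * y)"
    using assms(1)[OF j] assms(3) by (simp add: mult_right_mono)
  moreover have "l j \<ge> 0" using assms(1)[OF j] assms(2) by linarith
  ultimately show "norm ((\<i> * l j) ^ k * c j * of_real (exp (- l j * y)) * cis (l j * t)) \<le> l j ^ k * norm (c j) * exp (- m * y)"
    by (simp add: norm_mult norm_power mult_left_mono)
qed

text \<open>
  Let \<open>U(y, t) = G(f(t + iy))\<close>. By the Cauchy-Riemann equations the Laplacian of \<open>U\<close> is \<open>|f'|\<^sup>2\<close> times
  that of \<open>G\<close>, hence nonnegative. So the integral \<open>k(y)\<close> of \<open>U(y, t)\<close> over \<open>0 \<le> t \<le> T\<close> satisfies
  \<open>k'' \<ge> - \<integral> U_tt\<close>, and this is a difference of two boundary values of \<open>U_t\<close>, bounded independently of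
  \<open>T\<close>. Therefore \<open>k\<close> plus a fixed multiple of \<open>y\<^sup>2\<close> is convex and lies above its tangent at \<open>Y\<close>. The
  slope \<open>k'(Y)\<close> is exponentially small since all frequencies are at least \<open>m\<close>.
\<close>
lemma subharmonic_integral_lower:
  assumes lap: "has_laplacian G L" and sub: "\<And>u v. L u v \<ge> 0"
    and J: "finite J" and m: "m > 0" "\<And>j. j \<in> J \<Longrightarrow> m \<le> l j"
  shows "\<exists>B K. \<forall>T>0. \<forall>Y\<ge>0.
    integral {0..T} (\<lambda>t. G (Re (upper_extension J c l 0 0 t)) (Im (upper_extension J c l 0 0 t))) \<ge>
    integral {0..T} (\<lambda>t. G (Re (upper_extension J c l 0 Y t)) (Im (upper_extension J c l 0 Y t))) - Y * T * (K * exp (- m * Y)) - B * Y\<^sup>2"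
proof -
  from lap obtain gu gv guu guv gvu gvv where G: "has_gradient G gu gv" "has_gradient gu guu guv" "has_gradient gv gvu gvv"
     "plane_continuous G" "plane_continuous gu" "plane_continuous gv"
     "plane_continuous guu" "plane_continuous guv" "plane_continuous gvu" "plane_continuous gvv"
     "\<forall>u v. L u v = guu u v + gvv u v" unfolding has_laplacian_def by blast
  define F where "F = upper_extension J c l"
  define u where "u = (\<lambda>y t. Re (F 0 y t))"
  define v where "v = (\<lambda>y t. Im (F 0 y t))"
  define A where "A = (\<lambda>y t. Re (F 1 y t))"
  define B where "B = (\<lambda>y t. Im (F 1 y t))"
  define A2 where "A2 = (\<lambda>y t. Re (F 2 y t))"
  define B2 where "B2 = (\<lambda>y t. Im (F 2 y t))"
  note defs = u_def v_def A_def B_def A2_def B2_def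
  have dt: "((\<lambda>t. u y t) has_real_derivative A y t) (at t)" "((\<lambda>t. v y t) has_real_derivative B y t) (at t)"
    "((\<lambda>t. A y t) has_real_derivative A2 y t) (at t)" "((\<lambda>t. B y t) has_real_derivative B2 y t) (at t)" for y t
    using upper_extension_Re_t[of J c l 0 y t] upper_extension_Im_t[of J c l 0 y t] upper_extension_Re_t[of J c l 1 y t] upper_extension_Im_t[of J c l 1 y t]
    unfolding defs F_def by (simp_all add: numeral_2_eq_2)
  have dy: "((\<lambda>y. u y t) has_real_derivative - B y t) (at y)" "((\<lambda>y. v y t) has_real_derivative A y t) (at y)"
    "((\<lambda>y. A y t) has_real_derivative - B2 y t) (at y)" "((\<lambda>y. B y t) has_real_derivative A2 y t) (at y)" for y t
    using upper_extension_Re_y[of J c l 0 t y] upper_extension_Im_y[of J c l 0 t y] upper_extension_Re_y[of J c l 1 t y] upper_extension_Im_y[of J c l 1 t y]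
    unfolding defs F_def by (simp_all add: numeral_2_eq_2)
  define P where "P = (\<lambda>y t. G (u y t) (v y t))"
  define Pt where "Pt = (\<lambda>y t. gu (u y t) (v y t) * A y t + gv (u y t) (v y t) * B y t)"
  define Py where "Py = (\<lambda>y t. gv (u y t) (v y t) * A y t - gu (u y t) (v y t) * B y t)"
  define Ptt where "Ptt = (\<lambda>y t. (guu (u y t) (v y t) * A y t + guv (u y t) (v y t) * B y t) * A y t + gu (u y t) (v y t) * A2 y t +
     (gvu (u y t) (v y t) * A y t + gvv (u y t) (v y t) * B y t) * B y t + gv (u y t) (v y t) * B2 y t)"
  define Pyy where "Pyy = (\<lambda>y t. (guu (u y t) (v y t) * B y t - guv (u y t) (v y t) * A y t) * B y t - gu (u y t) (v y t) * A2 y t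
     + (gvv (u y t) (v y t) * A y t - gvu (u y t) (v y t) * B y t) * A y t - gv (u y t) (v y t) * B2 y t)"
  have dPt: "(Pt y has_real_derivative Ptt y t) (at t)" for y t
    unfolding Pt_def Ptt_def
    by (rule DERIV_cong[OF DERIV_add[OF DERIV_mult[OF has_gradientD[OF G(2) dt(1,2)] dt(3)] DERIV_mult[OF has_gradientD[OF G(3) dt(1,2)] dt(4)]]])
       (simp add: algebra_simps)
  have dP: "((\<lambda>y. P y t) has_real_derivative Py y t) (at y)" for y t
    unfolding P_def Py_def
    by (rule DERIV_cong[OF has_gradientD[OF G(1) dy(1,2)]]) (simp add: algebra_simps)
  have dPy: "((\<lambda>y. Py y t) has_real_derivative Pyy y t) (at y)" for y t
    unfolding Py_def Pyy_def
    by (rule DERIV_cong[OF DERIV_diff[OF DERIV_mult[OF has_gradientD[OF G(3) dy(1,2)] dy(3)] DERIV_mult[OF has_gradientD[OF G(2) dy(1,2)] dy(4)]]])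
       (simp add: algebra_simps)
  have cF: "continuous_on S (\<lambda>z. F k (fst z) (snd z))" for k S
    unfolding F_def by (rule continuous_upper_extension)
  have cr: "continuous_on S (\<lambda>z. u (fst z) (snd z))" "continuous_on S (\<lambda>z. v (fst z) (snd z))"
    "continuous_on S (\<lambda>z. A (fst z) (snd z))" "continuous_on S (\<lambda>z. B (fst z) (snd z))"
    "continuous_on S (\<lambda>z. A2 (fst z) (snd z))" "continuous_on S (\<lambda>z. B2 (fst z) (snd z))" for S
    unfolding defs by (intro continuous_on_Re continuous_on_Im cF)+
  note cg = plane_continuousD[OF _ cr(1,2)]
  have cP: "continuous_on S (\<lambda>z. P (fst z) (snd z))" "continuous_on S (\<lambda>z. Py (fst z) (snd z))"
    "continuous_on S (\<lambda>z. Pyy (fst z) (snd z))" "continuous_on S (\<lambda>z. Ptt (fst z) (snd z))" for S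
    unfolding P_def Py_def Pyy_def Ptt_def
    by (intro continuous_on_add continuous_on_diff continuous_on_mult cr cg G)+
  have sect: "continuous_on S (h y)" if "\<And>S. continuous_on S (\<lambda>z. h (fst z) (snd z))" for h :: "real \<Rightarrow> real \<Rightarrow> real" and y S
    using continuous_on_compose2[OF that[of UNIV], of S "\<lambda>t. (y, t)"] by (simp add: continuous_on_Pair)
  have lap_ge: "Pyy y t + Ptt y t \<ge> 0" for y t
  proof -
    have "Pyy y t + Ptt y t = L (u y t) (v y t) * ((A y t)\<^sup>2 + (B y t)\<^sup>2)"
      unfolding Pyy_def Ptt_def G(11)[rule_format] by (simp add: algebra_simps power2_eq_square)
    then show ?thesis using sub by simp
  qed
  define R where "R = (\<lambda>k. \<Sum>j\<in>J. l j ^ k * norm (c j))"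
  have R: "norm (F k y t) \<le> R k * exp (- m * y)" if "y \<ge> 0" for k y t
    unfolding F_def R_def using norm_upper_extension_le[of J m l y c k t] m that by simp
  have R0: "R k \<ge> 0" for k
    unfolding R_def using m by (intro sum_nonneg mult_nonneg_nonneg zero_le_power) (auto intro: order_trans[of 0 m])
  have Rb: "norm (F k y t) \<le> R k" if "y \<ge> 0" for k y t
  proof -
    have "R k * exp (- m * y) \<le> R k * 1"
      using R0 m that by (intro mult_left_mono) auto
    then show ?thesis using R[OF that, of k t] by linarith
  qed
  define S where "S = {-R 0..R 0} \<times> {-R 0..R 0}"
  have uvS: "(u y t, v y t) \<in> S" if "y \<ge> 0" for y t
    using Rb[OF that, of 0 t] abs_Re_le_cmod[of "F 0 y t"] abs_Im_le_cmod[of "F 0 y t"]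
    unfolding S_def u_def v_def by (auto simp: abs_le_iff)
  have bd: "\<exists>M\<ge>0. \<forall>y\<ge>0. \<forall>t. \<bar>g (u y t) (v y t)\<bar> \<le> M" if "plane_continuous g" for g
  proof -
    have "compact ((\<lambda>z. g (fst z) (snd z)) ` S)"
      using that unfolding S_def plane_continuous_def
      by (intro compact_continuous_image compact_Times compact_Icc) (auto intro: continuous_on_subset)
    then obtain M where "\<forall>x\<in>(\<lambda>z. g (fst z) (snd z)) ` S. norm x \<le> M"
      using compact_imp_bounded bounded_iff by blast
    then have "\<forall>y\<ge>0. \<forall>t. \<bar>g (u y t) (v y t)\<bar> \<le> M" using uvS by fastforce
    then show ?thesis by (intro exI[of _ "max M 0"]) (auto simp: le_max_iff_disj)
  qed
  obtain Mu where Mu: "Mu \<ge> 0" "\<And>y t. y \<ge> 0 \<Longrightarrow> \<bar>gu (u y t) (v y t)\<bar> \<le> Mu" using bd[OF G(5)] by blast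
  obtain Mv where Mv: "Mv \<ge> 0" "\<And>y t. y \<ge> 0 \<Longrightarrow> \<bar>gv (u y t) (v y t)\<bar> \<le> Mv" using bd[OF G(6)] by blast
  define K where "K = (Mu + Mv) * R 1"
  have AB: "\<bar>A y t\<bar> \<le> R 1 * exp (- m * y)" "\<bar>B y t\<bar> \<le> R 1 * exp (- m * y)" if "y \<ge> 0" for y t
    using R[OF that, of 1 t] abs_Re_le_cmod[of "F 1 y t"] abs_Im_le_cmod[of "F 1 y t"]
    unfolding A_def B_def by linarith+
  have "\<bar>Py y t\<bar> \<le> Mv * (R 1 * exp (- m * y)) + Mu * (R 1 * exp (- m * y))" if "y \<ge> 0" for y t
    unfolding Py_def using AB[OF that] Mu Mv that
    by (intro order_trans[OF abs_triangle_ineq4] add_mono) (auto simp: abs_mult intro!: mult_mono)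
  then have Py_le: "\<bar>Py y t\<bar> \<le> K * exp (- m * y)" if "y \<ge> 0" for y t
    using that by (simp only: K_def distrib_right mult.assoc add.commute)
  have Pt_le: "\<bar>Pt y t\<bar> \<le> K" if y: "y \<ge> 0" for y t
  proof -
    have "\<bar>A y t\<bar> \<le> R 1" "\<bar>B y t\<bar> \<le> R 1"
      using Rb[OF that, of 1 t] abs_Re_le_cmod[of "F 1 y t"] abs_Im_le_cmod[of "F 1 y t"]
      unfolding A_def B_def by linarith+
    then have "\<bar>Pt y t\<bar> \<le> Mu * R 1 + Mv * R 1"
      unfolding Pt_def using Mu Mv y
      by (intro order_trans[OF abs_triangle_ineq] add_mono) (auto simp: abs_mult intro!: mult_mono)
    then show ?thesis unfolding K_def by (simp add: algebra_simps)
  qed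
  have "integral {0..T} (P 0) \<ge> integral {0..T} (P Y) - Y * T * (K * exp (- m * Y)) - K * Y\<^sup>2"
    if T: "T > 0" and Y: "Y \<ge> 0" for T Y
  proof -
    define k where "k = (\<lambda>y. integral {0..T} (P y))"
    define k1 where "k1 = (\<lambda>y. integral {0..T} (Py y))"
    define k2 where "k2 = (\<lambda>y. integral {0..T} (Pyy y))"
    have int: "P y integrable_on {0..T}" "Py y integrable_on {0..T}" "Pyy y integrable_on {0..T}" "Ptt y integrable_on {0..T}" for y
      by (intro integrable_continuous_real sect cP)+
    have dk: "(k has_real_derivative k1 y) (at y)" for y
      unfolding k_def k1_def
      using leibniz_rule_field_derivative[of UNIV 0 T P Py y] dP int(1) cP(2)[of "UNIV \<times> {0..T}"]
      by (simp add: split_beta)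
    have dk1: "(k1 has_real_derivative k2 y) (at y)" for y
      unfolding k1_def k2_def
      using leibniz_rule_field_derivative[of UNIV 0 T Py Pyy y] dPy int(2) cP(3)[of "UNIV \<times> {0..T}"]
      by (simp add: split_beta)
    have k2: "k2 y \<ge> - (2 * K)" if "y \<ge> 0" for y
    proof -
      have "(Ptt y has_integral (Pt y T - Pt y 0)) {0..T}"
        using T dPt by (intro fundamental_theorem_of_calculus)
          (auto simp flip: has_real_derivative_iff_has_vector_derivative intro: DERIV_subset)
      then have "integral {0..T} (Ptt y) = Pt y T - Pt y 0" by (rule integral_unique)
      moreover have "0 \<le> integral {0..T} (\<lambda>t. Pyy y t + Ptt y t)"
        using lap_ge int by (intro integral_nonneg integrable_add) auto
      moreover have "integral {0..T} (\<lambda>t. Pyy y t + Ptt y t) = k2 y + integral {0..T} (Ptt y)"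
        unfolding k2_def using int by (intro integral_add) auto
      ultimately show ?thesis using Pt_le[OF that, of T] Pt_le[OF that, of 0] by linarith
    qed
    \<comment> \<open>convex on \<open>{0..Y}\<close> since \<open>k2 \<ge> - 2 K\<close>\<close>
    define h where "h = (\<lambda>y. k y + K * y\<^sup>2)"
    have "(k1 Y + 2 * K * Y) * (0 - Y) \<le> h 0 - h Y"
    proof (rule f''_imp_f'[where C = "{0..Y}" and f'' = "\<lambda>y. k2 y + 2 * K"])
      show "(h has_real_derivative k1 y + 2 * K * y) (at y)" for y
        unfolding h_def using dk by (auto intro!: derivative_eq_intros)
      show "((\<lambda>y. k1 y + 2 * K * y) has_real_derivative k2 y + 2 * K) (at y)" for y
        using dk1 by (auto intro!: derivative_eq_intros)
    qed (use k2 Y in force)+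
    moreover have "\<bar>k1 Y\<bar> \<le> K * exp (- m * Y) * (T - 0)"
      unfolding k1_def using T Py_le[OF Y]
      by (subst real_norm_def[symmetric], intro integral_bound sect cP) auto
    then have "k1 Y * Y \<le> (K * exp (- m * Y) * T) * Y"
      using Y by (intro mult_right_mono) auto
    ultimately show ?thesis
      unfolding h_def k_def by (simp add: algebra_simps power2_eq_square)
  qed
  then show ?thesis
    unfolding P_def u_def v_def F_def by blast
qed

definition mean_upto :: "real \<Rightarrow> (real \<Rightarrow> real) \<Rightarrow> real" where
  "mean_upto T \<phi> = 1 / T * integral {0..T} \<phi>"

text \<open>
  As \<open>Y \<rightarrow> \<infinity>\<close> the function tends to \<open>0\<close> on the line of height \<open>Y\<close>, because all its frequencies are
  positive. The error terms of \<open>subharmonic_integral_lower\<close> vanish if first \<open>T\<close> and then \<open>Y\<close> tends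
  to infinity.
\<close>
lemma subharmonic_mean_ge:
  assumes lap: "has_laplacian G L" and sub: "\<And>u v. L u v \<ge> 0"
    and J: "finite J" and l: "\<And>j. j \<in> J \<Longrightarrow> l j > 0" and e: "e > 0"
  shows "eventually (\<lambda>T. mean_upto T (\<lambda>t. G (Re (\<Sum>j\<in>J. c j * cis (l j * t))) (Im (\<Sum>j\<in>J. c j * cis (l j * t)))) \<ge> G 0 0 - e) at_top"
proof -
  have "\<exists>m>0. \<forall>j\<in>J. m \<le> l j"
    using J l
  proof (induction J rule: finite_induct)
    case empty
    then show ?case by (intro exI[of _ 1]) auto
  next
    case (insert x J)
    then obtain m where "m > 0" "\<forall>j\<in>J. m \<le> l j" by auto
    then show ?case using insert.prems by (intro exI[of _ "min m (l x)"]) auto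
  qed
  then obtain m where m: "m > 0" "\<And>j. j \<in> J \<Longrightarrow> m \<le> l j" by blast
  obtain B K where BK: "\<And>T Y. T > 0 \<Longrightarrow> Y \<ge> 0 \<Longrightarrow>
    integral {0..T} (\<lambda>t. G (Re (upper_extension J c l 0 0 t)) (Im (upper_extension J c l 0 0 t))) \<ge>
    integral {0..T} (\<lambda>t. G (Re (upper_extension J c l 0 Y t)) (Im (upper_extension J c l 0 Y t))) - Y * T * (K * exp (- m * Y)) - B * Y\<^sup>2"
    using subharmonic_integral_lower[where l = l and c = c, OF lap sub J m] by blast
  have cG: "plane_continuous G" using lap unfolding has_laplacian_def by blast
  have "isCont (\<lambda>z. G (fst z) (snd z)) (0, 0)"
    using cG unfolding plane_continuous_def by (simp add: continuous_on_eq_continuous_at)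
  then obtain d where d: "d > 0" "\<And>z. dist z (0, 0) < d \<Longrightarrow> dist (G (fst z) (snd z)) (G 0 0) < e / 3"
    unfolding continuous_at_eps_delta using e by (metis fst_conv snd_conv divide_pos_pos zero_less_numeral)
  define R where "R = (\<Sum>j\<in>J. l j ^ 0 * norm (c j))"
  have lim: "((\<lambda>Y. Y * (K * exp (- m * Y))) \<longlongrightarrow> 0) at_top" "((\<lambda>Y. R * exp (- m * Y)) \<longlongrightarrow> 0) at_top"
    using m(1) by real_asymp+
  have "\<forall>\<^sub>F Y in at_top. Y * (K * exp (- m * Y)) < e / 3 \<and> R * exp (- m * Y) < d \<and> Y \<ge> 0"
    using order_tendstoD(2)[OF lim(1), of "e / 3"] order_tendstoD(2)[OF lim(2) d(1)] e
    by (intro eventually_conj eventually_ge_at_top) auto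
  then obtain Y where Y: "Y * (K * exp (- m * Y)) < e / 3" "R * exp (- m * Y) < d" "Y \<ge> 0"
    using eventually_happens'[OF trivial_limit_at_top_linorder] by blast
  have near: "G (Re (upper_extension J c l 0 Y t)) (Im (upper_extension J c l 0 Y t)) \<ge> G 0 0 - e / 3" for t
  proof -
    have "dist (Re (upper_extension J c l 0 Y t), Im (upper_extension J c l 0 Y t)) (0, 0) = norm (upper_extension J c l 0 Y t)"
      by (simp add: dist_norm norm_Pair cmod_def)
    also have "\<dots> < d"
      using norm_upper_extension_le[of J m l Y c 0 t] m Y unfolding R_def by simp
    finally have "dist (Re (upper_extension J c l 0 Y t), Im (upper_extension J c l 0 Y t)) (0, 0) < d" .
    from d(2)[OF this] show ?thesis
      unfolding fst_conv snd_conv dist_real_def by linarith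
  qed
  have cu: "continuous_on S (\<lambda>t. G (Re (upper_extension J c l 0 y t)) (Im (upper_extension J c l 0 y t)))" for y S
    unfolding upper_extension_def by (intro plane_continuousD[OF cG] continuous_intros)
  have "((\<lambda>T. B * Y\<^sup>2 / T) \<longlongrightarrow> 0) at_top"
    by (intro real_tendsto_divide_at_top[where c = "B * Y\<^sup>2"] filterlim_ident) auto
  then have "\<forall>\<^sub>F T in at_top. B * Y\<^sup>2 / T < e / 3"
    using e by (intro order_tendstoD) auto
  then show ?thesis
    using eventually_gt_at_top[of 0]
  proof eventually_elim
    case (elim T)
    have "integral {0..T} (\<lambda>t. G 0 0 - e / 3) \<le> integral {0..T} (\<lambda>t. G (Re (upper_extension J c l 0 Y t)) (Im (upper_extension J c l 0 Y t)))"
      using near by (intro integral_le integrable_continuous_real cu) auto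
    then have "integral {0..T} (\<lambda>t. G (Re (upper_extension J c l 0 0 t)) (Im (upper_extension J c l 0 0 t))) \<ge>
        T * (G 0 0 - e / 3) - T * (Y * (K * exp (- m * Y))) - B * Y\<^sup>2"
      using BK[OF elim(2) Y(3)] elim(2) by (simp add: mult_ac)
    moreover have "T * (Y * (K * exp (- m * Y))) \<le> T * (e / 3)"
      using Y elim by (intro mult_left_mono) auto
    moreover have "B * Y\<^sup>2 \<le> T * (e / 3)"
      using elim by (simp add: field_simps)
    ultimately have "integral {0..T} (\<lambda>t. G (Re (upper_extension J c l 0 0 t)) (Im (upper_extension J c l 0 0 t))) \<ge>
        T * (G 0 0 - e / 3) - T * (e / 3) - T * (e / 3)" by linarith
    also have "T * (G 0 0 - e / 3) - T * (e / 3) - T * (e / 3) = T * (G 0 0 - e)"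
      by (simp add: algebra_simps)
    finally have "G 0 0 - e \<le> integral {0..T} (\<lambda>t. G (Re (upper_extension J c l 0 0 t)) (Im (upper_extension J c l 0 0 t))) / T"
      using elim by (simp add: field_simps)
    then show ?case
      by (simp add: mean_upto_def upper_extension_def)
  qed
qed

section \<open>The inequalities of M. Riesz and Kolmogorov\<close>

lemma mean_upto_le:
  assumes "continuous_on UNIV \<phi>" "continuous_on UNIV \<psi>" "continuous_on UNIV \<rho>" "T > 0"
    and "\<And>t. \<phi> t \<le> A * \<psi> t + B - \<rho> t"
  shows "mean_upto T \<phi> \<le> A * mean_upto T \<psi> + B - mean_upto T \<rho>"
proof -
  have i: "\<phi> integrable_on {0..T}" "\<psi> integrable_on {0..T}" "\<rho> integrable_on {0..T}"
    by (auto intro!: integrable_continuous_real intro: continuous_on_subset[OF assms(1)]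
        continuous_on_subset[OF assms(2)] continuous_on_subset[OF assms(3)])
  have "integral {0..T} \<phi> \<le> integral {0..T} (\<lambda>t. A * \<psi> t + B - \<rho> t)"
    using i assms(5) by (intro integral_le integrable_add integrable_diff integrable_on_mult_right) auto
  also have "\<dots> = A * integral {0..T} \<psi> + B * T - integral {0..T} \<rho>"
  proof (rule integral_unique)
    have "((\<lambda>t. B) has_integral B * T) {0..T}"
      using has_integral_const_real[of B 0 T] assms(4) by (simp add: mult.commute)
    then show "((\<lambda>t. A * \<psi> t + B - \<rho> t) has_integral A * integral {0..T} \<psi> + B * T - integral {0..T} \<rho>) {0..T}"
      by (intro has_integral_add has_integral_diff has_integral_mult_right integrable_integral i)
  qed
  finally have "1 / T * integral {0..T} \<phi> \<le> 1 / T * (A * integral {0..T} \<psi> + B * T - integral {0..T} \<rho>)"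
    using assms(4) by (intro mult_left_mono) auto
  then show ?thesis
    using assms(4) by (simp add: mean_upto_def diff_divide_distrib add_divide_distrib)
qed

lemma riesz_from_subharmonic:
  fixes c :: "'j \<Rightarrow> complex" and l :: "'j \<Rightarrow> real"
  assumes lap: "has_laplacian G L" "\<And>u v. L u v \<ge> 0"
    and J: "finite J" "\<And>j. j \<in> J \<Longrightarrow> l j > 0" and e: "e > 0" and qr: "q > 0" "r > 0"
    and pw: "\<And>w. norm w powr q \<le> A * \<bar>Re w\<bar> powr r + B - G (Re w) (Im w)"
  defines "f \<equiv> \<lambda>t. \<Sum>j\<in>J. c j * cis (l j * t)"
  shows "eventually (\<lambda>T. mean_upto T (\<lambda>t. norm (f t) powr q) \<le> A * mean_upto T (\<lambda>t. \<bar>Re (f t)\<bar> powr r) + B - G 0 0 + e) at_top"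
proof -
  have cG: "plane_continuous G" using lap unfolding has_laplacian_def by blast
  have cf: "continuous_on UNIV f" unfolding f_def by (intro continuous_intros)
  have c1: "continuous_on UNIV (\<lambda>t. norm (f t) powr q)"
    by (intro continuous_on_powr_norm cf qr)
  have c2: "continuous_on UNIV (\<lambda>t. \<bar>Re (f t)\<bar> powr r)"
    using continuous_on_powr_norm[OF continuous_on_Re[OF cf] qr(2)] by simp
  have c3: "continuous_on UNIV (\<lambda>t. G (Re (f t)) (Im (f t)))"
    by (intro plane_continuousD[OF cG] continuous_on_Re continuous_on_Im cf)
  have ev: "eventually (\<lambda>T. mean_upto T (\<lambda>t. G (Re (f t)) (Im (f t))) \<ge> G 0 0 - e) at_top"
    unfolding f_def by (rule subharmonic_mean_ge[OF lap J(1) J(2) e])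
  show ?thesis
    using ev eventually_gt_at_top[of 0]
  proof eventually_elim
    case (elim T)
    have "mean_upto T (\<lambda>t. norm (f t) powr q) \<le> A * mean_upto T (\<lambda>t. \<bar>Re (f t)\<bar> powr r) + B - mean_upto T (\<lambda>t. G (Re (f t)) (Im (f t)))"
      by (rule mean_upto_le[OF c1 c2 c3 elim(2) pw])
    then show ?case using elim(1) by linarith
  qed
qed

lemma powr_sum_le:
  fixes x y s :: real
  assumes "x \<ge> 0" "y \<ge> 0" "s \<ge> 0"
  shows "(x + y) powr s \<le> 2 powr s * (x powr s + y powr s)"
proof -
  have "(x + y) powr s \<le> (2 * max x y) powr s"
    using assms by (intro powr_mono2) auto
  also have "\<dots> = 2 powr s * (max x y) powr s"
    using assms by (simp add: powr_mult)
  also have "\<dots> \<le> 2 powr s * (x powr s + y powr s)"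
    by (intro mult_left_mono) (auto simp: max_def)
  finally show ?thesis .
qed

lemma norm_powr_le_smoothed:
  assumes "e > 0" "s \<ge> 0"
  shows "norm w powr (2 * s) \<le> (e + Re w * Re w + Im w * Im w) powr s"
proof -
  have "norm w powr (2 * s) = ((norm w)\<^sup>2) powr s"
    by (simp add: powr_powr flip: powr_numeral)
  also have "\<dots> \<le> (e + Re w * Re w + Im w * Im w) powr s"
    unfolding cmod_power2 using assms by (intro powr_mono2) (auto simp: power2_eq_square)
  finally show ?thesis .
qed

lemma abs_powr_square: "\<bar>u::real\<bar> powr (2 * s) = (u * u) powr s"
proof -
  have "\<bar>u\<bar> powr 2 = u * u"
    by (cases "u = 0") (simp_all add: power2_eq_square)
  then show ?thesis by (metis powr_powr)
qed

lemma nonneg_combination: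
  fixes P Q R S :: real
  shows "Q \<le> P \<Longrightarrow> R \<le> Q \<Longrightarrow> S \<le> 0 \<Longrightarrow> 0 \<le> P + (-1) * (R + S)"
  by simp

text \<open>
  Up to smoothing, the subharmonic function is \<open>C |Re w|^q - |w|^q\<close>. The Laplacians of \<open>|Re w|^q\<close> and
  \<open>|w|^q\<close> are \<open>q (q - 1) |Re w|^(q-2)\<close> and \<open>q\<^sup>2 |w|^(q-2)\<close>, and \<open>|Re w|^(q-2) \<ge> |w|^(q-2)\<close> for \<open>q \<le> 2\<close>,
  so a constant of order \<open>1/(q - 1)\<close> suffices.
\<close>
lemma riesz_conjugate_le_2:
  fixes c :: "'j \<Rightarrow> complex" and l :: "'j \<Rightarrow> real"
  assumes q: "1 < q" "q \<le> 2" and J: "finite J" "\<And>j. j \<in> J \<Longrightarrow> l j > 0" and e: "e > 0"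
  defines "f \<equiv> \<lambda>t. \<Sum>j\<in>J. c j * cis (l j * t)"
  shows "eventually (\<lambda>T. mean_upto T (\<lambda>t. norm (f t) powr q) \<le> 4 / (q - 1) * mean_upto T (\<lambda>t. \<bar>Re (f t)\<bar> powr q) + e) at_top"
proof -
  define s where "s = q / 2"
  have s: "1/2 < s" "s \<le> 1" "q = 2 * s" using q by (auto simp: s_def)
  define A where "A = 4 / (q - 1)"
  have A: "A > 0" using q by (simp add: A_def)
  \<comment> \<open>chosen so that the additive error \<open>A * h powr s\<close> is \<open>e / 2\<close>\<close>
  define h where "h = (e / (2 * A)) powr (1 / s)"
  have h: "h > 0" "h powr s = e / (2 * A)" using e A s by (auto simp: h_def powr_powr)
  define G where "G = (\<lambda>u v. A / 2 * (h + u * u) powr s + (-1) * (h + u * u + v * v) powr s)"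
  define L where "L = (\<lambda>u v. A / 2 * (2 * s * (h + u * u) powr (s - 1) + 4 * s * (s - 1) * (u * u) * (h + u * u) powr (s - 2))
     + (-1) * (4 * s * (h + u * u + v * v) powr (s - 1) + 4 * s * (s - 1) * (u * u + v * v) * (h + u * u + v * v) powr (s - 2)))"
  have lap: "has_laplacian G L"
    unfolding G_def L_def
    by (intro has_laplacian_add has_laplacian_cmult has_laplacian_real_powr has_laplacian_norm_powr h)
  have sub: "L u v \<ge> 0" for u v
  proof -
    have X: "h + u * u > 0" using h by (simp add: add_pos_nonneg)
    have r: "h + u * u + v * v > 0" using X by (simp add: add_pos_nonneg)
    have X1: "(h + u * u) powr (s - 1) = (h + u * u) * (h + u * u) powr (s - 2)"
      using X powr_add[of "h + u * u" 1 "s - 2"] by simp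
    have "(2 * s - 1) * (h + u * u) \<le> (h + u * u) - 2 * (1 - s) * (u * u)"
      using s h by (simp add: algebra_simps)
    then have "2 * s * (h + u * u) powr (s - 2) * ((2 * s - 1) * (h + u * u)) \<le>
        2 * s * (h + u * u) powr (s - 2) * ((h + u * u) - 2 * (1 - s) * (u * u))"
      using s by (intro mult_left_mono) auto
    also have "\<dots> = 2 * s * (h + u * u) powr (s - 1) + 4 * s * (s - 1) * (u * u) * (h + u * u) powr (s - 2)"
      unfolding X1 by (simp add: algebra_simps)
    finally have "2 * s * (2 * s - 1) * (h + u * u) powr (s - 1) \<le> 2 * s * (h + u * u) powr (s - 1) + 4 * s * (s - 1) * (u * u) * (h + u * u) powr (s - 2)"
      unfolding X1 by (simp only: mult_ac)
    then have "A / 2 * (2 * s * (2 * s - 1) * (h + u * u) powr (s - 1)) \<le> A / 2 * (2 * s * (h + u * u) powr (s - 1) + 4 * s * (s - 1) * (u * u) * (h + u * u) powr (s - 2))"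
      using A by (intro mult_left_mono) auto
    moreover have "A * (2 * s - 1) = 4" using s by (simp add: A_def field_simps)
    moreover have "A / 2 * (2 * s * (2 * s - 1) * Z) = (A * (2 * s - 1)) * (s * Z)" for Z
      by (simp add: algebra_simps)
    ultimately have "4 * s * (h + u * u) powr (s - 1) \<le> A / 2 * (2 * s * (h + u * u) powr (s - 1) + 4 * s * (s - 1) * (u * u) * (h + u * u) powr (s - 2))"
      by (simp only: mult.assoc)
    moreover have "(h + u * u + v * v) powr (s - 1) \<le> (h + u * u) powr (s - 1)"
      using s X by (intro powr_mono2') auto
    then have "4 * s * (h + u * u + v * v) powr (s - 1) \<le> 4 * s * (h + u * u) powr (s - 1)"
      using s by (intro mult_left_mono) auto
    moreover have "4 * s * (s - 1) * (u * u + v * v) * (h + u * u + v * v) powr (s - 2) \<le> 0"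
      using s by (intro mult_nonpos_nonneg mult_nonneg_nonpos) auto
    ultimately show ?thesis unfolding L_def by (rule nonneg_combination)
  qed
  have pw: "norm w powr q \<le> A * \<bar>Re w\<bar> powr q + A * h powr s - G (Re w) (Im w)" for w
  proof -
    have "(h + Re w * Re w) powr s \<le> 2 powr s * (h powr s + (Re w * Re w) powr s)"
      using h s by (intro powr_sum_le) auto
    also have "\<dots> \<le> 2 powr 1 * (h powr s + (Re w * Re w) powr s)"
      using s by (intro mult_right_mono powr_mono) auto
    finally have "A / 2 * (h + Re w * Re w) powr s \<le> A / 2 * (2 * (h powr s + \<bar>Re w\<bar> powr q))"
      using A unfolding s(3) abs_powr_square by (intro mult_left_mono) auto
    then show ?thesis
      using norm_powr_le_smoothed[OF h(1), of s w] s unfolding G_def by (simp add: algebra_simps)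
  qed
  have "G 0 0 \<ge> 0"
  proof -
    have "A / 2 \<ge> 1" using q by (simp add: A_def field_simps)
    then have "1 * h powr s \<le> A / 2 * h powr s" by (intro mult_right_mono) auto
    then show ?thesis by (simp add: G_def)
  qed
  moreover have "A * h powr s = e / 2" using h A by simp
  ultimately have le: "B + A * h powr s - G 0 0 + e / 2 \<le> B + e" for B by simp
  have "eventually (\<lambda>T. mean_upto T (\<lambda>t. norm (f t) powr q) \<le> A * mean_upto T (\<lambda>t. \<bar>Re (f t)\<bar> powr q) + A * h powr s - G 0 0 + e / 2) at_top"
    unfolding f_def using riesz_from_subharmonic[where e = "e / 2", OF lap sub J _ _ _ pw] e q by simp
  then show ?thesis
    unfolding A_def[symmetric]
  proof eventually_elim
    case (elim T)
    then show ?case using le[of "A * mean_upto T (\<lambda>t. \<bar>Re (f t)\<bar> powr q)"] by linarith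
  qed
qed

text \<open>
  For \<open>q \<ge> 2\<close> the comparison of \<open>|Re w|^(q-2)\<close> with \<open>|w|^(q-2)\<close> goes the wrong way. Instead,
  \<open>(Re w)\<^sup>2 |w|^(q-2)\<close> has Laplacian at least \<open>2 |w|^(q-2)\<close>, which makes
  \<open>q\<^sup>2 (Re w)\<^sup>2 |w|^(q-2) - 2 |w|^q\<close> subharmonic. Its first term is at most \<open>|w|^q + q^q |Re w|^q\<close>.
\<close>
lemma riesz_conjugate_ge_2:
  fixes c :: "'j \<Rightarrow> complex" and l :: "'j \<Rightarrow> real"
  assumes q: "2 \<le> q" and J: "finite J" "\<And>j. j \<in> J \<Longrightarrow> l j > 0" and e: "e > 0"
  defines "f \<equiv> \<lambda>t. \<Sum>j\<in>J. c j * cis (l j * t)"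
  shows "eventually (\<lambda>T. mean_upto T (\<lambda>t. norm (f t) powr q) \<le> q powr q * mean_upto T (\<lambda>t. \<bar>Re (f t)\<bar> powr q) + e) at_top"
proof -
  define s where "s = q / 2"
  have s: "1 \<le> s" "q = 2 * s" using q by (auto simp: s_def)
  define h where "h = (e / 4) powr (1 / s)"
  have h: "h > 0" "h powr s = e / 4" using e s by (auto simp: h_def powr_powr)
  define G where "G = (\<lambda>u v. q\<^sup>2 * ((u * u) * (h + u * u + v * v) powr (s - 1)) + (-2) * (h + u * u + v * v) powr s)"
  define L where "L = (\<lambda>u v. q\<^sup>2 * (2 * (h + u * u + v * v) powr (s - 1) + 12 * (s - 1) * (u * u) * (h + u * u + v * v) powr (s - 1 - 1)
       + 4 * (s - 1) * (s - 1 - 1) * (u * u) * (u * u + v * v) * (h + u * u + v * v) powr (s - 1 - 2))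
     + (-2) * (4 * s * (h + u * u + v * v) powr (s - 1) + 4 * s * (s - 1) * (u * u + v * v) * (h + u * u + v * v) powr (s - 2)))"
  have lap: "has_laplacian G L"
    unfolding G_def L_def
    by (intro has_laplacian_add has_laplacian_cmult has_laplacian_mixed_powr has_laplacian_norm_powr h)
  have sub: "L u v \<ge> 0" for u v
  proof -
    define r where "r = h + u * u + v * v"
    define w where "w = u * u + v * v"
    have r: "r > 0" using h by (simp add: r_def add_pos_nonneg)
    have w: "0 \<le> w" "w \<le> r" using h by (auto simp: w_def r_def)
    have b: "r powr (x + 1) = r * r powr x" for x using r by (simp add: powr_add)
    have p: "r powr (s - 2) = r * r powr (s - 3)" "r powr (s - 1) = r * (r * r powr (s - 3))"
      using b[of "s - 3"] b[of "s - 2"] by simp_all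
    define Z where "Z = r powr (s - 3)"
    have Z: "Z \<ge> 0" by (simp add: Z_def)
    have "L u v = q\<^sup>2 * (2 * (r * (r * Z)) + 4 * (s - 1) * (u * u) * Z * (3 * r + (s - 2) * w)) - 8 * s * r * Z * (r + (s - 1) * w)"
      unfolding L_def r_def[symmetric] w_def[symmetric] using p by (simp add: Z_def algebra_simps)
    moreover have "3 * r + (s - 2) * w \<ge> 0"
      using w s mult_nonneg_nonneg[of "s - 1" w] by (simp add: algebra_simps)
    then have "4 * (s - 1) * (u * u) * Z * (3 * r + (s - 2) * w) \<ge> 0"
      using s Z by (intro mult_nonneg_nonneg[OF mult_nonneg_nonneg[OF mult_nonneg_nonneg]]) simp_all
    then have "q\<^sup>2 * (2 * (r * (r * Z)) + 4 * (s - 1) * (u * u) * Z * (3 * r + (s - 2) * w)) \<ge> q\<^sup>2 * (2 * (r * (r * Z)))"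
      by (intro mult_left_mono) auto
    moreover have "8 * s * r * Z * (r + (s - 1) * w) \<le> 8 * s * r * Z * (r + (s - 1) * r)"
      using s Z r w by (intro mult_left_mono add_left_mono) auto
    moreover have "8 * s * r * Z * (r + (s - 1) * r) = q\<^sup>2 * (2 * (r * (r * Z)))"
      unfolding s(2) by (simp add: algebra_simps power2_eq_square)
    ultimately show ?thesis by linarith
  qed
  have pw: "norm w powr q \<le> q powr q * \<bar>Re w\<bar> powr q + 0 - G (Re w) (Im w)" for w
  proof -
    define u where "u = Re w"
    define r where "r = h + u * u + Im w * Im w"
    have r: "r > 0" using h by (simp add: r_def add_pos_nonneg)
    have rs: "r powr s = r * r powr (s - 1)" using r powr_add[of r 1 "s - 1"] by simp
    have "q\<^sup>2 * ((u * u) * r powr (s - 1)) \<le> r powr s + q powr q * \<bar>u\<bar> powr q"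
    proof (cases "q\<^sup>2 * (u * u) \<le> r")
      case True
      then have "(q\<^sup>2 * (u * u)) * r powr (s - 1) \<le> r * r powr (s - 1)" by (intro mult_right_mono) auto
      then show ?thesis unfolding rs by (simp add: mult.assoc add_increasing2)
    next
      case False
      have "(q\<^sup>2 * (u * u)) * r powr (s - 1) \<le> (q\<^sup>2 * (u * u)) * (q\<^sup>2 * (u * u)) powr (s - 1)"
        using False r s by (intro mult_left_mono powr_mono2) auto
      also have "\<dots> = (q\<^sup>2 * (u * u)) powr s"
        using False r powr_add[of "q\<^sup>2 * (u * u)" 1 "s - 1"] by simp
      also have "(q\<^sup>2 * (u * u)) powr s = ((q * u) * (q * u)) powr s" by (simp add: power2_eq_square mult_ac)
      also have "\<dots> = \<bar>q * u\<bar> powr (2 * s)" by (simp only: abs_powr_square)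
      also have "\<dots> = q powr q * \<bar>u\<bar> powr q"
        using q s by (simp add: abs_mult powr_mult)
      finally show ?thesis by (simp add: mult.assoc add_increasing)
    qed
    then show ?thesis
      using norm_powr_le_smoothed[OF h(1), of s w] s unfolding G_def r_def u_def by simp
  qed
  have "0 - G 0 0 = e / 2" using h s by (simp add: G_def)
  then have G0: "B + 0 - G 0 0 + e / 2 = B + e" for B by simp
  have "eventually (\<lambda>T. mean_upto T (\<lambda>t. norm (f t) powr q) \<le> q powr q * mean_upto T (\<lambda>t. \<bar>Re (f t)\<bar> powr q) + 0 - G 0 0 + e / 2) at_top"
    unfolding f_def using riesz_from_subharmonic[where e = "e / 2", OF lap sub J _ _ _ pw] e q by simp
  then show ?thesis
    unfolding G0 .
qed

text \<open>
  A function of \<open>u = Re w\<close> whose second derivative is at least \<open>(1 + u\<^sup>2)^(q/2 - 1)\<close> dominates the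
  Laplacian of \<open>(1 + |w|\<^sup>2)^(q/2)\<close> up to a constant. Since \<open>q < 1\<close>, this second derivative is integrable
  and such a function can have linear growth: a multiple of
  \<open>q (2 - q) (1 + u\<^sup>2)^(1/2) - (1 + u\<^sup>2)^(q/2)\<close> does it. This bounds the \<open>q\<close>-th moment by a first
  moment.
\<close>
lemma kolmogorov_conjugate:
  fixes c :: "'j \<Rightarrow> complex" and l :: "'j \<Rightarrow> real"
  assumes q: "0 < q" "q < 1" and J: "finite J" "\<And>j. j \<in> J \<Longrightarrow> l j > 0"
  defines "f \<equiv> \<lambda>t. \<Sum>j\<in>J. c j * cis (l j * t)"
  shows "eventually (\<lambda>T. mean_upto T (\<lambda>t. norm (f t) powr q) \<le> 2 / (1 - q) * mean_upto T (\<lambda>t. \<bar>Re (f t)\<bar> powr 1) + 6 / (1 - q)) at_top"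
proof -
  define s where "s = q / 2"
  have s: "0 < s" "s < 1/2" "q = 2 * s" using q by (auto simp: s_def)
  define A where "A = 2 / (1 - q)"
  have A: "A > 0" "A \<ge> 2" using q by (auto simp: A_def field_simps)
  define G where "G = (\<lambda>u v. A * (4 * s * (1 - s) * (1 + u * u) powr (1/2) + (-1) * (1 + u * u) powr s) + (-1) * (1 + u * u + v * v) powr s)"
  define L where "L = (\<lambda>u v. A * (4 * s * (1 - s) * (2 * (1/2) * (1 + u * u) powr (1/2 - 1) + 4 * (1/2) * (1/2 - 1) * (u * u) * (1 + u * u) powr (1/2 - 2))
     + (-1) * (2 * s * (1 + u * u) powr (s - 1) + 4 * s * (s - 1) * (u * u) * (1 + u * u) powr (s - 2)))
     + (-1) * (4 * s * (1 + u * u + v * v) powr (s - 1) + 4 * s * (s - 1) * (u * u + v * v) * (1 + u * u + v * v) powr (s - 2)))"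
  have lap: "has_laplacian G L"
    unfolding G_def L_def
    by (intro has_laplacian_add has_laplacian_cmult has_laplacian_real_powr has_laplacian_norm_powr) auto
  have sub: "L u v \<ge> 0" for u v
  proof -
    define X where "X = 1 + u * u"
    have X: "X \<ge> 1" by (simp add: X_def)
    have uu: "u * u = X - 1" by (simp add: X_def)
    have b: "X powr (x + 1) = X * X powr x" for x using X by (simp add: powr_add)
    have p: "X powr (s - 1) = X * X powr (s - 2)" "X powr (1/2 - 1) = X * X powr (1/2 - 2)"
      using b[of "s - 2"] b[of "1/2 - 2"] by simp_all
    have e1: "2 * (1/2) * X powr (1/2 - 1) + 4 * (1/2) * (1/2 - 1) * (u * u) * X powr (1/2 - 2) = X powr (1/2 - 2)"
      unfolding p uu by (simp add: algebra_simps)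
    have e2: "2 * s * X powr (s - 1) + 4 * s * (s - 1) * (u * u) * X powr (s - 2) =
       4 * s * (1 - s) * X powr (s - 2) - 2 * s * (1 - 2 * s) * X powr (s - 1)"
      unfolding p uu by (simp add: algebra_simps)
    have "X powr (s - 2) \<le> X powr (1/2 - 2)" using X s by (intro powr_mono) auto
    then have "4 * s * (1 - s) * X powr (s - 2) \<le> 4 * s * (1 - s) * X powr (1/2 - 2)"
      using s by (intro mult_left_mono) auto
    then have "A * (2 * s * (1 - 2 * s) * X powr (s - 1)) \<le> A * (4 * s * (1 - s) * X powr (1/2 - 2)
       + (-1) * (4 * s * (1 - s) * X powr (s - 2) - 2 * s * (1 - 2 * s) * X powr (s - 1)))"
      using A by (intro mult_left_mono) auto
    moreover have "A * (2 * s * (1 - 2 * s) * X powr (s - 1)) = 4 * s * X powr (s - 1)"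
      using s by (simp add: A_def)
    ultimately have "4 * s * X powr (s - 1) \<le> A * (4 * s * (1 - s) * X powr (1/2 - 2)
       + (-1) * (4 * s * (1 - s) * X powr (s - 2) - 2 * s * (1 - 2 * s) * X powr (s - 1)))" by simp
    moreover have "(X + v * v) powr (s - 1) \<le> X powr (s - 1)"
      using s X by (intro powr_mono2') auto
    then have "4 * s * (X + v * v) powr (s - 1) \<le> 4 * s * X powr (s - 1)"
      using s by (intro mult_left_mono) auto
    moreover have "4 * s * (s - 1) * (u * u + v * v) * (X + v * v) powr (s - 2) \<le> 0"
      using s by (intro mult_nonpos_nonneg mult_nonneg_nonpos) auto
    ultimately show ?thesis unfolding L_def X_def[symmetric] e1 e2 by (rule nonneg_combination)
  qed
  have pw: "norm w powr q \<le> A * \<bar>Re w\<bar> powr 1 + A - G (Re w) (Im w)" for w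
  proof -
    have "(1 + Re w * Re w) powr (1/2) = sqrt (1 + Re w * Re w)" by (simp add: powr_half_sqrt)
    also have "\<dots> \<le> 1 + \<bar>Re w\<bar>"
      by (rule real_le_lsqrt) (auto simp: power2_eq_square algebra_simps abs_mult_self_eq)
    finally have 1: "(1 + Re w * Re w) powr (1/2) \<le> 1 + \<bar>Re w\<bar>" .
    have "4 * s * (1 - s) \<le> 1" using zero_le_power2[of "2 * s - 1"] by (simp add: power2_eq_square algebra_simps)
    then have "4 * s * (1 - s) * (1 + Re w * Re w) powr (1/2) \<le> 1 * (1 + \<bar>Re w\<bar>)"
      using 1 s by (intro mult_mono) auto
    then have "4 * s * (1 - s) * (1 + Re w * Re w) powr (1/2) + (-1) * (1 + Re w * Re w) powr s \<le> 1 + \<bar>Re w\<bar>"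
      by (smt (verit) powr_ge_zero)
    then have "A * (4 * s * (1 - s) * (1 + Re w * Re w) powr (1/2) + (-1) * (1 + Re w * Re w) powr s) \<le> A * (1 + \<bar>Re w\<bar>)"
      using A by (intro mult_left_mono) auto
    then show ?thesis
      using norm_powr_le_smoothed[of 1 s w] s unfolding G_def by (simp add: algebra_simps)
  qed
  have "- G 0 0 + 1 \<le> 2 * A"
  proof -
    have "- G 0 0 = A * (1 - 2 * s)\<^sup>2 + 1" by (simp add: G_def algebra_simps power2_eq_square)
    also have "A * (1 - 2 * s)\<^sup>2 = 2 * (1 - 2 * s)" using s by (simp add: A_def power2_eq_square)
    finally show ?thesis using A s by simp
  qed
  moreover have "3 * A = 6 / (1 - q)" by (simp add: A_def)
  ultimately have le: "B + A - G 0 0 + 1 \<le> B + 6 / (1 - q)" for B by linarith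
  have "eventually (\<lambda>T. mean_upto T (\<lambda>t. norm (f t) powr q) \<le> A * mean_upto T (\<lambda>t. \<bar>Re (f t)\<bar> powr 1) + A - G 0 0 + 1) at_top"
    unfolding f_def using riesz_from_subharmonic[where e = 1, OF lap sub J _ _ _ pw] q by simp
  then show ?thesis
    unfolding A_def[symmetric]
  proof eventually_elim
    case (elim T)
    then show ?case using le[of "A * mean_upto T (\<lambda>t. \<bar>Re (f t)\<bar> powr 1)"] by linarith
  qed
qed

section \<open>Partial sums\<close>

text \<open>
  Multiplied by \<open>(N + 1/2)^(it)\<close>, the term of index \<open>n\<close> has positive frequency if \<open>n \<le> N\<close> and negative
  frequency otherwise. Let \<open>g = g\<^sub>+ + g\<^sub>-\<close> accordingly. Then \<open>f1 = g\<^sub>+ + cnj g\<^sub>-\<close> and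
  \<open>f2 = i (g\<^sub>+ - cnj g\<^sub>-)\<close> have positive frequencies only, their real parts are those of \<open>g\<close> and \<open>ig\<close>,
  and \<open>g\<^sub>+ = (f1 - i f2) / 2\<close>. So a bound for such functions by their real parts yields a bound
  for partial sums.
\<close>
lemma moment_restrict_le:
  fixes c :: "nat \<Rightarrow> complex"
  assumes J: "finite J" "0 \<notin> J" and q: "q > 0" "r > 0" and A: "A \<ge> 0"
    and conj: "\<And>(c :: nat \<Rightarrow> complex) l e. (\<And>j. j \<in> J \<Longrightarrow> l j > 0) \<Longrightarrow> e > 0 \<Longrightarrow>
      eventually (\<lambda>T. mean_upto T (\<lambda>t. norm (\<Sum>j\<in>J. c j * cis (l j * t)) powr q) \<le>
        A * mean_upto T (\<lambda>t. \<bar>Re (\<Sum>j\<in>J. c j * cis (l j * t))\<bar> powr r) + B + e) at_top"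
  shows "moment q c {n\<in>J. n \<le> N} \<le> 2 * A * moment r c J + 2 * B"
proof (rule field_le_epsilon)
  fix e0 :: real assume "e0 > 0"
  define e where "e = e0 / 2"
  have e: "e > 0" using \<open>e0 > 0\<close> by (simp add: e_def)
  define l where "l = (\<lambda>n. ln (real N + 1 / 2) - ln (real n))"
  have lpos: "l n > 0 \<longleftrightarrow> n \<le> N" if "n \<in> J" for n
  proof -
    have "n > 0" using that J(2) by (metis gr0I)
    then have "l n > 0 \<longleftrightarrow> real n < real N + 1 / 2" by (simp add: l_def)
    also have "\<dots> \<longleftrightarrow> n \<le> N" by linarith
    finally show ?thesis .
  qed
  have lnz: "l n \<noteq> 0" if "n \<in> J" for n
  proof -
    have "n > 0" using that J(2) by (metis gr0I)
    moreover have "real n \<noteq> real N + 1 / 2"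
    proof
      assume "real n = real N + 1 / 2"
      then have "real (2 * n) = real (2 * N + 1)" by simp
      then have "2 * n = 2 * N + 1" by (simp only: of_nat_eq_iff)
      then show False by presburger
    qed
    ultimately show ?thesis by (auto simp: l_def)
  qed
  define g where "g = (\<lambda>t. \<Sum>n\<in>J. c n * cis (l n * t))"
  define gp where "gp = (\<lambda>t. \<Sum>n\<in>{n\<in>J. n \<le> N}. c n * cis (l n * t))"
  define f1 where "f1 = (\<lambda>t. \<Sum>n\<in>J. (if n \<le> N then c n else cnj (c n)) * cis (\<bar>l n\<bar> * t))"
  \<comment> \<open>the conjugated terms of index beyond N have frequency \<open>- l n > 0\<close>\<close>
  define f2 where "f2 = (\<lambda>t. \<Sum>n\<in>J. (if n \<le> N then \<i> * c n else - \<i> * cnj (c n)) * cis (\<bar>l n\<bar> * t))"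
  have rot: "norm (\<Sum>n\<in>I. c n * cis (l n * t)) = norm (dirichlet_sum c I t)" for I t
  proof -
    have "(\<Sum>n\<in>I. c n * cis (l n * t)) = cis (ln (real N + 1 / 2) * t) * dirichlet_sum c I t"
      unfolding dirichlet_sum_def sum_distrib_left l_def
      by (intro sum.cong refl) (simp add: cis_mult algebra_simps)
    then show ?thesis by (simp add: norm_mult)
  qed
  have t1: "(if n \<le> N then c n else cnj (c n)) * cis (\<bar>l n\<bar> * t) =
      (if n \<le> N then c n * cis (l n * t) else cnj (c n * cis (l n * t)))" if "n \<in> J" for n t
    using lpos[OF that] by (auto simp: cis_cnj abs_if)
  have t2: "(if n \<le> N then \<i> * c n else - \<i> * cnj (c n)) * cis (\<bar>l n\<bar> * t) =
      (if n \<le> N then \<i> * (c n * cis (l n * t)) else - \<i> * cnj (c n * cis (l n * t)))" if "n \<in> J" for n t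
    using lpos[OF that] by (auto simp: cis_cnj abs_if)
  have Re1: "Re (f1 t) = Re (g t)" for t
    unfolding f1_def g_def Re_sum by (intro sum.cong refl) (simp only: t1, simp)
  have Re2: "Re (f2 t) = - Im (g t)" for t
    unfolding f2_def g_def Re_sum Im_sum sum_negf[symmetric] by (intro sum.cong refl) (simp only: t2, simp)
  have split: "gp t = (f1 t - \<i> * f2 t) / 2" for t
  proof -
    have "f1 t - \<i> * f2 t = (\<Sum>n\<in>J. if n \<le> N then 2 * (c n * cis (l n * t)) else 0)"
      unfolding f1_def f2_def sum_distrib_left sum_subtractf[symmetric]
      by (intro sum.cong refl) (simp only: t1 mult.assoc t2, simp add: algebra_simps)
    also have "\<dots> = 2 * gp t"
      unfolding gp_def sum_distrib_left using J(1) by (simp add: sum.inter_filter)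
    finally show ?thesis by simp
  qed
  have pw: "norm (dirichlet_sum c {n\<in>J. n \<le> N} t) powr q \<le> norm (f1 t) powr q + norm (f2 t) powr q" for t
  proof -
    have "norm (gp t) \<le> (norm (f1 t) + norm (f2 t)) / 2"
      unfolding split norm_divide using norm_triangle_ineq4[of "f1 t" "\<i> * f2 t"] by (simp add: norm_mult)
    also have "\<dots> \<le> max (norm (f1 t)) (norm (f2 t))" by (simp add: max_def)
    finally have "norm (gp t) powr q \<le> (max (norm (f1 t)) (norm (f2 t))) powr q"
      using q by (intro powr_mono2) auto
    also have "\<dots> \<le> norm (f1 t) powr q + norm (f2 t) powr q" by (simp add: max_def)
    finally show ?thesis using rot[where I = "{n\<in>J. n \<le> N}"] by (simp add: gp_def)
  qed
  have Re_le: "\<bar>Re (f1 t)\<bar> powr r \<le> norm (dirichlet_sum c J t) powr r" "\<bar>Re (f2 t)\<bar> powr r \<le> norm (dirichlet_sum c J t) powr r" for t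
    unfolding Re1 Re2 using rot[where I = J] abs_Re_le_cmod[of "g t"] abs_Im_le_cmod[of "g t"] q
    by (auto simp: g_def intro!: powr_mono2)
  have cf: "continuous_on UNIV f1" "continuous_on UNIV f2"
    unfolding f1_def f2_def by (intro continuous_intros)+
  have cp: "continuous_on UNIV (\<lambda>t. norm (f1 t) powr q)" "continuous_on UNIV (\<lambda>t. norm (f2 t) powr q)"
    by (intro continuous_on_powr_norm cf q)+
  have cr: "continuous_on UNIV (\<lambda>t. \<bar>Re (f1 t)\<bar> powr r)" "continuous_on UNIV (\<lambda>t. \<bar>Re (f2 t)\<bar> powr r)"
    using continuous_on_powr_norm[OF continuous_on_Re[OF cf(1)] q(2)] continuous_on_powr_norm[OF continuous_on_Re[OF cf(2)] q(2)] by simp_all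
  have abs_l: "\<bar>l n\<bar> > 0" if "n \<in> J" for n using lnz[OF that] by simp
  have ev: "eventually (\<lambda>T. mean_upto T (\<lambda>t. norm (f1 t) powr q) \<le> A * mean_upto T (\<lambda>t. \<bar>Re (f1 t)\<bar> powr r) + B + e / 2) at_top"
    "eventually (\<lambda>T. mean_upto T (\<lambda>t. norm (f2 t) powr q) \<le> A * mean_upto T (\<lambda>t. \<bar>Re (f2 t)\<bar> powr r) + B + e / 2) at_top"
    unfolding f1_def f2_def using abs_l e by (intro conj; simp)+
  have "eventually (\<lambda>T. mean_upto T (\<lambda>t. norm (dirichlet_sum c {n\<in>J. n \<le> N} t) powr q) \<le>
      2 * A * mean_upto T (\<lambda>t. norm (dirichlet_sum c J t) powr r) + 2 * B + e) at_top"
    using ev eventually_gt_at_top[of 0]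
  proof eventually_elim
    case (elim T)
    have z: "continuous_on UNIV (\<lambda>t::real. 0::real)" by simp
    have mz: "mean_upto T (\<lambda>t. 0) = 0" by (simp add: mean_upto_def)
    have "mean_upto T (\<lambda>t. \<bar>Re (f1 t)\<bar> powr r) \<le> 1 * mean_upto T (\<lambda>t. norm (dirichlet_sum c J t) powr r) + 0 - mean_upto T (\<lambda>t. 0)"
      "mean_upto T (\<lambda>t. \<bar>Re (f2 t)\<bar> powr r) \<le> 1 * mean_upto T (\<lambda>t. norm (dirichlet_sum c J t) powr r) + 0 - mean_upto T (\<lambda>t. 0)"
      using Re_le by (intro mean_upto_le cr continuous_dirichlet_sum_powr q z elim(3); simp)+
    then have "A * mean_upto T (\<lambda>t. \<bar>Re (f1 t)\<bar> powr r) \<le> A * mean_upto T (\<lambda>t. norm (dirichlet_sum c J t) powr r)"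
      "A * mean_upto T (\<lambda>t. \<bar>Re (f2 t)\<bar> powr r) \<le> A * mean_upto T (\<lambda>t. norm (dirichlet_sum c J t) powr r)"
      using A mz by (auto intro!: mult_left_mono)
    moreover have "mean_upto T (\<lambda>t. norm (dirichlet_sum c {n\<in>J. n \<le> N} t) powr q) \<le>
        1 * mean_upto T (\<lambda>t. norm (f1 t) powr q) + 0 - mean_upto T (\<lambda>t. - (norm (f2 t) powr q))"
      using pw by (intro mean_upto_le continuous_on_minus cp continuous_dirichlet_sum_powr q elim(3); simp)
    then have "mean_upto T (\<lambda>t. norm (dirichlet_sum c {n\<in>J. n \<le> N} t) powr q) \<le>
        mean_upto T (\<lambda>t. norm (f1 t) powr q) + mean_upto T (\<lambda>t. norm (f2 t) powr q)"
      by (simp add: mean_upto_def)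
    ultimately show ?case using elim(1,2) by linarith
  qed
  moreover have "((\<lambda>T. mean_upto T (\<lambda>t. norm (dirichlet_sum c {n\<in>J. n \<le> N} t) powr q)) \<longlongrightarrow> moment q c {n\<in>J. n \<le> N}) at_top"
    using has_mean_moment[of "{n\<in>J. n \<le> N}" q c] J q by (simp add: has_mean_def mean_upto_def)
  moreover have "((\<lambda>T. 2 * A * mean_upto T (\<lambda>t. norm (dirichlet_sum c J t) powr r) + 2 * B + e) \<longlongrightarrow> 2 * A * moment r c J + 2 * B + e) at_top"
    using has_mean_moment[of J r c] J q by (intro tendsto_intros) (simp add: has_mean_def mean_upto_def)
  ultimately have "moment q c {n\<in>J. n \<le> N} \<le> 2 * A * moment r c J + 2 * B + e"
    by (intro tendsto_le[OF trivial_limit_at_top_linorder])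
  then show "moment q c {n\<in>J. n \<le> N} \<le> 2 * A * moment r c J + 2 * B + e0"
    using e by (simp add: e_def)
qed

lemma moment_scale:
  assumes "finite J" "0 \<notin> J" "q > 0" "M > 0"
  shows "moment q (\<lambda>n. c n / of_real M) J = moment q c J / M powr q"
proof (rule has_mean_unique)
  show "has_mean (\<lambda>t. norm (dirichlet_sum (\<lambda>n. c n / of_real M) J t) powr q) (moment q (\<lambda>n. c n / of_real M) J)"
    by (rule has_mean_moment[OF assms(1-3)])
  have "dirichlet_sum (\<lambda>n. c n / of_real M) J t = dirichlet_sum c J t / of_real M" for t
    by (simp add: dirichlet_sum_def sum_divide_distrib)
  then show "has_mean (\<lambda>t. norm (dirichlet_sum (\<lambda>n. c n / of_real M) J t) powr q) (moment q c J / M powr q)"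
    using has_mean_cmult[OF has_mean_moment[OF assms(1-3), of c], of "1 / M powr q"] assms(4)
    by (simp add: norm_divide powr_divide)
qed

lemma moment_restrict_le_2:
  assumes "finite J" "0 \<notin> J" "1 < q" "q \<le> 2"
  shows "moment q c {n\<in>J. n \<le> N} \<le> 8 / (q - 1) * moment q c J"
proof -
  have "moment q c {n\<in>J. n \<le> N} \<le> 2 * (4 / (q - 1)) * moment q c J + 2 * 0"
  proof (rule moment_restrict_le)
    fix c :: "nat \<Rightarrow> complex" and l :: "nat \<Rightarrow> real" and e :: real
    assume le: "\<And>j. j \<in> J \<Longrightarrow> l j > 0" "e > 0"
    show "eventually (\<lambda>T. mean_upto T (\<lambda>t. norm (\<Sum>j\<in>J. c j * cis (l j * t)) powr q) \<le>
        4 / (q - 1) * mean_upto T (\<lambda>t. \<bar>Re (\<Sum>j\<in>J. c j * cis (l j * t))\<bar> powr q) + 0 + e) at_top"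
      unfolding add_0_right by (rule riesz_conjugate_le_2[OF assms(3,4,1) le])
  qed (use assms in auto)
  then show ?thesis by simp
qed

lemma moment_restrict_ge_2:
  assumes "finite J" "0 \<notin> J" "2 \<le> q"
  shows "moment q c {n\<in>J. n \<le> N} \<le> 2 * q powr q * moment q c J"
proof -
  have "moment q c {n\<in>J. n \<le> N} \<le> 2 * (q powr q) * moment q c J + 2 * 0"
  proof (rule moment_restrict_le)
    fix c :: "nat \<Rightarrow> complex" and l :: "nat \<Rightarrow> real" and e :: real
    assume le: "\<And>j. j \<in> J \<Longrightarrow> l j > 0" "e > 0"
    show "eventually (\<lambda>T. mean_upto T (\<lambda>t. norm (\<Sum>j\<in>J. c j * cis (l j * t)) powr q) \<le>
        q powr q * mean_upto T (\<lambda>t. \<bar>Re (\<Sum>j\<in>J. c j * cis (l j * t))\<bar> powr q) + 0 + e) at_top"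
      unfolding add_0_right by (rule riesz_conjugate_ge_2[OF assms(3,1) le])
  qed (use assms in auto)
  then show ?thesis by simp
qed

text \<open>
  The additive constant in Kolmogorov's inequality disappears after normalizing the first moment.
\<close>
lemma moment_restrict_lt_1:
  assumes "finite J" "0 \<notin> J" "0 < q" "q < 1" "M > 0" "moment 1 c J \<le> M"
  shows "moment q c {n\<in>J. n \<le> N} \<le> 16 / (1 - q) * M powr q"
proof -
  define b where "b = (\<lambda>n. c n / of_real M)"
  have "moment 1 b J \<le> 1"
    unfolding b_def using assms by (subst moment_scale) auto
  have "moment q b {n\<in>J. n \<le> N} \<le> 2 * (2 / (1 - q)) * moment 1 b J + 2 * (6 / (1 - q))"
  proof (rule moment_restrict_le)
    fix c :: "nat \<Rightarrow> complex" and l :: "nat \<Rightarrow> real" and e :: real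
    assume le: "\<And>j. j \<in> J \<Longrightarrow> l j > 0" "e > 0"
    show "eventually (\<lambda>T. mean_upto T (\<lambda>t. norm (\<Sum>j\<in>J. c j * cis (l j * t)) powr q) \<le>
        2 / (1 - q) * mean_upto T (\<lambda>t. \<bar>Re (\<Sum>j\<in>J. c j * cis (l j * t))\<bar> powr 1) + 6 / (1 - q) + e) at_top"
      using kolmogorov_conjugate[where c = c and l = l, OF assms(3,4,1) le(1)]
      by (rule eventually_mono) (use le(2) in auto)
  qed (use assms in auto)
  also have "\<dots> \<le> 2 * (2 / (1 - q)) * 1 + 2 * (6 / (1 - q))"
    using \<open>moment 1 b J \<le> 1\<close> assms by (intro add_right_mono mult_left_mono) auto
  also have "\<dots> = 16 / (1 - q)" by (simp add: field_simps)
  finally have "moment q c {n\<in>J. n \<le> N} / M powr q \<le> 16 / (1 - q)"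
    unfolding b_def using assms by (subst (asm) moment_scale) auto
  then show ?thesis using assms by (simp add: pos_divide_le_eq)
qed

text \<open>
  Integrated with \<open>M = (\<integral> x^q)^(1/q)\<close>, this is the power mean inequality up to a factor \<open>2\<close>.
\<close>
lemma le_crude_power_mean:
  fixes x M q :: real
  assumes "x \<ge> 0" "M > 0" "q \<ge> 1"
  shows "x \<le> M + M powr (1 - q) * x powr q"
proof (cases "x \<le> M")
  case True
  then show ?thesis by (simp add: add_increasing2)
next
  case False
  then have "x = x powr (1 - q) * x powr q"
    using assms by (simp flip: powr_add)
  also have "\<dots> \<le> M powr (1 - q) * x powr q"
    using False assms by (intro mult_right_mono powr_mono2') auto
  finally show ?thesis using assms(2) by simp
qed

lemma moment_1_le:
  assumes "finite J" "0 \<notin> J" "q \<ge> 1" "M > 0" "moment q c J \<le> M powr q"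
  shows "moment 1 c J \<le> 2 * M"
proof -
  have pw: "norm w powr 1 \<le> M + M powr (1 - q) * norm w powr q" for w :: complex
    using le_crude_power_mean[of "norm w" M q] assms(3,4) by simp
  have "moment 1 c J \<le> M + M powr (1 - q) * moment q c J"
  proof (rule has_mean_mono)
    show "has_mean (\<lambda>t. norm (dirichlet_sum c J t) powr 1) (moment 1 c J)"
      using assms by (intro has_mean_moment) auto
    show "has_mean (\<lambda>t. M + M powr (1 - q) * norm (dirichlet_sum c J t) powr q) (M + M powr (1 - q) * moment q c J)"
      using assms by (intro has_mean_add has_mean_const has_mean_cmult has_mean_moment continuous_on_mult continuous_on_const continuous_dirichlet_sum_powr) auto
  qed (use assms pw in \<open>auto intro!: continuous_on_add continuous_on_mult continuous_dirichlet_sum_powr simp del: powr_one powr_one'\<close>)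
  also have "M powr (1 - q) * moment q c J \<le> M powr (1 - q) * M powr q"
    using assms by (intro mult_left_mono) auto
  also have "\<dots> = M" using assms by (simp flip: powr_add)
  finally show ?thesis by simp
qed

section \<open>Circle means\<close>

lemma norm_powr_of_real:
  assumes "w \<noteq> 0"
  shows "norm (w powr complex_of_real x) = norm w powr x"
  using assms by (simp add: powr_def Re_Ln)

lemma binomial_taylor_bound:
  fixes z :: complex
  assumes "0 \<le> s" "s \<le> S" "norm z \<le> 1 / 2"
  shows "norm ((1 + z) powr of_real s - (1 + of_real s * z + of_real (s * (s - 1) / 2) * z ^ 2
     + of_real (s * (s - 1) * (s - 2) / 6) * z ^ 3)) \<le> (S + 3) ^ 4 * (2 powr S * 16) * norm z ^ 4"
proof -
  define f where "f = (\<lambda>i z. of_real (\<Prod>j<i. s - real j) * (1 + z) powr (of_real (s - real i) :: complex))"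
  let ?D = "cball (0 :: complex) (1 / 2)"
  have Re: "1/2 \<le> norm (1 + x)" "norm (1 + x) \<le> 2" "1 + x \<notin> \<real>\<^sub>\<le>\<^sub>0" "1 + x \<noteq> 0" if "x \<in> ?D" for x :: complex
  proof -
    have x: "norm x \<le> 1/2" using that by simp
    show "1/2 \<le> norm (1 + x)" using norm_triangle_ineq2[of 1 "- x"] x by simp
    then show "1 + x \<noteq> 0" by auto
    show "norm (1 + x) \<le> 2" using norm_triangle_ineq[of 1 x] x by simp
    have "Re (1 + x) > 0" using abs_Re_le_cmod[of x] x by simp
    then show "1 + x \<notin> \<real>\<^sub>\<le>\<^sub>0" by (auto simp: complex_nonpos_Reals_iff)
  qed
  have der: "(f i has_field_derivative f (Suc i) x) (at x within ?D)" if "x \<in> ?D" for i x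
  proof -
    have "((\<lambda>z. z powr of_real (s - real i)) has_field_derivative of_real (s - real i) * (1 + x) powr (of_real (s - real i) - 1)) (at (1 + x))"
      by (rule has_field_derivative_powr[OF Re(3)[OF that]])
    then have "((\<lambda>z. (1 + z) powr of_real (s - real i)) has_field_derivative of_real (s - real i) * (1 + x) powr (of_real (s - real i) - 1) * 1) (at x)"
      by (rule DERIV_chain2) (auto intro!: derivative_eq_intros)
    then have "(f i has_field_derivative of_real (\<Prod>j<i. s - real j) * (of_real (s - real i) * (1 + x) powr (of_real (s - real i) - 1) * 1)) (at x)"
      unfolding f_def by (rule DERIV_cmult)
    also have "of_real (\<Prod>j<i. s - real j) * (of_real (s - real i) * (1 + x) powr (of_real (s - real i) - 1) * 1) = f (Suc i) x"
      unfolding f_def by (simp add: algebra_simps)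
    finally show ?thesis by (rule has_field_derivative_at_within)
  qed
  have bd: "norm (f (Suc 3) x) \<le> (S + 3) ^ 4 * (2 powr S * 16)" if "x \<in> ?D" for x
  proof -
    have "norm (f (Suc 3) x) = \<bar>\<Prod>j<4. s - real j\<bar> * norm (1 + x) powr (s - 4)"
      unfolding f_def norm_mult using norm_powr_of_real[OF Re(4)[OF that], of "s - 4"]
      by (simp add: numeral_eq_Suc del: of_real_diff of_real_mult of_real_prod)
    also have "\<dots> \<le> (S + 3) ^ 4 * (2 powr S * 16)"
    proof (rule mult_mono)
      have "\<bar>\<Prod>j<4. s - real j\<bar> = (\<Prod>j<4. \<bar>s - real j\<bar>)" by (simp add: abs_prod)
      also have "\<dots> \<le> (\<Prod>j<4::nat. S + 3)"
        using assms by (intro prod_mono) auto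
      finally show "\<bar>\<Prod>j<4. s - real j\<bar> \<le> (S + 3) ^ 4" by simp
      have "norm (1 + x) powr (s - 4) = norm (1 + x) powr s * norm (1 + x) powr (-4)"
        by (simp flip: powr_add)
      also have "\<dots> \<le> 2 powr S * (1/2) powr (-4)"
      proof (rule mult_mono)
        have "norm (1 + x) powr s \<le> 2 powr s" using Re[OF that] assms by (intro powr_mono2) auto
        also have "\<dots> \<le> 2 powr S" using assms by simp
        finally show "norm (1 + x) powr s \<le> 2 powr S" .
        show "norm (1 + x) powr (-4) \<le> (1/2) powr (-4)" using Re(1)[OF that] by (intro powr_mono2') auto
      qed auto
      also have "(1/2 :: real) powr (-4) = 16" by (simp add: powr_minus powr_numeral field_simps)
      finally show "norm (1 + x) powr (s - 4) \<le> 2 powr S * 16" .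
    qed (use assms in auto)
    finally show ?thesis .
  qed
  have "norm (f 0 z - (\<Sum>i\<le>3. f i 0 * (z - 0) ^ i / fact i)) \<le> (S + 3) ^ 4 * (2 powr S * 16) * norm (z - 0) ^ Suc 3 / fact 3"
    using assms by (intro complex_Taylor[of ?D] der bd) auto
  also have "(\<Sum>i\<le>3. f i 0 * (z - 0) ^ i / fact i) = 1 + of_real s * z + of_real (s * (s - 1) / 2) * z ^ 2
     + of_real (s * (s - 1) * (s - 2) / 6) * z ^ 3"
    by (simp add: f_def numeral_eq_Suc atMost_Suc lessThan_Suc algebra_simps)
  also have "f 0 z = (1 + z) powr of_real s" by (simp add: f_def)
  also have "(S + 3) ^ 4 * (2 powr S * 16) * norm (z - 0) ^ Suc 3 / fact 3 \<le> (S + 3) ^ 4 * (2 powr S * 16) * norm z ^ 4"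
    using assms by (simp add: fact_numeral field_simps)
  finally show ?thesis .
qed

definition circle_mean :: "(complex \<Rightarrow> 'a::euclidean_space) \<Rightarrow> 'a" where
  "circle_mean \<phi> = integral {0..1} (\<lambda>x. \<phi> (cis (2 * pi * x)))"

lemma continuous_on_circle:
  assumes "continuous_on UNIV \<phi>"
  shows "continuous_on S (\<lambda>x. \<phi> (cis (2 * pi * x)))"
  by (intro continuous_on_compose2[OF assms] continuous_intros) auto

lemma circle_integrable:
  fixes \<phi> :: "complex \<Rightarrow> 'a::euclidean_space"
  assumes "continuous_on UNIV \<phi>"
  shows "(\<lambda>x. \<phi> (cis (2 * pi * x))) integrable_on {0..1}"
  by (intro integrable_continuous_real continuous_on_circle assms)

lemma circle_mean_power:
  "circle_mean (\<lambda>z. z ^ n) = (if n = 0 then 1 else 0)"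
proof (cases "n = 0")
  case False
  have "((\<lambda>x. cis (2 * pi * x) ^ n) has_integral
      exp (2 * pi * n * \<i> * of_real 1) / (2 * pi * n * \<i>) - exp (2 * pi * n * \<i> * of_real 0) / (2 * pi * n * \<i>)) {0..1}"
  proof (rule fundamental_theorem_of_calculus)
    fix x :: real
    have "((\<lambda>z. exp (2 * pi * n * \<i> * z) / (2 * pi * n * \<i>)) has_field_derivative exp (2 * pi * n * \<i> * of_real x)) (at (of_real x))"
      using False by (auto intro!: derivative_eq_intros simp: field_simps)
    from has_vector_derivative_real_field[OF this]
    show "((\<lambda>x. exp (2 * pi * n * \<i> * of_real x) / (2 * pi * n * \<i>)) has_vector_derivative cis (2 * pi * x) ^ n) (at x within {0..1})"
      by (simp add: cis_conv_exp flip: exp_of_nat_mult) (simp add: mult_ac)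
  qed auto
  moreover have "exp (2 * pi * n * \<i> * of_real 1) = (1 :: complex)"
    using exp_of_nat_mult[of n "2 * of_real pi * \<i>"] by (simp add: mult_ac)
  ultimately have "((\<lambda>x. cis (2 * pi * x) ^ n) has_integral 0) {0..1}" by simp
  then show ?thesis using False by (simp add: circle_mean_def integral_unique)
qed (simp add: circle_mean_def)

lemma circle_mean_power_poly:
  assumes "j > 0"
  shows "circle_mean (\<lambda>z. z ^ j * poly P z) = 0"
proof -
  have int: "(\<lambda>x. coeff P i * cis (2 * pi * x) ^ (j + i)) integrable_on {0..1}" for i
    by (intro circle_integrable[of "\<lambda>z. coeff P i * z ^ (j + i)"] continuous_intros)
  have "circle_mean (\<lambda>z. z ^ j * poly P z) =
      integral {0..1} (\<lambda>x. \<Sum>i\<le>degree P. coeff P i * cis (2 * pi * x) ^ (j + i))"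
    by (simp only: circle_mean_def poly_altdef sum_distrib_left power_add mult_ac)
  also have "\<dots> = (\<Sum>i\<le>degree P. integral {0..1} (\<lambda>x. coeff P i * cis (2 * pi * x) ^ (j + i)))"
    using int by (intro integral_sum) auto
  also have "\<dots> = (\<Sum>i\<le>degree P. coeff P i * circle_mean (\<lambda>z. z ^ (j + i)))"
    by (simp add: circle_mean_def)
  also have "\<dots> = 0" using assms by (simp add: circle_mean_power)
  finally show ?thesis .
qed

text \<open>
  The terms \<open>h0\<close>, \<open>h1 z\<close> and \<open>z\<^sup>2 k(z)\<close> are orthogonal on the circle.
\<close>
lemma circle_mean_poly_norm_square:
  "circle_mean (\<lambda>z. (norm (poly (pCons h0 (pCons h1 k)) z))\<^sup>2) =
    (norm h0)\<^sup>2 + (norm h1)\<^sup>2 + circle_mean (\<lambda>z. (norm (poly k z))\<^sup>2)"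
proof -
  define P where "P = pCons (cnj h0 * h1) (smult (cnj h0) k)"
  define Q where "Q = smult (cnj h1) k"
  have pw: "(norm (poly (pCons h0 (pCons h1 k)) z))\<^sup>2 =
     ((norm h0)\<^sup>2 + (norm h1)\<^sup>2) + (norm (poly k z))\<^sup>2 + 2 * Re (z ^ 1 * poly P z) + 2 * Re (z ^ 1 * poly Q z)"
    if "norm z = 1" for z
  proof -
    have zz: "z * cnj z = 1" using that complex_norm_square[of z] by simp
    have "complex_of_real ((norm (poly (pCons h0 (pCons h1 k)) z))\<^sup>2) =
       (h0 + z * (h1 + z * poly k z)) * cnj (h0 + z * (h1 + z * poly k z))"
      by (simp only: complex_norm_square poly_pCons)
    also have "\<dots> = h0 * cnj h0 + (z * cnj z) * (h1 * cnj h1) + (z * cnj z) * (z * cnj z) * (poly k z * cnj (poly k z))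
       + (z * poly P z + cnj (z * poly P z)) + (z * cnj z) * (z * poly Q z + cnj (z * poly Q z))"
      unfolding P_def Q_def by (simp add: algebra_simps)
    also have "\<dots> = of_real (((norm h0)\<^sup>2 + (norm h1)\<^sup>2) + (norm (poly k z))\<^sup>2 + 2 * Re (z ^ 1 * poly P z) + 2 * Re (z ^ 1 * poly Q z))"
      unfolding zz complex_add_cnj by (simp only: of_real_add complex_norm_square mult_1_left power_one_right)
    finally show ?thesis by (simp only: of_real_eq_iff)
  qed
  have RePQ: "integral {0..1} (\<lambda>x. Re (cis (2 * pi * x) ^ 1 * poly R (cis (2 * pi * x)))) = 0" for R
    using integral_linear[OF circle_integrable[of "\<lambda>z. z ^ 1 * poly R z"] bounded_linear_Re] circle_mean_power_poly[of 1 R]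
    by (simp add: o_def circle_mean_def continuous_intros)
  have i: "(\<lambda>x. Re (cis (2 * pi * x) ^ 1 * poly R (cis (2 * pi * x)))) integrable_on {0..1}"
    "(\<lambda>x. (norm (poly R (cis (2 * pi * x))))\<^sup>2) integrable_on {0..1}" for R
    by (intro circle_integrable[of "\<lambda>z. Re (z ^ 1 * poly R z)"] circle_integrable[of "\<lambda>z. (norm (poly R z))\<^sup>2"] continuous_intros)+
  have "((\<lambda>x. ((norm h0)\<^sup>2 + (norm h1)\<^sup>2) + (norm (poly k (cis (2 * pi * x))))\<^sup>2 +
       2 * Re (cis (2 * pi * x) ^ 1 * poly P (cis (2 * pi * x))) + 2 * Re (cis (2 * pi * x) ^ 1 * poly Q (cis (2 * pi * x)))) has_integral
     ((norm h0)\<^sup>2 + (norm h1)\<^sup>2) + circle_mean (\<lambda>z. (norm (poly k z))\<^sup>2) + 2 * 0 + 2 * 0) {0..1}"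
    unfolding circle_mean_def
    using i RePQ has_integral_const_real[of "(norm h0)\<^sup>2 + (norm h1)\<^sup>2" 0 1]
    by (intro has_integral_add has_integral_mult_right) (auto simp: has_integral_iff)
  then have "integral {0..1} (\<lambda>x. (norm (poly (pCons h0 (pCons h1 k)) (cis (2 * pi * x))))\<^sup>2) =
     ((norm h0)\<^sup>2 + (norm h1)\<^sup>2) + circle_mean (\<lambda>z. (norm (poly k z))\<^sup>2)"
    by (subst pw) (auto simp: integral_unique)
  then show ?thesis by (simp add: circle_mean_def)
qed

lemma circle_mean_le:
  fixes \<phi> \<psi> :: "complex \<Rightarrow> real"
  assumes "continuous_on UNIV \<phi>" "continuous_on UNIV \<psi>" "\<And>z. norm z = 1 \<Longrightarrow> \<phi> z \<le> A * \<psi> z + B"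
  shows "circle_mean \<phi> \<le> A * circle_mean \<psi> + B"
proof -
  have "((\<lambda>x. A * \<psi> (cis (2 * pi * x)) + B) has_integral A * circle_mean \<psi> + B) {0..1}"
    unfolding circle_mean_def using circle_integrable[OF assms(2)] has_integral_const_real[of B 0 1]
    by (intro has_integral_add has_integral_mult_right) (auto simp: has_integral_iff)
  then show ?thesis
    unfolding circle_mean_def using circle_integrable[OF assms(1)] assms(3)
    by (intro has_integral_le[OF integrable_integral]) auto
qed

section \<open>The local upper bound\<close>

text \<open>
  With \<open>w\<close> the sum over \<open>m\<close>, \<open>(1 + w)^s = H + O(w\<^sup>4)\<close> where \<open>H\<close> is a cubic polynomial in \<open>w\<close>. As a
  polynomial in \<open>z\<close>, \<open>H = 1 + s b_1 z + z\<^sup>2 k\<close> with \<open>k = O(\<rho>\<^sup>2)\<close>, so orthogonality gives the mean of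
  \<open>|H|\<^sup>2\<close> with an error \<open>O(\<rho>\<^sup>4)\<close>. Estimating \<open>|1 + w|^(2s)\<close> without orthogonality would
  leave terms of order \<open>\<rho>\<^sup>2\<close> and \<open>\<rho>\<^sup>3\<close>, which need not be summable over primes. The constants are uniform in
  \<open>s\<close>, as required for exponents that vary with \<open>N\<close>.
\<close>
lemma local_upper_bound:
  fixes C S :: real
  assumes C: "C \<ge> 0" and S: "S \<ge> 0"
  shows "\<exists>K\<ge>0. \<exists>r0>0. \<forall>\<rho> s L b. 0 \<le> \<rho> \<longrightarrow> \<rho> \<le> r0 \<longrightarrow> 0 < s \<longrightarrow> s \<le> S \<longrightarrow> 1 \<le> L \<longrightarrow>
    (\<forall>m\<in>{1..L}. norm (b m) \<le> C * \<rho> ^ m) \<longrightarrow>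
    circle_mean (\<lambda>z. norm (1 + (\<Sum>m=1..L. b m * z ^ m)) powr (2 * s)) \<le> 1 + s\<^sup>2 * (norm (b 1))\<^sup>2 + K * \<rho> ^ 4"
proof -
  define K1 where "K1 = (S + 3) ^ 4 * (2 powr S * 16)"
  define D where "D = 2 * C"
  define K2 where "K2 = S * D + S * (S + 1) / 2 * D\<^sup>2 + S * (S + 1) * (S + 2) / 6 * D ^ 3"
  define K where "K = K2\<^sup>2 + (2 * (1 + S * (D / 2) + K2) + K1 * D ^ 4) * (K1 * D ^ 4)"
  have D: "D \<ge> 0" using C by (simp add: D_def)
  have K1: "K1 \<ge> 0" using S by (simp add: K1_def)
  have K2: "K2 \<ge> 0" using S D by (simp add: K2_def)
  have K: "K \<ge> 0" using S D K1 K2 by (simp add: K_def)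
  define r0 where "r0 = min (1/2) (1 / (2 * D + 2))"
  have r0: "r0 > 0" using D by (simp add: r0_def)
  show ?thesis
  proof (rule exI[of _ K], rule conjI[OF K], rule exI[of _ r0], rule conjI[OF r0], intro allI impI)
    fix \<rho> s :: real and L :: nat and b :: "nat \<Rightarrow> complex"
    assume \<rho>: "0 \<le> \<rho>" "\<rho> \<le> r0" and s: "0 < s" "s \<le> S" and L: "1 \<le> L" and b: "\<forall>m\<in>{1..L}. norm (b m) \<le> C * \<rho> ^ m"
    have rh: "\<rho> \<le> 1/2" using \<rho> by (simp add: r0_def)
    have "\<rho> * D \<le> 1 / (2 * D + 2) * D"
      using \<rho> D by (intro mult_right_mono) (auto simp: r0_def)
    also have "\<dots> \<le> 1/2" using D by (simp add: field_simps)
    finally have rD: "D * \<rho> \<le> 1/2" by (simp add: mult.commute)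
    have \<rho>1: "\<rho> \<le> 1" using rh by simp
    define W where "W = (\<Sum>m=1..L. monom (b m) m)"
    have W: "poly W z = (\<Sum>m=1..L. b m * z ^ m)" for z
      by (simp add: W_def poly_sum poly_monom)
    have geo: "(\<Sum>m=k..L. \<rho> ^ m) \<le> 2 * \<rho> ^ k" for k
    proof -
      have "(\<Sum>m\<le>L. \<rho> ^ m) = (1 - \<rho> ^ Suc L) / (1 - \<rho>)"
        using rh by (subst sum_gp0) auto
      also have "\<dots> \<le> 2"
      proof -
        have "1 - \<rho> ^ Suc L \<le> 2 * (1 - \<rho>)"
          by (rule order_trans[of _ 1]) (use rh \<rho> in simp_all)
        then show ?thesis using rh by (simp add: pos_divide_le_eq)
      qed
      finally have "\<rho> ^ k * (\<Sum>m\<le>L. \<rho> ^ m) \<le> \<rho> ^ k * 2"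
        using \<rho> by (intro mult_left_mono) auto
      moreover have "(\<Sum>m=k..L. \<rho> ^ m) \<le> (\<Sum>m=k..k+L. \<rho> ^ m)"
        using \<rho> by (intro sum_mono2) auto
      moreover have "(\<Sum>m=k..k+L. \<rho> ^ m) = \<rho> ^ k * (\<Sum>m\<le>L. \<rho> ^ m)"
        unfolding sum_distrib_left by (rule sum.reindex_bij_witness[of _ "\<lambda>m. m + k" "\<lambda>m. m - k"]) (auto simp flip: power_add)
      ultimately show ?thesis by simp
    qed
    have tail: "norm (\<Sum>m=k..L. b m * z ^ m) \<le> D * \<rho> ^ k" if "norm z = 1" "k \<ge> 1" for z k
    proof -
      have "norm (\<Sum>m=k..L. b m * z ^ m) \<le> (\<Sum>m=k..L. C * \<rho> ^ m)"
        using b that by (intro sum_norm_le) (auto simp: norm_mult norm_power)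
      also have "\<dots> \<le> C * (2 * \<rho> ^ k)"
        unfolding sum_distrib_left[symmetric] using geo C by (intro mult_left_mono) auto
      finally show ?thesis by (simp add: D_def)
    qed
    have w1: "norm (poly W z) \<le> D * \<rho>" if "norm z = 1" for z
      using tail[OF that, of 1] by (simp add: W)
    have w2: "norm (poly W z - b 1 * z) \<le> D * \<rho>\<^sup>2" if "norm z = 1" for z
    proof -
      have "poly W z = b 1 * z ^ 1 + (\<Sum>m=2..L. b m * z ^ m)"
        unfolding W using L by (subst sum.atLeast_Suc_atMost) (auto simp: numeral_2_eq_2)
      then show ?thesis using tail[OF that, of 2] by simp
    qed
    define c2 where "c2 = s * (s - 1) / 2"
    define c3 where "c3 = s * (s - 1) * (s - 2) / 6"
    have as: "\<bar>s - 1\<bar> \<le> S + 1" "\<bar>s - 2\<bar> \<le> S + 2" using s by auto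
    have c2: "\<bar>c2\<bar> \<le> S * (S + 1) / 2"
      unfolding c2_def abs_divide abs_mult abs_numeral using s as by (intro divide_right_mono mult_mono) auto
    have c3: "\<bar>c3\<bar> \<le> S * (S + 1) * (S + 2) / 6"
      unfolding c3_def abs_divide abs_mult abs_numeral using s S as by (intro divide_right_mono mult_mono) auto
    define H where "H = 1 + smult (of_real s) W + smult (of_real c2) (W ^ 2) + smult (of_real c3) (W ^ 3)"
    have H: "poly H z = 1 + of_real s * poly W z + of_real c2 * poly W z ^ 2 + of_real c3 * poly W z ^ 3" for z
      by (simp add: H_def)
    have W0: "coeff W 0 = 0" unfolding W_def coeff_sum using L by (intro sum.neutral) auto
    have W1: "coeff W 1 = b 1" unfolding W_def coeff_sum using L by (simp add: coeff_monom sum.delta' if_distrib)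
    have H0: "coeff H 0 = 1" using W0 by (simp add: H_def coeff_0_power)
    have H1: "coeff H 1 = of_real s * b 1"
      using W0 W1 by (simp add: H_def power2_eq_square power3_eq_cube coeff_mult)
    define k where "k = poly_shift 2 H"
    have Hk: "H = pCons 1 (pCons (of_real s * b 1) k)"
    proof (rule poly_eqI)
      fix n
      show "coeff H n = coeff (pCons 1 (pCons (of_real s * b 1) k)) n"
        using H0 H1 by (cases n; cases "n - 1") (auto simp: k_def coeff_poly_shift coeff_pCons)
    qed
    have kb: "norm (poly k z) \<le> K2 * \<rho>\<^sup>2" if z: "norm z = 1" for z
    proof -
      have "poly H z = 1 + z * (of_real s * b 1 + z * poly k z)" by (simp add: Hk)
      then have "z ^ 2 * poly k z = of_real s * (poly W z - b 1 * z) + of_real c2 * poly W z ^ 2 + of_real c3 * poly W z ^ 3"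
        unfolding H by (simp add: algebra_simps power2_eq_square)
      moreover have "norm (z ^ 2 * poly k z) = norm (poly k z)" using z by (simp add: norm_mult norm_power)
      ultimately have "norm (poly k z) = norm (of_real s * (poly W z - b 1 * z) + of_real c2 * poly W z ^ 2 + of_real c3 * poly W z ^ 3)" by simp
      also have "\<dots> \<le> s * norm (poly W z - b 1 * z) + \<bar>c2\<bar> * norm (poly W z) ^ 2 + \<bar>c3\<bar> * norm (poly W z) ^ 3"
        using s by (intro norm_triangle_le add_mono) (auto simp: norm_mult norm_power)
      also have "\<dots> \<le> S * (D * \<rho>\<^sup>2) + S * (S + 1) / 2 * (D * \<rho>) ^ 2 + S * (S + 1) * (S + 2) / 6 * (D * \<rho>) ^ 3"
        using s S w1[OF z] w2[OF z] c2 c3 by (intro add_mono mult_mono power_mono) auto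
      also have "\<dots> \<le> S * (D * \<rho>\<^sup>2) + S * (S + 1) / 2 * (D ^ 2 * \<rho> ^ 2) + S * (S + 1) * (S + 2) / 6 * (D ^ 3 * \<rho> ^ 2)"
        unfolding power_mult_distrib using S D \<rho> \<rho>1 by (intro add_left_mono mult_left_mono power_decreasing) auto
      also have "\<dots> = K2 * \<rho>\<^sup>2" by (simp add: K2_def algebra_simps)
      finally show ?thesis .
    qed
    have pw: "norm (1 + (\<Sum>m=1..L. b m * z ^ m)) powr (2 * s) \<le> 1 * (norm (poly H z))\<^sup>2 + (2 * (1 + S * (D / 2) + K2) + K1 * D ^ 4) * (K1 * D ^ 4) * \<rho> ^ 4"
      if z: "norm z = 1" for z
    proof -
      define w where "w = poly W z"
      have w: "norm w \<le> 1/2" "norm w \<le> D * \<rho>" using w1[OF z] rD by (auto simp: w_def)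
      have nz: "1 + w \<noteq> 0" using w norm_triangle_ineq2[of 1 "- w"] by auto
      define E where "E = (1 + w) powr of_real s - poly H z"
      have "norm E \<le> K1 * norm w ^ 4"
        unfolding E_def H w_def[symmetric] c2_def c3_def K1_def using s w by (intro binomial_taylor_bound) auto
      also have "\<dots> \<le> K1 * (D * \<rho>) ^ 4" using K1 w by (intro mult_left_mono power_mono) auto
      finally have E: "norm E \<le> K1 * D ^ 4 * \<rho> ^ 4" by (simp add: power_mult_distrib)
      have \<rho>4: "\<rho> ^ 4 \<le> 1" using \<rho> \<rho>1 by (simp add: power_le_one)
      have E': "norm E \<le> K1 * D ^ 4"
        using E mult_left_mono[OF \<rho>4, of "K1 * D ^ 4"] K1 D by simp
      have Hb: "norm (poly H z) \<le> 1 + S * (D / 2) + K2"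
      proof -
        have "norm (poly H z) \<le> norm (1::complex) + (norm (of_real s * b 1 * z) + norm (z ^ 2 * poly k z))"
          unfolding Hk using norm_triangle_ineq[of 1 "of_real s * b 1 * z + z ^ 2 * poly k z"]
            norm_triangle_ineq[of "of_real s * b 1 * z" "z ^ 2 * poly k z"]
          by (simp add: algebra_simps power2_eq_square)
        also have "norm (of_real s * b 1 * z) \<le> S * (D / 2)"
        proof -
          have "norm (b 1) \<le> C * \<rho> ^ 1" using bspec[OF b, of 1] L by simp
          also have "\<dots> \<le> C * 1" using C \<rho>1 by (intro mult_left_mono) auto
          finally show ?thesis using s S z C by (auto simp: norm_mult D_def intro!: mult_mono)
        qed
        also have "norm (z ^ 2 * poly k z) \<le> K2"
          using kb[OF z] z K2 \<rho> \<rho>1 mult_left_mono[of "\<rho>\<^sup>2" 1 K2] by (simp add: norm_mult norm_power power_le_one)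
        finally show ?thesis by simp
      qed
      have "norm (1 + w) powr (2 * s) = (norm ((1 + w) powr of_real s))\<^sup>2"
        using nz by (simp add: norm_powr_of_real power2_eq_square flip: powr_add)
      also have "\<dots> \<le> (norm (poly H z) + norm E)\<^sup>2"
        unfolding E_def by (intro power_mono norm_ge_zero) (metis add.commute diff_add_cancel norm_triangle_ineq)
      also have "\<dots> = (norm (poly H z))\<^sup>2 + (2 * norm (poly H z) + norm E) * norm E"
        by (simp add: power2_eq_square algebra_simps)
      also have "\<dots> \<le> (norm (poly H z))\<^sup>2 + (2 * (1 + S * (D / 2) + K2) + K1 * D ^ 4) * (K1 * D ^ 4 * \<rho> ^ 4)"
        using Hb E E' K1 K2 S D by (intro add_left_mono mult_mono add_mono mult_left_mono) auto
      finally show ?thesis by (simp add: w_def W mult.assoc)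
    qed
    have "circle_mean (\<lambda>z. norm (1 + (\<Sum>m=1..L. b m * z ^ m)) powr (2 * s)) \<le>
        1 * circle_mean (\<lambda>z. (norm (poly H z))\<^sup>2) + (2 * (1 + S * (D / 2) + K2) + K1 * D ^ 4) * (K1 * D ^ 4) * \<rho> ^ 4"
      using s by (intro circle_mean_le pw continuous_on_powr_norm continuous_intros) auto
    also have "circle_mean (\<lambda>z. (norm (poly H z))\<^sup>2) \<le> 1 + s\<^sup>2 * (norm (b 1))\<^sup>2 + K2\<^sup>2 * \<rho> ^ 4"
    proof -
      have "circle_mean (\<lambda>z. (norm (poly k z))\<^sup>2) \<le> 0 * circle_mean (\<lambda>z. (norm (poly k z))\<^sup>2) + K2\<^sup>2 * \<rho> ^ 4"
      proof (intro circle_mean_le continuous_intros)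
        fix z :: complex assume "norm z = 1"
        then have "(norm (poly k z))\<^sup>2 \<le> (K2 * \<rho>\<^sup>2)\<^sup>2" by (intro power_mono kb) auto
        then show "(norm (poly k z))\<^sup>2 \<le> 0 * (norm (poly k z))\<^sup>2 + K2\<^sup>2 * \<rho> ^ 4" by (simp add: power_mult_distrib)
      qed
      then show ?thesis unfolding Hk circle_mean_poly_norm_square using s by (simp add: norm_mult power_mult_distrib)
    qed
    finally show "circle_mean (\<lambda>z. norm (1 + (\<Sum>m=1..L. b m * z ^ m)) powr (2 * s)) \<le> 1 + s\<^sup>2 * (norm (b 1))\<^sup>2 + K * \<rho> ^ 4"
      by (simp add: K_def algebra_simps)
  qed
qed

section \<open>The local lower bound\<close>

lemma circle_mean_holomorphic:
  fixes r :: real and h :: "complex \<Rightarrow> complex"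
  assumes h: "h holomorphic_on ball 0 1" and r: "0 < r" "r < 1"
  shows "((\<lambda>x. h (r * cis (2 * pi * x))) has_integral h 0) {0..1}"
    "((\<lambda>x. h (r * cis (2 * pi * x)) * cnj (cis (2 * pi * x))) has_integral r * deriv h 0) {0..1}"
proof -
  have sub: "cball 0 r \<subseteq> ball (0 :: complex) 1" "ball 0 r \<subseteq> ball (0 :: complex) 1" using r by auto
  have c: "continuous_on (cball 0 r) h" "h holomorphic_on ball 0 r"
    by (rule holomorphic_on_imp_continuous_on[OF holomorphic_on_subset[OF h sub(1)]])
       (rule holomorphic_on_subset[OF h sub(2)])
  have e: "exp (2 * of_real pi * \<i> * of_real x) = cis (2 * pi * x)" for x :: real
    by (simp add: cis_conv_exp mult_ac)
  have cc: "circlepath 0 r x = r * cis (2 * pi * x)" for x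
    unfolding circlepath e by simp
  have vd: "vector_derivative (circlepath 0 r) (at x within {0..1}) = 2 * pi * \<i> * (r * cis (2 * pi * x))" if "x \<in> {0..1}" for x
    using vector_derivative_circlepath01[of x 0 r] that unfolding e by (simp add: mult_ac)
  have inv: "cnj (cis a) = 1 / cis a" for a
    using cis_divide[of 0 a] by (simp add: cis_cnj)
  have eq: "h (circlepath 0 r x) / (circlepath 0 r x - 0) ^ Suc 0 * vector_derivative (circlepath 0 r) (at x within {0..1})
      = 2 * pi * \<i> * h (r * cis (2 * pi * x))"
    "h (circlepath 0 r x) / (circlepath 0 r x - 0) ^ Suc 1 * vector_derivative (circlepath 0 r) (at x within {0..1})
      = 2 * pi * \<i> / r * (h (r * cis (2 * pi * x)) * cnj (cis (2 * pi * x)))" if "x \<in> {0..1}" for x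
  proof -
    have "H / (r * z - 0) ^ Suc 0 * (2 * pi * \<i> * (r * z)) = 2 * pi * \<i> * H" if "z \<noteq> 0" for H z :: complex
      using r that by (simp add: field_simps)
    moreover have "H / (r * z - 0) ^ Suc 1 * (2 * pi * \<i> * (r * z)) = 2 * pi * \<i> / r * (H * (1 / z))" if "z \<noteq> 0" for H z :: complex
      using r that by (simp add: field_simps)
    ultimately show "h (circlepath 0 r x) / (circlepath 0 r x - 0) ^ Suc 0 * vector_derivative (circlepath 0 r) (at x within {0..1})
      = 2 * pi * \<i> * h (r * cis (2 * pi * x))"
    "h (circlepath 0 r x) / (circlepath 0 r x - 0) ^ Suc 1 * vector_derivative (circlepath 0 r) (at x within {0..1})
      = 2 * pi * \<i> / r * (h (r * cis (2 * pi * x)) * cnj (cis (2 * pi * x)))"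
      unfolding vd[OF that] cc inv by simp_all
  qed
  have "((\<lambda>u. h u / (u - 0) ^ Suc 0) has_contour_integral (2 * pi * \<i>) / fact 0 * (deriv ^^ 0) h 0) (circlepath 0 r)"
    by (rule Cauchy_has_contour_integral_higher_derivative_circlepath[OF c]) (use r in auto)
  from has_integral_mult_right[OF has_integral_eq[OF eq(1) this[unfolded has_contour_integral_def]], of "1 / (2 * pi * \<i>)"]
  show "((\<lambda>x. h (r * cis (2 * pi * x))) has_integral h 0) {0..1}" by simp
  have "((\<lambda>u. h u / (u - 0) ^ Suc 1) has_contour_integral (2 * pi * \<i>) / fact 1 * (deriv ^^ 1) h 0) (circlepath 0 r)"
    by (rule Cauchy_has_contour_integral_higher_derivative_circlepath[OF c]) (use r in auto)
  from has_integral_mult_right[OF has_integral_eq[OF eq(2) this[unfolded has_contour_integral_def]], of "r / (2 * pi * \<i>)"]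
  show "((\<lambda>x. h (r * cis (2 * pi * x)) * cnj (cis (2 * pi * x))) has_integral r * deriv h 0) {0..1}"
    using r by (simp add: field_simps)
qed

text \<open>
  Bessel's inequality for the orthonormal functions \<open>1\<close> and \<open>exp (2\<pi>ix)\<close>: expand the mean of
  \<open>|h - A - B e|\<^sup>2 \<ge> 0\<close>, where \<open>A\<close> and \<open>B\<close> are the first two Fourier coefficients on the circle of
  radius \<open>r\<close>.
\<close>
lemma bessel_two_terms:
  fixes r :: real and h :: "complex \<Rightarrow> complex"
  assumes h: "h holomorphic_on ball 0 1" and r: "0 < r" "r < 1"
  shows "(norm (h 0))\<^sup>2 + r\<^sup>2 * (norm (deriv h 0))\<^sup>2 \<le> integral {0..1} (\<lambda>x. (norm (h (r * cis (2 * pi * x))))\<^sup>2)"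
proof -
  define F where "F = (\<lambda>x. h (r * cis (2 * pi * x)))"
  define e where "e = (\<lambda>x. cis (2 * pi * x))"
  define A where "A = h 0"
  define B where "B = r * deriv h 0"
  have I: "(F has_integral A) {0..1}" "((\<lambda>x. F x * cnj (e x)) has_integral B) {0..1}"
    unfolding F_def e_def A_def B_def by (rule circle_mean_holomorphic[OF h r])+
  have "((\<lambda>x. cis (2 * pi * x) ^ 1) has_integral circle_mean (\<lambda>z. z ^ 1)) {0..1}"
    unfolding circle_mean_def by (intro integrable_integral circle_integrable[of "\<lambda>z. z ^ 1"] continuous_intros)
  then have Ie: "(e has_integral 0) {0..1}" using circle_mean_power[of 1] by (simp add: e_def)
  have "continuous_on {0..1} F"
    unfolding F_def
  proof (rule continuous_on_compose2[OF holomorphic_on_imp_continuous_on[OF h]])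
    show "(\<lambda>x. of_real r * cis (2 * pi * x)) ` {0..1} \<subseteq> ball 0 1" using r by (auto simp: norm_mult)
  qed (intro continuous_intros)
  then have "(\<lambda>x. (norm (F x))\<^sup>2) integrable_on {0..1}"
    by (intro integrable_continuous_real continuous_intros)
  then have IF: "((\<lambda>x. (norm (F x))\<^sup>2) has_integral integral {0..1} (\<lambda>x. (norm (F x))\<^sup>2)) {0..1}" by blast
  have Re: "((\<lambda>x. Re (f x)) has_integral Re y) {0..1}" if "(f has_integral y) {0..1}" for f :: "real \<Rightarrow> complex" and y
    using has_integral_linear[OF that bounded_linear_Re] by (simp add: o_def)
  have const: "((\<lambda>x::real. c) has_integral c) {0..1}" for c :: real
    using has_integral_const_real[of c 0 1] by simp
  have "((\<lambda>x. (norm (F x))\<^sup>2 + ((norm A)\<^sup>2 + (norm B)\<^sup>2) - 2 * Re (cnj A * F x) - 2 * Re (cnj B * (F x * cnj (e x))) + 2 * Re (cnj A * B * e x))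
     has_integral (integral {0..1} (\<lambda>x. (norm (F x))\<^sup>2) + ((norm A)\<^sup>2 + (norm B)\<^sup>2) - 2 * Re (cnj A * A) - 2 * Re (cnj B * B) + 2 * Re (cnj A * B * 0))) {0..1}"
    by (intro has_integral_add has_integral_diff has_integral_mult_right Re IF const I Ie)
  moreover have "(norm (F x))\<^sup>2 + ((norm A)\<^sup>2 + (norm B)\<^sup>2) - 2 * Re (cnj A * F x) - 2 * Re (cnj B * (F x * cnj (e x))) + 2 * Re (cnj A * B * e x)
      = (norm (F x - A - B * e x))\<^sup>2" for x
  proof -
    have ee: "e x * cnj (e x) = 1" using complex_norm_square[of "e x"] by (simp add: e_def)
    have "(F x - A - B * e x) * cnj (F x - A - B * e x) = F x * cnj (F x) + (A * cnj A + (e x * cnj (e x)) * (B * cnj B))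
       - (cnj A * F x + cnj (cnj A * F x)) - (cnj B * (F x * cnj (e x)) + cnj (cnj B * (F x * cnj (e x)))) + (cnj A * B * e x + cnj (cnj A * B * e x))"
      by (simp add: algebra_simps)
    also have "\<dots> = of_real ((norm (F x))\<^sup>2 + ((norm A)\<^sup>2 + (norm B)\<^sup>2) - 2 * Re (cnj A * F x) - 2 * Re (cnj B * (F x * cnj (e x))) + 2 * Re (cnj A * B * e x))"
      unfolding complex_add_cnj ee by (simp only: of_real_add of_real_diff complex_norm_square mult_1_left)
    finally show ?thesis by (simp only: complex_norm_square[symmetric] of_real_eq_iff)
  qed
  ultimately have "((\<lambda>x. (norm (F x - A - B * e x))\<^sup>2) has_integral
      (integral {0..1} (\<lambda>x. (norm (F x))\<^sup>2) + ((norm A)\<^sup>2 + (norm B)\<^sup>2) - 2 * Re (cnj A * A) - 2 * Re (cnj B * B) + 2 * Re (cnj A * B * 0))) {0..1}"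
    by simp
  then have "0 \<le> integral {0..1} (\<lambda>x. (norm (F x))\<^sup>2) + ((norm A)\<^sup>2 + (norm B)\<^sup>2) - 2 * Re (cnj A * A) - 2 * Re (cnj B * B) + 2 * Re (cnj A * B * 0)"
    by (rule has_integral_nonneg) simp
  moreover have sq: "Re (cnj z * z) = (norm z)\<^sup>2" for z
    unfolding cmod_power2 by (simp add: power2_eq_square)
  ultimately have "(norm A)\<^sup>2 + (norm B)\<^sup>2 \<le> integral {0..1} (\<lambda>x. (norm (F x))\<^sup>2)"
    unfolding sq by simp
  then show ?thesis
    using r by (simp add: A_def B_def F_def norm_mult power_mult_distrib)
qed

lemma coeff_1_eq_pderiv: "coeff p 1 = poly (pderiv p) 0"
  by (simp add: poly_0_coeff_0 coeff_pderiv)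

text \<open>
  Without zeros in the disc, \<open>p^s\<close> has a holomorphic branch \<open>h\<close> with \<open>|h|\<^sup>2 = |p|^(2s)\<close> and Taylor
  polynomial \<open>p_0^s (1 + s (p_1/p_0) z)\<close>, so this is Bessel's inequality for \<open>h\<close>. Zeros on the circle
  itself are admitted by letting the radius tend to \<open>1\<close>.
\<close>
lemma zero_free_lower_bound:
  fixes p :: "complex poly"
  assumes nz: "\<And>z. norm z < 1 \<Longrightarrow> poly p z \<noteq> 0" and s: "s > 0"
  shows "norm (coeff p 0) powr (2 * s) * (1 + s\<^sup>2 * (norm (coeff p 1) / norm (coeff p 0))\<^sup>2) \<le> circle_mean (\<lambda>z. norm (poly p z) powr (2 * s))"
proof -
  have hp: "poly p holomorphic_on ball 0 1" by (intro holomorphic_intros)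
  obtain g where "g holomorphic_on ball 0 1" "\<And>z. z \<in> ball 0 1 \<Longrightarrow> exp (g z) = poly p z"
    by (rule holomorphic_logarithm_exists[OF convex_ball open_ball hp, of 0]) (use nz in auto)
  then have g: "g holomorphic_on ball 0 1" "\<And>z. z \<in> ball 0 1 \<Longrightarrow> poly p z = exp (g z)" by simp_all
  define h where "h = (\<lambda>z. exp (of_real s * g z))"
  have hh: "h holomorphic_on ball 0 1" unfolding h_def by (intro holomorphic_intros g)
  have hn: "(norm (h z))\<^sup>2 = norm (poly p z) powr (2 * s)" if "z \<in> ball 0 1" for z
    using g(2)[OF that] by (simp add: h_def norm_exp_eq_Re powr_def power2_eq_square flip: exp_add)
  have dg: "(g has_field_derivative deriv g 0) (at 0)"
    using g(1) by (intro holomorphic_derivI[of g "ball 0 1"]) auto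
  have "(poly p has_field_derivative exp (g 0) * deriv g 0) (at 0)"
  proof (rule has_field_derivative_transform_within_open[of "\<lambda>z. exp (g z)" _ _ "ball 0 1"])
    show "((\<lambda>z. exp (g z)) has_field_derivative exp (g 0) * deriv g 0) (at 0)"
      by (rule DERIV_chain2[OF DERIV_exp dg])
  qed (use g(2) in auto)
  then have "poly (pderiv p) 0 = exp (g 0) * deriv g 0"
    using poly_DERIV[of p 0] DERIV_unique by blast
  moreover have p0: "coeff p 0 = exp (g 0)" using g(2)[of 0] by (simp add: poly_0_coeff_0)
  ultimately have dg0: "deriv g 0 = coeff p 1 / coeff p 0" unfolding coeff_1_eq_pderiv by simp
  have "(h has_field_derivative exp (of_real s * g 0) * (of_real s * deriv g 0)) (at 0)"
    unfolding h_def by (rule DERIV_chain2[OF DERIV_exp DERIV_cmult[OF dg]])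
  then have dh: "deriv h 0 = h 0 * (of_real s * (coeff p 1 / coeff p 0))"
    unfolding dg0 h_def by (rule DERIV_imp_deriv)
  define a where "a = norm (coeff p 0) powr (2 * s)"
  define y where "y = s\<^sup>2 * (norm (coeff p 1) / norm (coeff p 0))\<^sup>2"
  have h0: "(norm (h 0))\<^sup>2 = a" using hn[of 0] by (simp add: a_def poly_0_coeff_0)
  have h1: "(norm (deriv h 0))\<^sup>2 = a * y"
    unfolding dh norm_mult power_mult_distrib h0 y_def using s by (simp add: norm_divide power_divide)
  define I where "I = (\<lambda>r. integral {0..1} (\<lambda>x. norm (poly p (of_real r * cis (2 * pi * x))) powr (2 * s)))"
  have le: "a + r\<^sup>2 * (a * y) \<le> I r" if "0 < r" "r < 1" for r
  proof -
    have "I r = integral {0..1} (\<lambda>x. (norm (h (r * cis (2 * pi * x))))\<^sup>2)"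
      unfolding I_def by (intro integral_cong hn[symmetric]) (use that in \<open>auto simp: norm_mult\<close>)
    then show ?thesis using bessel_two_terms[OF hh that] h0 h1 by simp
  qed
  have contI: "continuous_on {0..1} I"
  proof -
    have "continuous_on ({0..1} \<times> cbox 0 1) (\<lambda>z. norm (poly p (of_real (fst z) * cis (2 * pi * snd z))) powr (2 * s))"
      using s by (intro continuous_on_powr_norm continuous_intros) auto
    then show ?thesis
      unfolding I_def using integral_continuous_on_param[of "{0..1}" 0 1 "\<lambda>r x. norm (poly p (of_real r * cis (2 * pi * x))) powr (2 * s)"]
      by (simp add: split_beta)
  qed
  have "0 \<le> I 1 - (a + 1\<^sup>2 * (a * y))"
  proof (rule continuous_ge_on_closure[where f = "\<lambda>r. I r - (a + r\<^sup>2 * (a * y))" and S = "{0<..<1::real}"])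
    show "continuous_on (closure {0<..<1}) (\<lambda>r. I r - (a + r\<^sup>2 * (a * y)))"
      using contI by (simp, intro continuous_intros)
  qed (use le in auto)
  then show ?thesis
    by (simp add: I_def circle_mean_def a_def y_def distrib_left)
qed

text \<open>
  A factor \<open>z - w\<close> with \<open>|w| < 1\<close> may be replaced by \<open>1 - cnj w z\<close>. This preserves the modulus on the
  circle, and \<open>|p_0| + e |p_1|\<close> does not decrease since \<open>t + e (1 - t\<^sup>2) \<le> 1\<close> for \<open>t = |w|\<close> and
  \<open>e \<le> 1/2\<close>. The factor \<open>u\<close> collects what is already free of zeros, so that the induction can run over
  the degree of the remaining factor \<open>h\<close>.
\<close>
lemma reflect_zeros:
  fixes u h :: "complex poly"
  assumes eps: "0 \<le> e" "e \<le> 1/2" and u: "\<And>z. norm z < 1 \<Longrightarrow> poly u z \<noteq> 0" and h: "h \<noteq> 0"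
  shows "\<exists>p. (\<forall>z. norm z < 1 \<longrightarrow> poly p z \<noteq> 0) \<and> (\<forall>z. norm z = 1 \<longrightarrow> norm (poly p z) = norm (poly (u * h) z)) \<and>
    norm (coeff (u * h) 0) + e * norm (coeff (u * h) 1) \<le> norm (coeff p 0) + e * norm (coeff p 1)"
  using u h
proof (induction "degree h" arbitrary: u h rule: less_induct)
  case less
  show ?case
  proof (cases "\<exists>w. norm w < 1 \<and> poly h w = 0")
    case False
    then show ?thesis using less.prems by (intro exI[of _ "u * h"]) auto
  next
    case True
    then obtain w where w: "norm w < 1" "poly h w = 0" by blast
    then obtain k where k: "h = [:- w, 1:] * k" by (metis dvdE poly_eq_0_iff_dvd)
    have k0: "k \<noteq> 0" using k less.prems by auto
    have deg: "degree k < degree h" unfolding k using k0 by (subst degree_mult_eq) auto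
    define v where "v = [:1, - cnj w:] * u"
    have v: "poly v z \<noteq> 0" if "norm z < 1" for z
    proof -
      have "norm (z * cnj w) < 1"
        using that w mult_strict_mono[of "norm z" 1 "norm w" 1] by (simp add: norm_mult)
      then have "1 - z * cnj w \<noteq> 0" by auto
      then show ?thesis using less.prems(1)[OF that] by (simp add: v_def algebra_simps)
    qed
    obtain p where p: "\<forall>z. norm z < 1 \<longrightarrow> poly p z \<noteq> 0" "\<forall>z. norm z = 1 \<longrightarrow> norm (poly p z) = norm (poly (v * k) z)"
      "norm (coeff (v * k) 0) + e * norm (coeff (v * k) 1) \<le> norm (coeff p 0) + e * norm (coeff p 1)"
      using less.hyps[OF deg v k0] by blast
    define R where "R = u * k"
    have uh: "u * h = [:- w, 1:] * R" and vk: "v * k = [:1, - cnj w:] * R"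
      by (simp_all only: R_def k v_def mult_ac)
    have "norm (poly (v * k) z) = norm (poly (u * h) z)" if z: "norm z = 1" for z
    proof -
      have "z * cnj z = 1" using complex_norm_square[of z] z by simp
      then have "z - w = z * cnj (1 - z * cnj w)" by (simp add: algebra_simps flip: mult.assoc)
      then have "norm (z - w) = norm (1 - z * cnj w)" using z by (metis complex_mod_cnj mult_1 norm_mult)
      moreover have "poly [:- w, 1:] z = z - w" "poly [:1, - cnj w:] z = 1 - z * cnj w" by simp_all
      ultimately show ?thesis unfolding uh vk poly_mult norm_mult by simp
    qed
    moreover have "norm (coeff (u * h) 0) + e * norm (coeff (u * h) 1) \<le> norm (coeff (v * k) 0) + e * norm (coeff (v * k) 1)"
    proof -
      define R0 where "R0 = coeff R 0"
      define Q where "Q = coeff R 1 - cnj w * R0"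
      define t where "t = norm w"
      have t: "0 \<le> t" "t < 1" using w by (auto simp: t_def)
      have c: "coeff (u * h) 0 = - w * R0" "coeff (u * h) 1 = R0 - w * coeff R 1" "coeff (v * k) 0 = R0" "coeff (v * k) 1 = Q"
        unfolding uh vk R0_def Q_def by (simp_all add: coeff_pCons)
      have "R0 - w * coeff R 1 = of_real (1 - t\<^sup>2) * R0 - w * Q"
        unfolding Q_def t_def of_real_diff complex_norm_square by (simp add: algebra_simps)
      then have "norm (R0 - w * coeff R 1) \<le> norm (of_real (1 - t\<^sup>2) * R0) + norm (w * Q)"
        by (metis norm_triangle_ineq4)
      also have "\<dots> = (1 - t\<^sup>2) * norm R0 + t * norm Q"
        using t by (simp add: norm_mult t_def power_le_one abs_square_le_1 flip: of_real_diff of_real_power)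
      finally have "e * norm (R0 - w * coeff R 1) \<le> e * ((1 - t\<^sup>2) * norm R0 + t * norm Q)"
        using eps by (intro mult_left_mono)
      moreover have "t + e * (1 - t\<^sup>2) \<le> 1"
      proof -
        have "e * (1 - t\<^sup>2) \<le> 1/2 * (1 - t\<^sup>2)" using eps t by (intro mult_right_mono) (auto simp: power_le_one)
        moreover have "(1 - t)\<^sup>2 \<ge> 0" by simp
        ultimately show ?thesis by (simp add: power2_eq_square algebra_simps)
      qed
      then have "(t + e * (1 - t\<^sup>2)) * norm R0 \<le> 1 * norm R0" by (intro mult_right_mono) auto
      moreover have "e * (t * norm Q) \<le> e * norm Q"
        using eps t by (intro mult_left_mono) (auto simp: mult_left_le_one_le)
      ultimately show ?thesis
        unfolding c norm_mult norm_minus_cancel t_def[symmetric] by (simp add: algebra_simps)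
    qed
    ultimately show ?thesis using p by (intro exI[of _ p]) force
  qed
qed

lemma norm_coeff_1_le:
  "norm (coeff p 1) \<le> circle_mean (\<lambda>z. norm (poly p z))"
proof -
  obtain a k where p: "p = pCons a k" by (cases p) auto
  obtain b l where k: "k = pCons b l" by (cases k) auto
  have i: "circle_mean (\<lambda>z. cnj z * poly p z) = coeff p 1"
  proof -
    have "cnj (cis t) * poly p (cis t) = a * cnj (cis t) + b + cis t ^ 1 * poly l (cis t)" for t
    proof -
      have "cis t * cnj (cis t) = 1" using complex_norm_square[of "cis t"] by simp
      then show ?thesis unfolding p k by (simp add: algebra_simps)
    qed
    note eq = this
    have pow: "((\<lambda>x. cis (2 * pi * x) ^ 1) has_integral 0) {0..1}"
      using integrable_integral[OF circle_integrable[of "\<lambda>z. z ^ 1"]] circle_mean_power[of 1]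
      by (simp add: circle_mean_def continuous_intros)
    have "((\<lambda>x. a * cnj (cis (2 * pi * x) ^ 1) + b + cis (2 * pi * x) ^ 1 * poly l (cis (2 * pi * x))) has_integral a * cnj 0 + b + 0) {0..1}"
    proof (intro has_integral_add has_integral_mult_right)
      show "((\<lambda>x. cnj (cis (2 * pi * x) ^ 1)) has_integral cnj 0) {0..1}"
        using has_integral_linear[OF pow bounded_linear_cnj] by (simp add: o_def)
      show "((\<lambda>x::real. b) has_integral b) {0..1}" using has_integral_const_real[of b 0 1] by simp
      show "((\<lambda>x. cis (2 * pi * x) ^ 1 * poly l (cis (2 * pi * x))) has_integral 0) {0..1}"
        using integrable_integral[OF circle_integrable[of "\<lambda>z. z ^ 1 * poly l z"]] circle_mean_power_poly[of 1 l]
        by (simp add: circle_mean_def continuous_intros)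
    qed
    then have "((\<lambda>x. cnj (cis (2 * pi * x)) * poly p (cis (2 * pi * x))) has_integral b) {0..1}"
      unfolding eq by simp
    then show ?thesis by (simp add: circle_mean_def integral_unique p k)
  qed
  have "norm (circle_mean (\<lambda>z. cnj z * poly p z)) \<le> circle_mean (\<lambda>z. norm (poly p z))"
    unfolding circle_mean_def
    by (intro integral_norm_bound_integral circle_integrable[of "\<lambda>z. cnj z * poly p z"]
        circle_integrable[of "\<lambda>z. norm (poly p z)"] continuous_intros) (simp add: norm_mult)
  then show ?thesis unfolding i .
qed

lemma exp_le_quadratic: "0 \<le> x \<Longrightarrow> x \<le> 1 \<Longrightarrow> exp x \<le> 1 + x + x\<^sup>2" for x :: real
  by (rule exp_bound)

lemma one_plus_powr_le:
  fixes x s :: real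
  assumes "x \<ge> 0" "0 < s" "s \<le> 1"
  shows "(1 + x) powr s \<le> 1 + s * x"
  using Youngs_inequality_0[of s "1 - s" "1 + x" 1] assms by (simp add: algebra_simps)

text \<open>
  Here \<open>y\<close> stands for \<open>s |p_1/p_0|\<close>. For \<open>s \<le> 1\<close> Bernoulli's inequality reduces the claim to the
  Cauchy-Schwarz inequality \<open>(1 + e y)\<^sup>2 \<le> (1 + e\<^sup>2) (1 + y\<^sup>2)\<close>. For \<open>s > 1\<close> the left side grows too
  fast in \<open>y\<close>, whence the restriction on \<open>e y\<close>.
\<close>
lemma local_ratio_bound:
  fixes e y s :: real
  assumes e: "0 \<le> e" "e \<le> 1/4" and y: "0 \<le> y" and s: "s > 0" and cond: "s \<le> 1 \<or> e * y \<le> 1/2"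
  shows "(1 + e / s * y) powr (2 * s) \<le> (1 + e\<^sup>2 + 8 * e ^ 4) * (1 + y\<^sup>2)"
proof (cases "s \<le> 1")
  case True
  have "(1 + e / s * y) powr (2 * s) = ((1 + e / s * y) powr s)\<^sup>2"
    by (simp add: power2_eq_square flip: powr_add)
  also have "\<dots> \<le> (1 + e * y)\<^sup>2"
    using one_plus_powr_le[of "e / s * y" s] e y s True by (intro power_mono) auto
  also have "\<dots> \<le> (1 + e\<^sup>2) * (1 + y\<^sup>2)"
    using zero_le_power2[of "e - y"] by (simp add: power2_eq_square algebra_simps)
  also have "\<dots> \<le> (1 + e\<^sup>2 + 8 * e ^ 4) * (1 + y\<^sup>2)"
    by (intro mult_right_mono) auto
  finally show ?thesis .
next
  case False
  then have ey: "e * y \<le> 1/2" using cond by simp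
  have "(1 + e / s * y) powr (2 * s) \<le> exp (e / s * y) powr (2 * s)"
    using e y s exp_ge_add_one_self[of "e / s * y"] by (intro powr_mono2) auto
  also have "\<dots> = exp (2 * (e * y))"
    using s by (simp add: powr_def)
  also have "\<dots> \<le> 1 + 2 * (e * y) + (2 * (e * y))\<^sup>2"
    using ey e y by (intro exp_le_quadratic) auto
  also have "\<dots> \<le> (1 + e\<^sup>2 + 8 * e ^ 4) * (1 + y\<^sup>2)"
  proof -
    \<comment> \<open>complete the square in \<open>y\<close>\<close>
    define m where "m = 1 - 4 * e\<^sup>2"
    have e2: "e\<^sup>2 \<le> 1/16" using power_mono[OF e(2) e(1), of 2] by (simp add: power2_eq_square)
    have m: "m > 0" using e2 by (simp add: m_def)
    have "m * (y\<^sup>2 * m - 2 * e * y + e\<^sup>2 + 8 * e ^ 4) = (m * y - e)\<^sup>2 + 4 * e ^ 4 * (1 - 8 * e\<^sup>2)"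
      by (simp add: m_def power2_eq_square power4_eq_xxxx algebra_simps)
    also have "\<dots> \<ge> 0" using e2 by (intro add_nonneg_nonneg mult_nonneg_nonneg) auto
    finally have "0 \<le> y\<^sup>2 * m - 2 * e * y + e\<^sup>2 + 8 * e ^ 4"
      using m by (simp add: zero_le_mult_iff)
    moreover have "0 \<le> y\<^sup>2 * (e\<^sup>2 + 8 * e ^ 4)" by simp
    ultimately show ?thesis by (simp add: m_def power2_eq_square algebra_simps)
  qed
  finally show ?thesis .
qed

text \<open>
  After reflecting zeros, the circle mean \<open>A\<close> of \<open>|p|^q\<close> is at least \<open>|p_0|^q (1 + y\<^sup>2)\<close> with
  \<open>y = s |p_1/p_0|\<close>, and \<open>local_ratio_bound\<close> compares this with the left side. In the remaining case
  \<open>s > 1\<close>, \<open>e y > 1/2\<close>, the coefficient \<open>p_0\<close> is so small compared with \<open>A^(1/q)\<close> that the trivial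
  bound for \<open>p_1\<close> suffices.
\<close>
lemma local_lower_bound:
  fixes q :: real
  assumes q: "q > 0"
  shows "\<exists>e0>0. \<forall>p e. 0 \<le> e \<longrightarrow> e \<le> e0 \<longrightarrow>
    (norm (coeff p 0) + e * norm (coeff p 1)) powr q \<le> (1 + e\<^sup>2 + 8 * e ^ 4) * circle_mean (\<lambda>z. norm (poly p z) powr q)"
proof -
  define s where "s = q / 2"
  have s: "s > 0" "q = 2 * s" using q by (auto simp: s_def)
  define e0 where "e0 = min (1/4) ((1/2) powr s / 2 :: real)"
  have e0: "e0 > 0" by (simp add: e0_def)
  show ?thesis
  proof (rule exI[of _ e0], rule conjI[OF e0], intro allI impI)
    fix p0 :: "complex poly" and e :: real
    assume e: "0 \<le> e" "e \<le> e0"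
    have e4: "e \<le> 1/4" using e by (simp add: e0_def)
    define A where "A = circle_mean (\<lambda>z. norm (poly p0 z) powr q)"
    show "(norm (coeff p0 0) + e * norm (coeff p0 1)) powr q \<le> (1 + e\<^sup>2 + 8 * e ^ 4) * A"
    proof (cases "p0 = 0")
      case True
      then show ?thesis using q by (simp add: A_def circle_mean_def)
    next
      case False
      obtain p where p: "\<forall>z. norm z < 1 \<longrightarrow> poly p z \<noteq> 0" "\<forall>z. norm z = 1 \<longrightarrow> norm (poly p z) = norm (poly (1 * p0) z)"
        "norm (coeff (1 * p0) 0) + e * norm (coeff (1 * p0) 1) \<le> norm (coeff p 0) + e * norm (coeff p 1)"
        using reflect_zeros[of e 1 p0] e e4 False by auto
      have A: "A = circle_mean (\<lambda>z. norm (poly p z) powr q)"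
        unfolding A_def circle_mean_def using p(2) by simp
      define a where "a = norm (coeff p 0)"
      define y where "y = s * (norm (coeff p 1) / a)"
      have a: "a > 0" using p(1)[rule_format, of 0] by (simp add: a_def poly_0_coeff_0)
      have y: "y \<ge> 0" using s a by (simp add: y_def)
      have p1: "norm (coeff p 1) = a * y / s" using s a by (simp add: y_def)
      have lower: "a powr q * (1 + y\<^sup>2) \<le> A"
        using zero_free_lower_bound[of p s] p(1) s unfolding A y_def a_def power_mult_distrib by simp
      have Apos: "A > 0" using lower a by (smt (verit) mult_pos_pos powr_gt_zero zero_le_power2)
      have key: "(a + e * norm (coeff p 1)) powr q \<le> (1 + e\<^sup>2 + 8 * e ^ 4) * A"
      proof (cases "s \<le> 1 \<or> e * y \<le> 1/2")
        case True
        have "a + e * norm (coeff p 1) = a * (1 + e / s * y)" unfolding p1 using s by (simp add: algebra_simps)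
        then have "(a + e * norm (coeff p 1)) powr q = a powr q * (1 + e / s * y) powr (2 * s)"
          using a e y s by (simp add: powr_mult)
        also have "\<dots> \<le> a powr q * ((1 + e\<^sup>2 + 8 * e ^ 4) * (1 + y\<^sup>2))"
          by (intro mult_left_mono local_ratio_bound e e4 y s True) auto
        also have "\<dots> = (1 + e\<^sup>2 + 8 * e ^ 4) * (a powr q * (1 + y\<^sup>2))" by simp
        also have "\<dots> \<le> (1 + e\<^sup>2 + 8 * e ^ 4) * A" using lower by (intro mult_left_mono) auto
        finally show ?thesis .
      next
        case False
        then have s1: "s > 1" and ey: "e * y > 1/2" by auto
        have epos: "e > 0" using ey e by (cases "e = 0") auto
        define M where "M = A powr (1 / q)"
        have M: "M > 0" "M powr q = A" using Apos q by (auto simp: M_def powr_powr)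
        have "1 \<le> (2 * e * y)\<^sup>2" using ey by (intro one_le_power) auto
        then have "a powr q * 1 \<le> a powr q * ((2 * e * y)\<^sup>2)" by (intro mult_left_mono) auto
        also have "\<dots> \<le> (2 * e)\<^sup>2 * (a powr q * (1 + y\<^sup>2))" by (simp add: power_mult_distrib algebra_simps)
        also have "\<dots> \<le> (2 * e)\<^sup>2 * A" using lower by (intro mult_left_mono) auto
        also have "\<dots> \<le> ((1/2) powr s)\<^sup>2 * A"
          using e Apos by (intro mult_right_mono power_mono) (auto simp: e0_def)
        also have "\<dots> = (1/2) powr q * M powr q"
          using M(2) unfolding s(2) by (simp add: power2_eq_square flip: powr_add)
        also have "\<dots> = (1/2 * M) powr q"
          using M(1) by (subst powr_mult) auto
        finally have "a powr q \<le> (1/2 * M) powr q" by simp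
        then have a_le: "a \<le> 1/2 * M"
          using powr_less_mono2[of q "1/2 * M" a] M(1) q by (cases "1/2 * M < a") auto
        have "norm (poly p z) \<le> M powr (1 - q) * norm (poly p z) powr q + M" for z
          using le_crude_power_mean[of "norm (poly p z)" M q] M(1) s s1 by simp
        then have "circle_mean (\<lambda>z. norm (poly p z)) \<le> M powr (1 - q) * circle_mean (\<lambda>z. norm (poly p z) powr q) + M"
          using q by (intro circle_mean_le continuous_on_powr_norm continuous_intros) auto
        also have "\<dots> = 2 * M"
          unfolding A[symmetric] M(2)[symmetric] using M(1) by (simp flip: powr_add)
        finally have "norm (coeff p 1) \<le> 2 * M" using norm_coeff_1_le[of p] by linarith
        then have "e * norm (coeff p 1) \<le> 1/4 * (2 * M)" using e e4 M by (intro mult_mono) auto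
        then have "a + e * norm (coeff p 1) \<le> M" using a_le by linarith
        then have "(a + e * norm (coeff p 1)) powr q \<le> M powr q" using a e q by (intro powr_mono2) auto
        also have "\<dots> \<le> (1 + e\<^sup>2 + 8 * e ^ 4) * A"
          unfolding M(2) using Apos by simp
        finally show ?thesis .
      qed
      have "(norm (coeff p0 0) + e * norm (coeff p0 1)) powr q \<le> (a + e * norm (coeff p 1)) powr q"
        using p(3) e q unfolding a_def by (intro powr_mono2) auto
      then show ?thesis using key by simp
    qed
  qed
qed

section \<open>Products over primes\<close>

text \<open>
  The indices that occur in the product over \<open>p \<in> A\<close> of local factors truncated at exponent \<open>L\<close>.
\<close>
definition smooth_numbers :: "nat set \<Rightarrow> nat \<Rightarrow> nat set" where
  "smooth_numbers A L = {n. n > 0 \<and> prime_factors n \<subseteq> A \<and> (\<forall>p\<in>A. multiplicity p n \<le> L)}"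

lemma smooth_empty: "smooth_numbers {} L = {1}"
  by (auto simp: smooth_numbers_def prime_factorization_empty_iff)

lemma prime_factors_prime_power_mult:
  assumes "prime p" "k > 0"
  shows "prime_factors (p ^ m * k :: nat) = (if m = 0 then {} else {p}) \<union> prime_factors k"
  using assms by (cases "m = 0") (simp_all add: prime_factors_product prime_factorization_prime_power prime_gt_0_nat)

lemma smooth_insert:
  assumes p: "prime p" "p \<notin> A" and A: "\<And>r. r \<in> A \<Longrightarrow> prime r"
  shows "bij_betw (\<lambda>(m, k). p ^ m * k) ({0..L} \<times> smooth_numbers A L) (smooth_numbers (insert p A) L)"
proof -
  have ndvd: "\<not> p dvd k" if "k \<in> smooth_numbers A L" for k
    using that p by (auto simp: smooth_numbers_def prime_factors_dvd)
  have mp: "multiplicity p (p ^ m * k) = m" if "k \<in> smooth_numbers A L" for m k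
  proof -
    have "multiplicity p (p ^ m * k) = multiplicity p (p ^ m) + multiplicity p k"
      using that p by (intro prime_elem_multiplicity_mult_distrib) (auto simp: smooth_numbers_def prime_gt_0_nat)
    then show ?thesis
      using ndvd[OF that] prime_gt_1_nat[OF p(1)] by (simp add: multiplicity_same_power' not_dvd_imp_multiplicity_0)
  qed
  have mr: "multiplicity r (p ^ m * k) = multiplicity r k" if "k > 0" "r \<in> A" for m k r
  proof -
    have "\<not> r dvd p ^ m"
      using A[OF that(2)] p that(2) by (metis prime_dvd_power_nat primes_dvd_imp_eq)
    then show ?thesis
      using that A[OF that(2)] p
      by (subst prime_elem_multiplicity_mult_distrib) (auto simp: not_dvd_imp_multiplicity_0 prime_gt_0_nat)
  qed
  show ?thesis
    unfolding bij_betw_def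
  proof (intro conjI equalityI subsetI)
    show "inj_on (\<lambda>(m, k). p ^ m * k) ({0..L} \<times> smooth_numbers A L)"
    proof (rule inj_onI, clarify)
      fix m k m' k' assume *: "k \<in> smooth_numbers A L" "k' \<in> smooth_numbers A L" "p ^ m * k = p ^ m' * k'"
      have "m = m'" using mp[OF *(1), of m] mp[OF *(2), of m'] *(3) by simp
      then show "m = m' \<and> k = k'" using *(3) p by (simp add: prime_gt_0_nat)
    qed
    fix n assume "n \<in> (\<lambda>(m, k). p ^ m * k) ` ({0..L} \<times> smooth_numbers A L)"
    then obtain m k where mk: "m \<le> L" "k \<in> smooth_numbers A L" "n = p ^ m * k" by auto
    then show "n \<in> smooth_numbers (insert p A) L"
      using p mp[OF mk(2), of m] mr[of k _ m] prime_factors_prime_power_mult[OF p(1), of k m]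
      by (auto simp: smooth_numbers_def prime_gt_0_nat)
  next
    fix n assume n: "n \<in> smooth_numbers (insert p A) L"
    then have n0: "n \<noteq> 0" by (simp add: smooth_numbers_def)
    have "\<not> is_unit p" using p by auto
    obtain k where k: "n = p ^ multiplicity p n * k" "\<not> p dvd k"
      using multiplicity_decompose'[OF n0 \<open>\<not> is_unit p\<close>] by metis
    have k0: "k > 0" using k n0 by (cases "k = 0") auto
    have "prime_factors k \<subseteq> prime_factors n" using k(1) n0 by (metis dvd_triv_right dvd_prime_factors)
    then have "prime_factors k \<subseteq> insert p A" using n by (auto simp: smooth_numbers_def)
    moreover have "p \<notin> prime_factors k" using k(2) by (auto simp: prime_factors_dvd)
    ultimately have "prime_factors k \<subseteq> A" by blast
    moreover have "multiplicity r k \<le> L" if "r \<in> A" for r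
      using mr[OF k0 that, of "multiplicity p n"] k(1) n that by (auto simp: smooth_numbers_def)
    ultimately have "k \<in> smooth_numbers A L" using k0 by (simp add: smooth_numbers_def)
    moreover have "multiplicity p n \<le> L" using n by (simp add: smooth_numbers_def)
    ultimately show "n \<in> (\<lambda>(m, k). p ^ m * k) ` ({0..L} \<times> smooth_numbers A L)"
      using k(1) by (intro image_eqI[of _ _ "(multiplicity p n, k)"]) auto
  qed
qed

lemma finite_smooth:
  assumes "finite A" "\<And>r. r \<in> A \<Longrightarrow> prime r"
  shows "finite (smooth_numbers A L)"
  using assms
proof (induction A rule: finite_induct)
  case (insert p A)
  then have "finite ({0..L} \<times> smooth_numbers A L)" by auto
  then show ?case
    using bij_betw_finite[OF smooth_insert[of p A L]] insert by auto
qed (simp add: smooth_empty)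

lemma zero_notin_smooth: "0 \<notin> smooth_numbers A L"
  by (simp add: smooth_numbers_def)

lemma coprime_prime_power_smooth:
  assumes "prime p" "p \<notin> A" "k \<in> smooth_numbers A L"
  shows "coprime (p ^ m) k"
proof -
  have "\<not> p dvd k" using assms by (auto simp: smooth_numbers_def prime_factors_dvd)
  then show ?thesis using assms by (simp add: prime_imp_coprime)
qed

lemma dirichlet_sum_smooth_insert:
  assumes c: "multiplicative_fun c" and p: "prime p" "p \<notin> A" and A: "\<And>r. r \<in> A \<Longrightarrow> prime r"
  shows "dirichlet_sum (twist p x c) (smooth_numbers (insert p A) L) t =
    (1 + (\<Sum>m=1..L. c (p ^ m) * cis (- (t * (real m * ln (real p)))) * cis (2 * pi * x) ^ m)) * dirichlet_sum c (smooth_numbers A L) t"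
proof -
  define b where "b = (\<lambda>m. c (p ^ m) * cis (- (t * (real m * ln (real p)))) * cis (2 * pi * x) ^ m)"
  have trm: "twist p x c (p ^ m * k) * cis (- (t * ln (real (p ^ m * k)))) = b m * (c k * cis (- (t * ln (real k))))"
    if k: "k \<in> smooth_numbers A L" for m k
  proof -
    have k0: "k > 0" "\<not> p dvd k" using k p by (auto simp: smooth_numbers_def prime_factors_dvd)
    have "multiplicity p (p ^ m * k) = m"
      using k0 p by (subst prime_elem_multiplicity_mult_distrib)
        (use prime_gt_1_nat[OF p(1)] in \<open>auto simp: multiplicity_same_power' not_dvd_imp_multiplicity_0\<close>)
    moreover have "c (p ^ m * k) = c (p ^ m) * c k"
      using c coprime_prime_power_smooth[OF p k, of m] k0 p unfolding multiplicative_fun_def by (simp add: prime_gt_0_nat)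
    moreover have "ln (real (p ^ m * k)) = real m * ln (real p) + ln (real k)"
      using p k0 by (simp add: ln_mult ln_realpow prime_gt_0_nat)
    moreover have "cis (2 * pi * x * real m) = cis (2 * pi * x) ^ m"
      using Complex.DeMoivre[of "2 * pi * x" m] by (simp add: mult_ac)
    moreover have "cis (- (t * (real m * ln (real p) + ln (real k)))) = cis (- (t * (real m * ln (real p)))) * cis (- (t * ln (real k)))"
      by (simp add: cis_mult algebra_simps)
    ultimately show ?thesis by (simp add: twist_def b_def mult_ac)
  qed
  have "dirichlet_sum (twist p x c) (smooth_numbers (insert p A) L) t =
      (\<Sum>(m, k)\<in>{0..L} \<times> smooth_numbers A L. twist p x c (p ^ m * k) * cis (- (t * ln (real (p ^ m * k)))))"
    unfolding dirichlet_sum_def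
    using sum.reindex_bij_betw[OF smooth_insert[OF p A], of "\<lambda>n. twist p x c n * cis (- (t * ln (real n)))" L, symmetric]
    by (simp add: case_prod_unfold A del: of_nat_mult of_nat_power)
  also have "\<dots> = (\<Sum>(m, k)\<in>{0..L} \<times> smooth_numbers A L. b m * (c k * cis (- (t * ln (real k)))))"
    by (intro sum.cong refl) (auto simp: trm simp del: of_nat_mult of_nat_power)
  also have "\<dots> = (\<Sum>m=0..L. b m) * dirichlet_sum c (smooth_numbers A L) t"
    by (simp add: dirichlet_sum_def sum_product sum.cartesian_product)
  also have "(\<Sum>m=0..L. b m) = 1 + (\<Sum>m=1..L. b m)"
    using c by (simp add: sum.atLeast_Suc_atMost b_def multiplicative_fun_def)
  finally show ?thesis by (simp add: b_def)
qed

text \<open>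
  After averaging the phase of \<open>p\<close>, the local factor at \<open>p\<close> contributes its circle mean, while the
  other factors do not depend on that phase.
\<close>
lemma moment_smooth_insert:
  assumes c: "multiplicative_fun c" and p: "prime p" "p \<notin> A" and A: "finite A" "\<And>r. r \<in> A \<Longrightarrow> prime r"
    and q: "q > 0"
    and B: "\<And>u. circle_mean (\<lambda>z. norm (1 + (\<Sum>m=1..L. c (p ^ m) * cis (u m) * z ^ m)) powr q) \<le> B"
  shows "moment q c (smooth_numbers (insert p A) L) \<le> B * moment q c (smooth_numbers A L)"
proof (rule has_mean_mono)
  have fin: "finite (smooth_numbers (insert p A) L)" "finite (smooth_numbers A L)"
    using A p by (auto intro!: finite_smooth)
  show "has_mean (\<lambda>t. integral {0..1} (\<lambda>x. norm (dirichlet_sum (twist p x c) (smooth_numbers (insert p A) L) t) powr q)) (moment q c (smooth_numbers (insert p A) L))"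
    by (rule has_mean_moment_avg[OF fin(1) zero_notin_smooth q p(1)])
  show "has_mean (\<lambda>t. B * norm (dirichlet_sum c (smooth_numbers A L) t) powr q) (B * moment q c (smooth_numbers A L))"
    by (rule has_mean_cmult[OF has_mean_moment[OF fin(2) zero_notin_smooth q]])
  show "continuous_on UNIV (\<lambda>t. integral {0..1} (\<lambda>x. norm (dirichlet_sum (twist p x c) (smooth_numbers (insert p A) L) t) powr q))"
    by (rule continuous_dirichlet_sum_avg[OF fin(1) zero_notin_smooth q p(1)])
  show "continuous_on UNIV (\<lambda>t. B * norm (dirichlet_sum c (smooth_numbers A L) t) powr q)"
    by (intro continuous_on_mult continuous_on_const continuous_dirichlet_sum_powr q)
  fix t
  have "integral {0..1} (\<lambda>x. norm (dirichlet_sum (twist p x c) (smooth_numbers (insert p A) L) t) powr q) =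
      circle_mean (\<lambda>z. norm (1 + (\<Sum>m=1..L. c (p ^ m) * cis (- (t * (real m * ln (real p)))) * z ^ m)) powr q) * norm (dirichlet_sum c (smooth_numbers A L) t) powr q"
  proof -
    have "norm (dirichlet_sum (twist p x c) (smooth_numbers (insert p A) L) t) powr q =
        norm (1 + (\<Sum>m=1..L. c (p ^ m) * cis (- (t * (real m * ln (real p)))) * cis (2 * pi * x) ^ m)) powr q *
        norm (dirichlet_sum c (smooth_numbers A L) t) powr q" for x
      by (subst dirichlet_sum_smooth_insert[OF c p A(2)]) (simp_all add: norm_mult powr_mult)
    then show ?thesis by (simp add: circle_mean_def)
  qed
  also have "\<dots> \<le> B * norm (dirichlet_sum c (smooth_numbers A L) t) powr q"
    by (intro mult_right_mono B) auto
  finally show "integral {0..1} (\<lambda>x. norm (dirichlet_sum (twist p x c) (smooth_numbers (insert p A) L) t) powr q) \<le> B * norm (dirichlet_sum c (smooth_numbers A L) t) powr q" .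
qed

lemma moment_const:
  assumes "q > 0"
  shows "moment q c {1} = norm (c 1) powr q"
proof (rule has_mean_unique)
  show "has_mean (\<lambda>t. norm (dirichlet_sum c {1} t) powr q) (moment q c {1})"
    by (rule has_mean_moment) (use assms in auto)
  show "has_mean (\<lambda>t. norm (dirichlet_sum c {1} t) powr q) (norm (c 1) powr q)"
    by (simp add: dirichlet_sum_def has_mean_const)
qed

lemma moment_smooth_le_prod:
  assumes c: "multiplicative_fun c" and A: "finite A" "\<And>r. r \<in> A \<Longrightarrow> prime r" and q: "q > 0"
    and B: "\<And>p u. p \<in> A \<Longrightarrow> circle_mean (\<lambda>z. norm (1 + (\<Sum>m=1..L. c (p ^ m) * cis (u m) * z ^ m)) powr q) \<le> B p"
    and B0: "\<And>p. p \<in> A \<Longrightarrow> B p \<ge> 0"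
  shows "moment q c (smooth_numbers A L) \<le> (\<Prod>p\<in>A. B p)"
  using A B B0
proof (induction A rule: finite_induct)
  case empty
  then show ?case using c q moment_const[of q c] by (simp add: smooth_empty multiplicative_fun_def)
next
  case (insert p A)
  have "moment q c (smooth_numbers (insert p A) L) \<le> B p * moment q c (smooth_numbers A L)"
    using insert by (intro moment_smooth_insert c q) auto
  also have "\<dots> \<le> B p * (\<Prod>p\<in>A. B p)"
    using insert by (intro mult_left_mono insert.IH) auto
  finally show ?case using insert by simp
qed

text \<open>
  Truncating the local factors at exponent \<open>N\<close> loses no index up to \<open>N\<close>, because \<open>p\<^sup>m > m\<close>.
\<close>
lemma upto_subset_smooth:
  "{n \<in> smooth_numbers {p. prime p \<and> p \<le> N} N. n \<le> N} = {1..N}"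
proof (intro equalityI subsetI)
  fix n assume n: "n \<in> {1..N}"
  have "p \<le> N" if "p \<in> prime_factors n" for p
    using that n by (auto dest!: in_prime_factors_imp_dvd dvd_imp_le)
  moreover have "multiplicity p n \<le> N" if "prime p" for p
  proof -
    have "multiplicity p n < 2 ^ multiplicity p n" by simp
    also have "2 ^ multiplicity p n \<le> p ^ multiplicity p n" using prime_ge_2_nat[OF that] by (rule power_mono) simp
    also have "\<dots> \<le> n" using n multiplicity_dvd[of p n] by (intro dvd_imp_le) auto
    finally show ?thesis using n by auto
  qed
  ultimately show "n \<in> {n \<in> smooth_numbers {p. prime p \<and> p \<le> N} N. n \<le> N}"
    using n by (auto simp: smooth_numbers_def)
qed (auto simp: smooth_numbers_def)

lemma multiplicative_fun_div_sqrt: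
  assumes "multiplicative_fun a"
  shows "multiplicative_fun (\<lambda>n. a n / of_real (sqrt (real n)))"
  using assms by (auto simp: multiplicative_fun_def real_sqrt_mult)

lemma prime_energy_nonneg: "prime_energy a N \<ge> 0"
  unfolding prime_energy_def by (intro sum_nonneg) auto

text \<open>
  All but boundedly many primes satisfy the hypothesis of \<open>local_upper_bound\<close> with
  \<open>\<rho> = p^(-(1/2 - \<theta>))\<close>; the others contribute a bounded factor each. The errors \<open>\<rho>\<^sup>4\<close> are summable over
  all integers since \<open>4 (1/2 - \<theta>) > 1\<close>.
\<close>
lemma euler_product_moment_le:
  assumes a: "multiplicative_fun a" and A: "condition_A a" and S: "S > 0"
  shows "\<exists>M\<ge>1. \<forall>N s. 0 < s \<longrightarrow> s \<le> S \<longrightarrow>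
    moment (2 * s) (\<lambda>n. a n / of_real (sqrt (real n))) (smooth_numbers {p. prime p \<and> p \<le> N} N) \<le> M * exp (s\<^sup>2 * prime_energy a N)"
proof -
  define c where "c = (\<lambda>n. a n / complex_of_real (sqrt (real n)))"
  have mc: "multiplicative_fun c" unfolding c_def by (rule multiplicative_fun_div_sqrt[OF a])
  obtain C \<theta> where C: "C > 0" "\<theta> < 1/4" "\<And>p m. prime p \<Longrightarrow> m > 0 \<Longrightarrow> norm (a (p ^ m)) \<le> C * real p powr (\<theta> * real m)"
    using A unfolding condition_A_def by blast
  define d where "d = 1/2 - \<theta>"
  have d: "d > 1/4" using C by (simp add: d_def)
  define \<rho> where "\<rho> = (\<lambda>p::nat. real p powr (- d))"
  have \<rho>0: "\<rho> p \<ge> 0" for p by (simp add: \<rho>_def)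
  have cb: "norm (c (p ^ m)) \<le> C * \<rho> p ^ m" if "prime p" "m > 0" for p m
  proof -
    have p0: "real p > 0" using that prime_gt_0_nat by auto
    have sq: "sqrt (real (p ^ m)) = real p powr (real m / 2)"
      using p0 by (simp add: real_sqrt_power powr_half_sqrt[symmetric] powr_powr flip: powr_realpow)
    have "norm (c (p ^ m)) = norm (a (p ^ m)) / real p powr (real m / 2)"
      unfolding c_def norm_divide norm_of_real sq by simp
    also have "\<dots> \<le> C * real p powr (\<theta> * real m) / real p powr (real m / 2)"
      using C(3)[OF that] by (intro divide_right_mono) auto
    also have "\<dots> = C * real p powr (- d * real m)"
    proof -
      have "- d * real m = \<theta> * real m - real m / 2" by (simp add: d_def algebra_simps)
      then show ?thesis using p0 by (simp add: powr_diff)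
    qed
    also have "real p powr (- d * real m) = \<rho> p ^ m"
      using p0 by (simp add: \<rho>_def powr_powr flip: powr_realpow)
    finally show ?thesis .
  qed
  have \<rho>2: "\<rho> p \<le> \<rho> 2" if "prime p" for p
    using prime_ge_2_nat[OF that] d unfolding \<rho>_def by (intro powr_mono2') auto
  have \<rho>21: "\<rho> 2 < 1" using d unfolding \<rho>_def by (simp add: powr_less_one)
  define D where "D = 1 + C / (1 - \<rho> 2)"
  have D: "D \<ge> 1" using C \<rho>21 by (simp add: D_def)
  from local_upper_bound[OF less_imp_le[OF C(1)] less_imp_le[OF S]]
  obtain K r0 where K: "K \<ge> 0" and r0: "r0 > 0" and loc: "\<forall>\<rho> s L b. 0 \<le> \<rho> \<longrightarrow> \<rho> \<le> r0 \<longrightarrow> 0 < s \<longrightarrow> s \<le> S \<longrightarrow> 1 \<le> L \<longrightarrow>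
    (\<forall>m\<in>{1..L}. norm (b m) \<le> C * \<rho> ^ m) \<longrightarrow>
    circle_mean (\<lambda>z. norm (1 + (\<Sum>m=1..L. b m * z ^ m)) powr (2 * s)) \<le> 1 + s\<^sup>2 * (norm (b 1))\<^sup>2 + K * \<rho> ^ 4"
    by blast
  have "((\<lambda>n. \<rho> n) \<longlongrightarrow> 0) sequentially"
    unfolding \<rho>_def using d by real_asymp
  then have "\<forall>\<^sub>F n in sequentially. \<rho> n < r0" using r0 by (rule order_tendstoD)
  then obtain P where P: "\<And>n. n \<ge> P \<Longrightarrow> \<rho> n < r0" unfolding eventually_sequentially by blast
  have summ: "summable (\<lambda>n. real n powr (- (4 * d)))"
    using d by (simp add: summable_real_powr_iff)
  define Z where "Z = (\<Sum>n. real n powr (- (4 * d)))"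
  define x where "x = (\<lambda>p. (norm (a p))\<^sup>2 / real p)"
  define E where "E = D powr (2 * S)"
  have E: "E \<ge> 1" using D S by (simp add: E_def ge_one_powr_ge_zero)
  define M where "M = E ^ P * exp (K * Z)"
  have Z: "Z \<ge> 0" unfolding Z_def by (intro suminf_nonneg summ) auto
  have M: "M \<ge> 1" using E K Z mult_mono[of 1 "E ^ P" 1 "exp (K * Z)"] by (simp add: M_def one_le_power)
  have "moment (2 * s) c (smooth_numbers {p. prime p \<and> p \<le> N} N) \<le> M * exp (s\<^sup>2 * prime_energy a N)" if s: "0 < s" "s \<le> S" for N s
  proof -
    define Q where "Q = {p. prime p \<and> p \<le> N}"
    have fQ: "finite Q" by (simp add: Q_def)
    define B where "B = (\<lambda>p. (if p < P then E else 1) * exp (s\<^sup>2 * x p + K * \<rho> p ^ 4))"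
    have x0: "x p \<ge> 0" for p by (simp add: x_def)
    have e1: "exp (s\<^sup>2 * x p + K * \<rho> p ^ 4) \<ge> 1 + s\<^sup>2 * x p + K * \<rho> p ^ 4" for p
      by (simp only: add.assoc exp_ge_add_one_self)
    have bound: "circle_mean (\<lambda>z. norm (1 + (\<Sum>m=1..N. c (p ^ m) * cis (u m) * z ^ m)) powr (2 * s)) \<le> B p"
      if "p \<in> Q" for p u
    proof -
      have p: "prime p" "p \<le> N" using that by (auto simp: Q_def)
      have N1: "1 \<le> N" using p prime_ge_2_nat[of p] by linarith
      have nb: "\<forall>m\<in>{1..N}. norm (c (p ^ m) * cis (u m)) \<le> C * \<rho> p ^ m"
        using cb[OF p(1)] by (auto simp: norm_mult)
      show ?thesis
      proof (cases "p < P")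
        case False
        have "circle_mean (\<lambda>z. norm (1 + (\<Sum>m=1..N. (c (p ^ m) * cis (u m)) * z ^ m)) powr (2 * s)) \<le>
            1 + s\<^sup>2 * (norm (c (p ^ 1) * cis (u 1)))\<^sup>2 + K * \<rho> p ^ 4"
        proof -
          have "\<rho> p \<le> r0" using P[of p] False by simp
          from loc[THEN spec, of "\<rho> p", THEN spec, of s, THEN spec, of N, THEN spec, of "\<lambda>m. c (p ^ m) * cis (u m)"]
            \<rho>0[of p] this s N1 nb
          show ?thesis by blast
        qed
        also have "(norm (c (p ^ 1) * cis (u 1)))\<^sup>2 = x p"
          by (simp add: c_def x_def norm_mult norm_divide power_divide)
        also note e1[of p]
        finally show ?thesis using False by (simp add: B_def)
      next
        case True
        have pw: "norm (1 + (\<Sum>m=1..N. c (p ^ m) * cis (u m) * z ^ m)) powr (2 * s) \<le> 0 * norm z + E" if z: "norm z = 1" for z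
        proof -
          have "norm (\<Sum>m=1..N. c (p ^ m) * cis (u m) * z ^ m) \<le> (\<Sum>m=1..N. C * \<rho> 2 ^ m)"
          proof (rule sum_norm_le)
            fix m assume m: "m \<in> {1..N}"
            have "norm (c (p ^ m) * cis (u m) * z ^ m) \<le> C * \<rho> p ^ m"
              using nb m z by (simp add: norm_mult norm_power)
            also have "\<dots> \<le> C * \<rho> 2 ^ m" using C \<rho>2[OF p(1)] \<rho>0 by (intro mult_left_mono power_mono) auto
            finally show "norm (c (p ^ m) * cis (u m) * z ^ m) \<le> C * \<rho> 2 ^ m" .
          qed
          also have "\<dots> = C * (\<Sum>m\<in>{1..N}. \<rho> 2 ^ m)" by (simp add: sum_distrib_left)
          also have "\<dots> \<le> C * (\<Sum>m. \<rho> 2 ^ m)"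
            using C \<rho>0 \<rho>21 by (intro mult_left_mono sum_le_suminf summable_geometric) auto
          also have "\<dots> = C / (1 - \<rho> 2)" using \<rho>0[of 2] \<rho>21 by (simp add: suminf_geometric)
          finally have "norm (1 + (\<Sum>m=1..N. c (p ^ m) * cis (u m) * z ^ m)) \<le> D"
            unfolding D_def by (intro norm_triangle_le) simp
          then have "norm (1 + (\<Sum>m=1..N. c (p ^ m) * cis (u m) * z ^ m)) powr (2 * s) \<le> D powr (2 * s)"
            using s by (intro powr_mono2) auto
          also have "\<dots> \<le> E" unfolding E_def using s D by (intro powr_mono) auto
          finally show ?thesis by simp
        qed
        have "circle_mean (\<lambda>z. norm (1 + (\<Sum>m=1..N. c (p ^ m) * cis (u m) * z ^ m)) powr (2 * s)) \<le> 0 * circle_mean (\<lambda>z::complex. norm z) + E"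
          using s by (intro circle_mean_le continuous_on_powr_norm continuous_intros pw) auto
        also have "\<dots> \<le> E * exp (s\<^sup>2 * x p + K * \<rho> p ^ 4)"
        proof -
          have "0 \<le> s\<^sup>2 * x p + K * \<rho> p ^ 4" using x0 K by (intro add_nonneg_nonneg mult_nonneg_nonneg) auto
          then have "1 \<le> exp (s\<^sup>2 * x p + K * \<rho> p ^ 4)" by simp
          then have "E * 1 \<le> E * exp (s\<^sup>2 * x p + K * \<rho> p ^ 4)" using E by (intro mult_left_mono) auto
          then show ?thesis by simp
        qed
        finally show ?thesis using True by (simp add: B_def)
      qed
    qed
    have "moment (2 * s) c (smooth_numbers Q N) \<le> (\<Prod>p\<in>Q. B p)"
    proof (rule moment_smooth_le_prod[OF mc fQ])
      show "prime r" if "r \<in> Q" for r using that by (simp add: Q_def)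
      show "2 * s > 0" using s by simp
      show "circle_mean (\<lambda>z. norm (1 + (\<Sum>m=1..N. c (p ^ m) * cis (u m) * z ^ m)) powr (2 * s)) \<le> B p"
        if "p \<in> Q" for p u by (rule bound[OF that])
      show "B p \<ge> 0" for p using E by (simp add: B_def)
    qed
    also have "\<dots> = (\<Prod>p\<in>Q. if p < P then E else 1) * exp (\<Sum>p\<in>Q. s\<^sup>2 * x p + K * \<rho> p ^ 4)"
      by (simp add: B_def prod.distrib exp_sum[OF fQ])
    also have "\<dots> \<le> E ^ P * exp (K * Z + s\<^sup>2 * prime_energy a N)"
    proof (rule mult_mono)
      have "(\<Prod>p\<in>Q. if p < P then E else 1) = E ^ card (Q \<inter> {p. p < P})"
        by (simp add: prod.If_cases[OF fQ])
      also have "\<dots> \<le> E ^ P"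
      proof (rule power_increasing[OF _ E])
        have "card (Q \<inter> {p. p < P}) \<le> card {..<P}" by (rule card_mono) auto
        then show "card (Q \<inter> {p. p < P}) \<le> P" by simp
      qed
      finally show "(\<Prod>p\<in>Q. if p < P then E else 1) \<le> E ^ P" .
      have "(\<Sum>p\<in>Q. \<rho> p ^ 4) = (\<Sum>p\<in>Q. real p powr (- (4 * d)))"
      proof (rule sum.cong[OF refl])
        fix p assume "p \<in> Q"
        then have "real p > 0" by (auto simp: Q_def prime_gt_0_nat)
        then show "\<rho> p ^ 4 = real p powr (- (4 * d))"
          by (simp add: \<rho>_def powr_powr mult.commute flip: powr_numeral)
      qed
      also have "\<dots> \<le> Z" unfolding Z_def using fQ by (intro sum_le_suminf summ) auto
      finally have "K * (\<Sum>p\<in>Q. \<rho> p ^ 4) \<le> K * Z" using K by (intro mult_left_mono)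
      then show "exp (\<Sum>p\<in>Q. s\<^sup>2 * x p + K * \<rho> p ^ 4) \<le> exp (K * Z + s\<^sup>2 * prime_energy a N)"
        unfolding prime_energy_def Q_def[symmetric] x_def[symmetric]
        by (simp add: sum.distrib flip: sum_distrib_left)
    qed (use E in auto)
    finally show ?thesis by (simp add: Q_def M_def exp_add)
  qed
  then show ?thesis unfolding c_def using M by blast
qed

section \<open>Upper bounds for the norm\<close>

lemma exp_powr: "exp x powr y = exp (x * y)" for x y :: real
  by (simp add: powr_def mult.commute)

lemma moment_restrict_gt_1:
  assumes "1 < q"
  shows "\<exists>C>0. \<forall>J c N. finite J \<longrightarrow> 0 \<notin> J \<longrightarrow> moment q c {n\<in>J. n \<le> N} \<le> C * moment q c J"
proof (cases "q \<le> 2")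
  case True
  then show ?thesis using assms moment_restrict_le_2[of _ q] by (intro exI[of _ "8 / (q - 1)"]) auto
next
  case False
  then show ?thesis using moment_restrict_ge_2[of _ q] by (intro exI[of _ "2 * q powr q"]) auto
qed

lemma norm_upper_gt_1:
  assumes a: "multiplicative_fun a" and A: "condition_A a" and q: "q > 1"
  shows "(\<lambda>N. mean_norm q (dirichlet_poly a N)) \<in> O(\<lambda>N. exp (q * prime_energy a N / 4))"
proof -
  define c where "c = (\<lambda>n. a n / complex_of_real (sqrt (real n)))"
  obtain C where C: "C > 0" "\<And>J c N. finite J \<Longrightarrow> 0 \<notin> J \<Longrightarrow> moment q c {n\<in>J. n \<le> N} \<le> C * moment q c J"
    using moment_restrict_gt_1[OF q] by blast
  have "\<exists>M\<ge>1. \<forall>N s. 0 < s \<longrightarrow> s \<le> q / 2 \<longrightarrow>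
      moment (2 * s) c (smooth_numbers {p. prime p \<and> p \<le> N} N) \<le> M * exp (s\<^sup>2 * prime_energy a N)"
    unfolding c_def by (rule euler_product_moment_le[OF a A]) (use q in simp)
  then obtain M where M: "M \<ge> 1" "\<And>N s. 0 < s \<Longrightarrow> s \<le> q / 2 \<Longrightarrow>
      moment (2 * s) c (smooth_numbers {p. prime p \<and> p \<le> N} N) \<le> M * exp (s\<^sup>2 * prime_energy a N)"
    by blast
  have "mean_norm q (dirichlet_poly a N) \<le> (C * M) powr (1 / q) * exp (q * prime_energy a N / 4)" for N
  proof -
    define J where "J = smooth_numbers {p. prime p \<and> p \<le> N} N"
    have J: "finite J" "0 \<notin> J" unfolding J_def by (auto intro!: finite_smooth zero_notin_smooth)
    have "moment q c {1..N} \<le> C * moment q c J"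
      using C(2)[OF J, of c N] upto_subset_smooth[of N] by (simp add: J_def)
    also have "\<dots> \<le> C * (M * exp ((q / 2)\<^sup>2 * prime_energy a N))"
      using M(2)[of "q / 2" N] C(1) q by (intro mult_left_mono) (auto simp: J_def)
    finally have "moment q c {1..N} powr (1 / q) \<le> (C * M * exp ((q / 2)\<^sup>2 * prime_energy a N)) powr (1 / q)"
      using q moment_nonneg[of "{1..N}" q c] by (intro powr_mono2) (auto simp: mult.assoc)
    also have "\<dots> = (C * M) powr (1 / q) * exp ((q / 2)\<^sup>2 * prime_energy a N * (1 / q))"
      using C M by (simp add: powr_mult exp_powr)
    also have "(q / 2)\<^sup>2 * prime_energy a N * (1 / q) = q * prime_energy a N / 4"
      using q by (simp add: power2_eq_square)
    finally show ?thesis by (simp add: mean_norm_dirichlet_poly c_def)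
  qed
  then show ?thesis
    by (intro bigoI[of _ "(C * M) powr (1 / q)"] always_eventually) (auto simp: mean_norm_dirichlet_poly)
qed

lemma norm_upper_lt_1:
  assumes a: "multiplicative_fun a" and A: "condition_A a" and q: "0 < q" "q < 1"
  shows "(\<lambda>N. mean_norm q (dirichlet_poly a N)) \<in> O(\<lambda>N. exp (prime_energy a N / 4))"
proof -
  define c where "c = (\<lambda>n. a n / complex_of_real (sqrt (real n)))"
  have "\<exists>M\<ge>1. \<forall>N s. 0 < s \<longrightarrow> s \<le> 1 / 2 \<longrightarrow>
      moment (2 * s) c (smooth_numbers {p. prime p \<and> p \<le> N} N) \<le> M * exp (s\<^sup>2 * prime_energy a N)"
    unfolding c_def by (rule euler_product_moment_le[OF a A]) simp
  then obtain M where M: "M \<ge> 1" "\<And>N s. 0 < s \<Longrightarrow> s \<le> 1 / 2 \<Longrightarrow>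
      moment (2 * s) c (smooth_numbers {p. prime p \<and> p \<le> N} N) \<le> M * exp (s\<^sup>2 * prime_energy a N)"
    by blast
  define C where "C = 16 / (1 - q)"
  have C: "C > 0" using q by (simp add: C_def)
  have "mean_norm q (dirichlet_poly a N) \<le> C powr (1 / q) * M * exp (prime_energy a N / 4)" for N
  proof -
    define J where "J = smooth_numbers {p. prime p \<and> p \<le> N} N"
    have J: "finite J" "0 \<notin> J" unfolding J_def by (auto intro!: finite_smooth zero_notin_smooth)
    define E where "E = M * exp (prime_energy a N / 4)"
    have E: "E > 0" using M by (simp add: E_def)
    have "moment 1 c J \<le> E"
      using M(2)[of "1 / 2" N] by (simp add: J_def E_def power2_eq_square)
    then have "moment q c {n\<in>J. n \<le> N} \<le> C * E powr q"
      unfolding C_def by (rule moment_restrict_lt_1[OF J q E])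
    then have "moment q c {1..N} powr (1 / q) \<le> (C * E powr q) powr (1 / q)"
      using q moment_nonneg[of "{1..N}" q c] upto_subset_smooth[of N] by (intro powr_mono2) (auto simp: J_def)
    also have "\<dots> = C powr (1 / q) * E"
      using C E q by (simp add: powr_mult powr_powr)
    finally show ?thesis by (simp add: mean_norm_dirichlet_poly c_def E_def)
  qed
  then show ?thesis
    by (intro bigoI[of _ "C powr (1 / q) * M"] always_eventually) (auto simp: mean_norm_dirichlet_poly)
qed

lemma prime_energy_mono: "N \<le> N' \<Longrightarrow> prime_energy a N \<le> prime_energy a N'"
  unfolding prime_energy_def by (intro sum_mono2) auto

text \<open>
  With \<open>q = 1 + 1/\<mu>\<close> and \<open>\<mu> = max 1 \<lambda>\<close>, the Riesz constant is \<open>8\<mu>\<close> and \<open>q \<lambda> \<le> \<lambda> + 1\<close>, so the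
  exponential changes by a bounded factor only. Since \<open>a p \<noteq> 0\<close> for some prime, \<open>\<lambda>\<close> is bounded below
  and \<open>\<mu>\<close> is at most a constant times \<open>\<lambda>\<close>, even if \<open>\<lambda>\<close> remains bounded.
\<close>
lemma norm_upper_eq_1:
  assumes a: "multiplicative_fun a" and A: "condition_A a" and p: "prime p" "a p \<noteq> 0"
  shows "(\<lambda>N. mean_norm 1 (dirichlet_poly a N)) \<in> O(\<lambda>N. prime_energy a N * exp (prime_energy a N / 4))"
proof -
  define c where "c = (\<lambda>n. a n / complex_of_real (sqrt (real n)))"
  have "\<exists>M\<ge>1. \<forall>N s. 0 < s \<longrightarrow> s \<le> 1 \<longrightarrow>
      moment (2 * s) c (smooth_numbers {p. prime p \<and> p \<le> N} N) \<le> M * exp (s\<^sup>2 * prime_energy a N)"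
    unfolding c_def by (rule euler_product_moment_le[OF a A]) simp
  then obtain M where M: "M \<ge> 1" "\<And>N s. 0 < s \<Longrightarrow> s \<le> 1 \<Longrightarrow>
      moment (2 * s) c (smooth_numbers {p. prime p \<and> p \<le> N} N) \<le> M * exp (s\<^sup>2 * prime_energy a N)"
    by blast
  define l where "l = prime_energy a"
  have l0: "l N \<ge> 0" for N by (simp add: l_def prime_energy_nonneg)
  have lp: "l p > 0"
  proof -
    have "0 < (norm (a p))\<^sup>2 / real p" using p by (simp add: prime_gt_0_nat)
    also have "\<dots> \<le> l p" unfolding l_def prime_energy_def
      using p by (intro member_le_sum) auto
    finally show ?thesis .
  qed
  define D where "D = max 1 (1 / l p)"
  have "mean_norm 1 (dirichlet_poly a N) \<le> (16 * M * exp (1 / 4) * D) * (l N * exp (l N / 4))" if N: "p \<le> N" for N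
  proof -
    define J where "J = smooth_numbers {p. prime p \<and> p \<le> N} N"
    have J: "finite J" "0 \<notin> J" unfolding J_def by (auto intro!: finite_smooth zero_notin_smooth)
    define \<mu> where "\<mu> = max 1 (l N)"
    define q where "q = 1 + 1 / \<mu>"
    have \<mu>: "\<mu> \<ge> 1" "l N \<le> \<mu>" by (auto simp: \<mu>_def)
    have q: "1 < q" "q \<le> 2" using \<mu> by (auto simp: q_def)
    have ql: "q * l N \<le> l N + 1" using \<mu> by (simp add: q_def field_simps)
    \<comment> \<open>an upper bound for the \<open>q\<close>-norm, valid because \<open>8 * \<mu> * M \<ge> 1\<close>\<close>
    define E where "E = 8 * \<mu> * M * exp (l N / 4 + 1 / 4)"
    have E: "E > 0" using \<mu> M by (simp add: E_def)
    have "moment q c {n\<in>J. n \<le> N} \<le> 8 / (q - 1) * moment q c J"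
      by (rule moment_restrict_le_2[OF J q])
    also have "\<dots> = 8 * \<mu> * moment q c J" by (simp add: q_def)
    also have "\<dots> \<le> 8 * \<mu> * (M * exp ((q / 2)\<^sup>2 * l N))"
      using M(2)[of "q / 2" N] \<mu> q by (intro mult_left_mono) (auto simp: J_def l_def)
    also have "\<dots> = (8 * \<mu> * M) powr 1 * exp (q / 4 * (q * l N))"
      using \<mu> M by (simp add: power2_eq_square mult_ac)
    also have "\<dots> \<le> (8 * \<mu> * M) powr q * exp (q / 4 * (l N + 1))"
    proof (intro mult_mono)
      have "1 * 1 \<le> (8 * \<mu>) * M" using \<mu> M by (intro mult_mono) auto
      then show "(8 * \<mu> * M) powr 1 \<le> (8 * \<mu> * M) powr q" using q by (intro powr_mono) auto
      show "exp (q / 4 * (q * l N)) \<le> exp (q / 4 * (l N + 1))" using ql q by simp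
    qed auto
    also have "\<dots> = E powr q"
      using \<mu> M by (simp add: E_def powr_mult exp_powr algebra_simps)
    finally have "moment q c {1..N} \<le> E powr q"
      using upto_subset_smooth[of N] by (simp add: J_def)
    then have "moment 1 c {1..N} \<le> 2 * E"
      using q E by (intro moment_1_le[of _ q]) auto
    also have "2 * E = 16 * M * exp (1 / 4) * (\<mu> * exp (l N / 4))"
      by (simp add: E_def exp_add)
    also have "\<dots> \<le> 16 * M * exp (1 / 4) * ((D * l N) * exp (l N / 4))"
    proof -
      have "l p \<le> l N" unfolding l_def by (rule prime_energy_mono[OF N])
      then have "1 \<le> 1 / l p * l N" using lp by (simp add: field_simps)
      also have "\<dots> \<le> D * l N" using l0 by (intro mult_right_mono) (auto simp: D_def)
      finally have "1 \<le> D * l N" .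
      moreover have "1 * l N \<le> D * l N" using l0 by (intro mult_right_mono) (auto simp: D_def)
      ultimately have "\<mu> \<le> D * l N" by (simp add: \<mu>_def)
      then show ?thesis using M by (intro mult_left_mono mult_right_mono) auto
    qed
    finally have "moment 1 c {1..N} \<le> (16 * M * exp (1 / 4) * D) * (l N * exp (l N / 4))"
      by (simp add: mult_ac)
    then show ?thesis
      using moment_nonneg[of "{1..N}" 1 c] by (simp add: mean_norm_dirichlet_poly c_def)
  qed
  then have "eventually (\<lambda>N. norm (mean_norm 1 (dirichlet_poly a N)) \<le> (16 * M * exp (1 / 4) * D) * norm (l N * exp (l N / 4))) sequentially"
    by (intro eventually_mono[OF eventually_ge_at_top[of p]]) (use l0 in \<open>auto simp: mean_norm_dirichlet_poly abs_mult\<close>)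
  then show ?thesis unfolding l_def by (rule bigoI)
qed

section \<open>Sums over squarefree numbers\<close>


text \<open>
  Squarefree numbers are represented by their sets of prime factors: this is the sum of \<open>w(n)\<close> over
  squarefree \<open>n \<le> N\<close> composed of primes in \<open>A\<close>, with \<open>w\<close> extended multiplicatively.
\<close>
definition sqsum :: "nat set \<Rightarrow> nat \<Rightarrow> (nat \<Rightarrow> real) \<Rightarrow> real" where
  "sqsum A N w = (\<Sum>B | B \<subseteq> A \<and> \<Prod>B \<le> N. \<Prod>p\<in>B. w p)"

lemma prod_primes_pos: "(\<And>r. r \<in> B \<Longrightarrow> prime r) \<Longrightarrow> \<Prod>B > (0::nat)"
  by (induction B rule: infinite_finite_induct) (auto simp: prime_gt_0_nat)

lemma prime_dvd_prod_primes:
  assumes "finite B" "\<And>r. r \<in> B \<Longrightarrow> prime (r::nat)" "prime p"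
  shows "p dvd \<Prod>B \<longleftrightarrow> p \<in> B"
proof
  assume "p dvd \<Prod>B"
  then obtain b where "b \<in> B" "p dvd b" using assms by (auto simp: prime_dvd_prod_iff)
  then show "p \<in> B" using assms primes_dvd_imp_eq by blast
qed (use assms in \<open>auto intro: dvd_prodI\<close>)

lemma sqsum_nonneg: "(\<And>p. p \<in> A \<Longrightarrow> w p \<ge> 0) \<Longrightarrow> sqsum A N w \<ge> 0"
  unfolding sqsum_def by (intro sum_nonneg prod_nonneg) auto

lemma sqsum_insert_le:
  assumes A: "finite A" "p \<notin> A" "p > 0" and w: "\<And>p. w p \<ge> 0"
  shows "sqsum (insert p A) N w \<le> (1 + w p) * sqsum A N w"
proof -
  have fin: "finite {B. B \<subseteq> A \<and> \<Prod>B \<le> N}" "finite {B. B \<subseteq> insert p A \<and> \<Prod>B \<le> N}"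
    using A(1) by (auto intro: finite_subset[of _ "Pow (insert p A)"])
  have "sqsum (insert p A) N w \<le> (\<Sum>B\<in>{B. B \<subseteq> A \<and> \<Prod>B \<le> N} \<union> insert p ` {B. B \<subseteq> A \<and> \<Prod>B \<le> N}. \<Prod>p\<in>B. w p)"
    unfolding sqsum_def
  proof (rule sum_mono2)
    show "{B. B \<subseteq> insert p A \<and> \<Prod>B \<le> N} \<subseteq> {B. B \<subseteq> A \<and> \<Prod>B \<le> N} \<union> insert p ` {B. B \<subseteq> A \<and> \<Prod>B \<le> N}"
    proof
      fix B assume B: "B \<in> {B. B \<subseteq> insert p A \<and> \<Prod>B \<le> N}"
      then have fB: "finite B" using A(1) by (auto intro: finite_subset)
      show "B \<in> {B. B \<subseteq> A \<and> \<Prod>B \<le> N} \<union> insert p ` {B. B \<subseteq> A \<and> \<Prod>B \<le> N}"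
      proof (cases "p \<in> B")
        case True
        have "\<Prod>B = p * \<Prod>(B - {p})" using fB True by (rule prod.remove)
        then have "\<Prod>(B - {p}) \<le> \<Prod>B" using A(3) by simp
        then have "B - {p} \<in> {B. B \<subseteq> A \<and> \<Prod>B \<le> N}" using B by auto
        moreover have "B = insert p (B - {p})" using True by auto
        ultimately show ?thesis by blast
      next
        case False
        then show ?thesis using B by auto
      qed
    qed
  qed (use fin w in \<open>auto intro: prod_nonneg\<close>)
  also have "\<dots> = sqsum A N w + (\<Sum>B\<in>insert p ` {B. B \<subseteq> A \<and> \<Prod>B \<le> N}. \<Prod>p\<in>B. w p)"
    unfolding sqsum_def using fin A(2) by (intro sum.union_disjoint) auto
  also have "(\<Sum>B\<in>insert p ` {B. B \<subseteq> A \<and> \<Prod>B \<le> N}. \<Prod>p\<in>B. w p) = (\<Sum>B | B \<subseteq> A \<and> \<Prod>B \<le> N. \<Prod>p\<in>insert p B. w p)"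
    using A(2) by (subst sum.reindex) (auto simp: inj_on_def o_def)
  also have "\<dots> = (\<Sum>B | B \<subseteq> A \<and> \<Prod>B \<le> N. w p * (\<Prod>p\<in>B. w p))"
  proof (rule sum.cong[OF refl])
    fix B assume "B \<in> {B. B \<subseteq> A \<and> \<Prod>B \<le> N}"
    then have "finite B" "p \<notin> B" using A by (auto intro: finite_subset)
    then show "(\<Prod>p\<in>insert p B. w p) = w p * (\<Prod>p\<in>B. w p)" by simp
  qed
  also have "\<dots> = w p * sqsum A N w" by (simp add: sqsum_def sum_distrib_left)
  finally show ?thesis by (simp add: algebra_simps)
qed

lemma sqsum_union_le:
  assumes "finite A1" "finite A2" "A1 \<inter> A2 = {}" "\<And>p. p \<in> A1 \<Longrightarrow> p > 0" "\<And>p. w p \<ge> 0"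
  shows "sqsum (A1 \<union> A2) N w \<le> (\<Prod>p\<in>A1. 1 + w p) * sqsum A2 N w"
  using assms(1,3,4)
proof (induction A1 rule: finite_induct)
  case (insert p A1)
  have "sqsum (insert p (A1 \<union> A2)) N w \<le> (1 + w p) * sqsum (A1 \<union> A2) N w"
    using insert assms by (intro sqsum_insert_le) auto
  also have "\<dots> \<le> (1 + w p) * ((\<Prod>p\<in>A1. 1 + w p) * sqsum A2 N w)"
    using insert assms(5)[of p] by (intro mult_left_mono insert.IH) auto
  finally show ?case using insert by (simp add: mult.assoc)
qed simp

lemma prod_one_plus_eq_sum:
  assumes "finite A"
  shows "(\<Prod>p\<in>A. 1 + w p) = (\<Sum>B\<in>Pow A. \<Prod>p\<in>B. w p :: real)"
  using assms
proof (induction A rule: finite_induct)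
  case (insert p A)
  have "(\<Sum>B\<in>Pow (insert p A). \<Prod>p\<in>B. w p) = (\<Sum>B\<in>Pow A. \<Prod>p\<in>B. w p) + (\<Sum>B\<in>insert p ` Pow A. \<Prod>p\<in>B. w p)"
    unfolding Pow_insert using insert by (intro sum.union_disjoint) auto
  also have "(\<Sum>B\<in>insert p ` Pow A. \<Prod>p\<in>B. w p) = (\<Sum>B\<in>Pow A. \<Prod>p\<in>insert p B. w p)"
    using insert(2) by (subst sum.reindex) (auto simp: inj_on_def o_def)
  also have "\<dots> = (\<Sum>B\<in>Pow A. w p * (\<Prod>p\<in>B. w p))"
  proof (rule sum.cong[OF refl])
    fix B assume "B \<in> Pow A"
    then have "finite B" "p \<notin> B" using insert by (auto intro: finite_subset)
    then show "(\<Prod>p\<in>insert p B. w p) = w p * (\<Prod>p\<in>B. w p)" by simp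
  qed
  finally show ?case using insert by (simp add: sum_distrib_left sum.distrib distrib_right)
qed simp

text \<open>
  Rankin's trick: \<open>1 \<le> (N/n)^\<sigma>\<close> for all \<open>n \<le> N\<close>; then the restriction on \<open>n\<close> may be dropped.
\<close>
lemma sqsum_rankin:
  assumes A: "finite A" "\<And>r. r \<in> A \<Longrightarrow> prime r" and w: "\<And>p. w p \<ge> 0" and \<sigma>: "\<sigma> \<ge> 0"
  shows "sqsum A N w \<le> real N powr \<sigma> * (\<Prod>p\<in>A. 1 + w p * real p powr (- \<sigma>))"
proof -
  have "sqsum A N w \<le> (\<Sum>B | B \<subseteq> A \<and> \<Prod>B \<le> N. real N powr \<sigma> * (\<Prod>p\<in>B. w p * real p powr (- \<sigma>)))"
    unfolding sqsum_def
  proof (rule sum_mono)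
    fix B assume B: "B \<in> {B. B \<subseteq> A \<and> \<Prod>B \<le> N}"
    have "\<Prod>B > 0" using A B by (intro prod_primes_pos) auto
    then have pos: "real (\<Prod>B) > 0" by (simp only: of_nat_0_less_iff)
    have "(\<Prod>p\<in>B. real p powr (- \<sigma>)) = (\<Prod>p\<in>B. real p) powr (- \<sigma>)"
      by (rule prod_powr_distrib[symmetric])
    also have "\<dots> = real (\<Prod>B) powr (- \<sigma>)" by (simp only: of_nat_prod)
    finally have e: "(\<Prod>p\<in>B. real p powr (- \<sigma>)) = real (\<Prod>B) powr (- \<sigma>)" .
    have "1 = real (\<Prod>B) powr \<sigma> * real (\<Prod>B) powr (- \<sigma>)" using pos by (simp del: of_nat_prod flip: powr_add)
    also have "\<dots> \<le> real N powr \<sigma> * real (\<Prod>B) powr (- \<sigma>)"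
      using B \<sigma> by (intro mult_right_mono powr_mono2) (auto simp del: of_nat_prod)
    finally have "(\<Prod>p\<in>B. w p) * 1 \<le> (\<Prod>p\<in>B. w p) * (real N powr \<sigma> * real (\<Prod>B) powr (- \<sigma>))"
      using w by (intro mult_left_mono prod_nonneg) auto
    then show "(\<Prod>p\<in>B. w p) \<le> real N powr \<sigma> * (\<Prod>p\<in>B. w p * real p powr (- \<sigma>))"
      unfolding prod.distrib e by (simp add: mult_ac)
  qed
  also have "\<dots> \<le> (\<Sum>B\<in>Pow A. real N powr \<sigma> * (\<Prod>p\<in>B. w p * real p powr (- \<sigma>)))"
    using A w by (intro sum_mono2) (auto intro!: mult_nonneg_nonneg prod_nonneg)
  also have "\<dots> = real N powr \<sigma> * (\<Prod>p\<in>A. 1 + w p * real p powr (- \<sigma>))"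
    unfolding prod_one_plus_eq_sum[OF A(1)] sum_distrib_left ..
  finally show ?thesis .
qed

lemma num_divisors_mult_prime:
  assumes "prime p" "\<not> p dvd m" "m > 0"
  shows "num_divisors (p * m) = 2 * num_divisors m"
proof -
  have fin: "finite {k. k dvd m}" using assms by simp
  have "{k. k dvd p * m} = {k. k dvd m} \<union> (\<lambda>k. p * k) ` {k. k dvd m}"
  proof (intro equalityI subsetI)
    fix k assume k: "k \<in> {k. k dvd p * m}"
    show "k \<in> {k. k dvd m} \<union> (\<lambda>k. p * k) ` {k. k dvd m}"
    proof (cases "p dvd k")
      case True
      then obtain j where "k = p * j" ..
      then show ?thesis using k assms by (auto simp: prime_gt_0_nat)
    next
      case False
      then have "coprime k p" using assms(1) by (metis coprime_commute prime_imp_coprime)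
      then show ?thesis using k by (simp add: coprime_dvd_mult_right_iff)
    qed
  qed auto
  then have "num_divisors (p * m) = card {k. k dvd m} + card ((\<lambda>k. p * k) ` {k. k dvd m})"
    unfolding num_divisors_def using fin assms by (simp, intro card_Un_disjoint) (auto dest: dvd_trans[OF dvd_triv_left])
  also have "card ((\<lambda>k. p * k) ` {k. k dvd m}) = card {k. k dvd m}"
    using assms by (intro card_image) (auto simp: inj_on_def prime_gt_0_nat)
  finally show ?thesis by (simp add: num_divisors_def)
qed

lemma prod_primes_facts:
  assumes "finite B" "\<And>r. r \<in> B \<Longrightarrow> prime r" and a: "multiplicative_fun a"
  shows "num_divisors (\<Prod>B) = 2 ^ card B" "a (\<Prod>B) = (\<Prod>p\<in>B. a p)" "squarefree (\<Prod>B)" "prime_factors (\<Prod>B) = B"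
proof -
  have *: "num_divisors (\<Prod>B) = 2 ^ card B \<and> a (\<Prod>B) = (\<Prod>p\<in>B. a p)"
    using assms(1,2)
  proof (induction B rule: finite_induct)
    case empty
    then show ?case using a by (simp add: num_divisors_def multiplicative_fun_def)
  next
    case (insert p B)
    have p: "prime p" and B: "\<And>r. r \<in> B \<Longrightarrow> prime r" using insert by auto
    have nd: "\<not> p dvd \<Prod>B" using prime_dvd_prod_primes[OF insert(1) B p] insert by auto
    moreover have pos: "\<Prod>B > 0" using prod_primes_pos[of B] B by auto
    moreover have "coprime p (\<Prod>B)" using nd p by (simp add: prime_imp_coprime)
    ultimately show ?case
      using insert.IH[OF B] insert(1,2) num_divisors_mult_prime[OF p nd pos] a p
      unfolding multiplicative_fun_def by (auto simp: prime_gt_0_nat)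
  qed
  then show "num_divisors (\<Prod>B) = 2 ^ card B" "a (\<Prod>B) = (\<Prod>p\<in>B. a p)" by auto
  show "squarefree (\<Prod>B)"
    using assms(2) by (intro squarefree_prod_coprime) (auto simp: primes_coprime squarefree_prime)
  show "prime_factors (\<Prod>B) = B"
    using prime_dvd_prod_primes[OF assms(1,2)] prod_primes_pos[OF assms(2)] assms(2)
    by (auto simp: prime_factors_dvd)
qed

lemma prod_prime_factors_squarefree:
  assumes "squarefree (n :: nat)"
  shows "\<Prod>(prime_factors n) = n"
proof -
  have n: "n \<noteq> 0" using assms by (metis not_squarefree_0)
  have "\<Prod>(prime_factors n) = (\<Prod>p\<in>prime_factors n. p ^ multiplicity p n)"
    using assms squarefree_factorial_semiring'[OF n] by (intro prod.cong) auto
  also have "\<dots> = n" using n prime_factorization_nat[of n] by simp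
  finally show ?thesis .
qed

text \<open>
  On squarefree \<open>n\<close> the divisor function is \<open>2^\<omega>(n)\<close>, so the sum in condition (B) has multiplicative
  weights.
\<close>
lemma squarefree_sum_eq_sqsum:
  assumes a: "multiplicative_fun a"
  shows "(\<Sum>n | n \<ge> 1 \<and> real n \<le> real N.
           real_of_int \<bar>moebius n\<bar> * (norm (a n))\<^sup>2 / real n * real (num_divisors n) powr r)
     = sqsum {p. prime p \<and> p \<le> N} N (\<lambda>p. 2 powr r * ((norm (a p))\<^sup>2 / real p))"
proof -
  define A where "A = {p. prime p \<and> p \<le> N}"
  define f where "f = (\<lambda>n. real_of_int \<bar>moebius n\<bar> * (norm (a n))\<^sup>2 / real n * real (num_divisors n) powr r)"
  have A: "finite A" "\<And>r. r \<in> A \<Longrightarrow> prime r" by (auto simp: A_def)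
  have bij: "bij_betw (\<lambda>B. \<Prod>B) {B. B \<subseteq> A \<and> \<Prod>B \<le> N} {n. n \<ge> 1 \<and> n \<le> N \<and> squarefree n}"
  proof (rule bij_betw_byWitness[where f' = prime_factors])
    show "\<forall>B\<in>{B. B \<subseteq> A \<and> \<Prod>B \<le> N}. prime_factors (\<Prod>B) = B"
    proof
      fix B assume "B \<in> {B. B \<subseteq> A \<and> \<Prod>B \<le> N}"
      then have "finite B" "\<And>r. r \<in> B \<Longrightarrow> prime r" using A by (auto intro: finite_subset)
      then show "prime_factors (\<Prod>B) = B" by (rule prod_primes_facts(4)[OF _ _ a])
    qed
    show "\<forall>n\<in>{n. n \<ge> 1 \<and> n \<le> N \<and> squarefree n}. \<Prod>(prime_factors n) = n"
      using prod_prime_factors_squarefree by auto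
    show "(\<lambda>B. \<Prod>B) ` {B. B \<subseteq> A \<and> \<Prod>B \<le> N} \<subseteq> {n. n \<ge> 1 \<and> n \<le> N \<and> squarefree n}"
    proof clarify
      fix B assume B: "B \<subseteq> A" "\<Prod>B \<le> N"
      then have "finite B" "\<And>r. r \<in> B \<Longrightarrow> prime r" using A by (auto intro: finite_subset)
      then have "squarefree (\<Prod>B)" "\<Prod>B > 0"
        by (auto intro: prod_primes_facts(3)[OF _ _ a] prod_primes_pos simp del: prod_pos_nat_iff)
      then show "1 \<le> \<Prod>B \<and> \<Prod>B \<le> N \<and> squarefree (\<Prod>B)"
        using B by (simp add: Suc_le_eq)
    qed
    show "prime_factors ` {n. n \<ge> 1 \<and> n \<le> N \<and> squarefree n} \<subseteq> {B. B \<subseteq> A \<and> \<Prod>B \<le> N}"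
    proof clarify
      fix n assume n: "1 \<le> n" "n \<le> N" "squarefree n"
      then show "prime_factors n \<subseteq> A \<and> \<Prod>(prime_factors n) \<le> N"
        using prod_prime_factors_squarefree[of n] by (auto simp: A_def prime_factors_dvd dest!: dvd_imp_le)
    qed
  qed
  have "(\<Sum>n | n \<ge> 1 \<and> real n \<le> real N. f n) = (\<Sum>n | n \<ge> 1 \<and> n \<le> N \<and> squarefree n. f n)"
  proof (rule sum.mono_neutral_right)
    have "{n. n \<ge> 1 \<and> real n \<le> real N} \<subseteq> {..N}" by auto
    then show "finite {n. n \<ge> 1 \<and> real n \<le> real N}" by (rule finite_subset) simp
  qed (auto simp: f_def moebius_def)
  also have "\<dots> = (\<Sum>B | B \<subseteq> A \<and> \<Prod>B \<le> N. f (\<Prod>B))"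
    by (rule sum.reindex_bij_betw[OF bij, symmetric])
  also have "\<dots> = sqsum A N (\<lambda>p. 2 powr r * ((norm (a p))\<^sup>2 / real p))"
    unfolding sqsum_def
  proof (rule sum.cong[OF refl])
    fix B assume "B \<in> {B. B \<subseteq> A \<and> \<Prod>B \<le> N}"
    then have B: "finite B" "\<And>r. r \<in> B \<Longrightarrow> prime r" using A by (auto intro: finite_subset)
    have F: "num_divisors (\<Prod>B) = 2 ^ card B" "a (\<Prod>B) = (\<Prod>p\<in>B. a p)" "squarefree (\<Prod>B)"
      using B by (auto intro!: prod_primes_facts(1,2,3)[OF _ _ a] simp del: prod_pos_nat_iff)
    have "\<bar>moebius (\<Prod>B)\<bar> = 1" using F(3) by (simp add: moebius_def abs_mult power_abs)
    moreover have "(2 ^ card B :: real) powr r = (\<Prod>p\<in>B. 2 powr r)"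
      by (simp add: powr_powr mult.commute flip: powr_realpow)
    ultimately show "f (\<Prod>B) = (\<Prod>p\<in>B. 2 powr r * ((norm (a p))\<^sup>2 / real p))"
      unfolding f_def F(1,2) prod.distrib prod_dividef
      by (simp add: prod_norm[symmetric] prod_power_distrib)
  qed
  finally show ?thesis by (simp add: f_def A_def)
qed

section \<open>The squarefree functional\<close>

text \<open>
  The coefficients of the result of applying \<open>f \<mapsto> f_0 + e f_1\<close> in the variable of \<open>p\<close>; the prime \<open>p\<close>
  no longer occurs in it.
\<close>
definition pair_prime :: "nat \<Rightarrow> complex \<Rightarrow> (nat \<Rightarrow> complex) \<Rightarrow> nat \<Rightarrow> complex" where
  "pair_prime p e c m = (if p dvd m then 0 else c m + e * c (p * m))"

text \<open>
  For fixed \<open>t\<close> the twisted sum is a polynomial \<open>P\<close> in the phase of \<open>p\<close>, and the sum on the left is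
  \<open>P_0 + e p\<^sup>i\<^sup>t P_1\<close>. The local inequality is applied for each \<open>t\<close>, and the circle means average to the
  full moment.
\<close>
lemma moment_pair_prime_le:
  assumes p: "prime p" and q: "q > 0" and c: "\<And>n. n \<notin> {1..N} \<Longrightarrow> c n = 0"
    and low: "\<And>P. (norm (coeff P 0) + norm e * norm (coeff P 1)) powr q \<le> \<kappa> * circle_mean (\<lambda>z. norm (poly P z) powr q)"
  shows "moment q (pair_prime p e c) {1..N} \<le> \<kappa> * moment q c {1..N}"
proof (rule has_mean_mono)
  have J: "finite {1..N}" "0 \<notin> {1..N}" by auto
  show "has_mean (\<lambda>t. norm (dirichlet_sum (pair_prime p e c) {1..N} t) powr q) (moment q (pair_prime p e c) {1..N})"
    by (rule has_mean_moment[OF J q])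
  show "has_mean (\<lambda>t. \<kappa> * integral {0..1} (\<lambda>x. norm (dirichlet_sum (twist p x c) {1..N} t) powr q)) (\<kappa> * moment q c {1..N})"
    by (rule has_mean_cmult[OF has_mean_moment_avg[OF J q p]])
  show "continuous_on UNIV (\<lambda>t. norm (dirichlet_sum (pair_prime p e c) {1..N} t) powr q)"
    by (rule continuous_dirichlet_sum_powr[OF q])
  show "continuous_on UNIV (\<lambda>t. \<kappa> * integral {0..1} (\<lambda>x. norm (dirichlet_sum (twist p x c) {1..N} t) powr q))"
    by (intro continuous_on_mult continuous_on_const continuous_dirichlet_sum_avg J q p)
  fix t
  define b where "b = (\<lambda>n. c n * cis (- (t * ln (real n))))"
  define P where "P = (\<Sum>n\<in>{1..N}. monom (b n) (multiplicity p n))"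
  have tw: "dirichlet_sum (twist p x c) {1..N} t = poly P (cis (2 * pi * x))" for x
  proof -
    have pw: "cis (2 * pi * x * real m) = cis (2 * pi * x) ^ m" for m
      using Complex.DeMoivre[of "2 * pi * x" m] by (simp add: mult_ac)
    have "u * v * w = u * w * v" for u v w :: complex by simp
    then show ?thesis
      unfolding dirichlet_sum_def P_def poly_sum poly_monom twist_def b_def pw by (intro sum.cong refl)
  qed
  have co: "coeff P k = (\<Sum>n\<in>{n\<in>{1..N}. multiplicity p n = k}. b n)" for k
    unfolding P_def coeff_sum coeff_monom by (rule sum.inter_filter[symmetric]) simp
  have m0: "multiplicity p n = 0 \<longleftrightarrow> \<not> p dvd n" if "n \<in> {1..N}" for n
    using that prime_multiplicity_gt_zero_iff[OF prime_imp_prime_elem[OF p], of n] by auto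
  have p0: "p > 0" "real p > 0" using p by (auto simp: prime_gt_0_nat)
  define I where "I = {m\<in>{1..N}. \<not> p dvd m}"
  have c0: "coeff P 0 = (\<Sum>m\<in>I. b m)"
    unfolding co I_def using m0 by (intro sum.cong) auto
  have c1: "coeff P 1 * cis (t * ln (real p)) = (\<Sum>m\<in>I. c (p * m) * cis (- (t * ln (real m))))"
  proof -
    have inj: "inj_on (\<lambda>m. p * m) {m\<in>I. p * m \<le> N}" using p0 by (auto simp: inj_on_def)
    have im: "{n \<in> {1..N}. multiplicity p n = 1} = (\<lambda>m. p * m) ` {m\<in>I. p * m \<le> N}"
    proof (intro equalityI subsetI)
      fix n assume n: "n \<in> {n \<in> {1..N}. multiplicity p n = 1}"
      then have n0: "n \<noteq> 0" by auto
      have "\<not> is_unit p" using p by auto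
      obtain k where k: "n = p ^ multiplicity p n * k" "\<not> p dvd k"
        using multiplicity_decompose'[OF n0 \<open>\<not> is_unit p\<close>] by metis
      then have nk: "n = p * k" using n by simp
      then have "k \<ge> 1" "k \<le> n" using n0 p0 by auto
      then have "k \<in> I" using n k(2) by (auto simp: I_def)
      then show "n \<in> (\<lambda>m. p * m) ` {m\<in>I. p * m \<le> N}" using n nk by auto
    next
      fix n assume "n \<in> (\<lambda>m. p * m) ` {m\<in>I. p * m \<le> N}"
      then obtain m where m: "n = p * m" "m \<in> I" "p * m \<le> N" by auto
      have "multiplicity p (p * m) = multiplicity p p + multiplicity p m"
        using m p p0 by (intro prime_elem_multiplicity_mult_distrib) (auto simp: I_def)
      also have "\<dots> = 1"
        using m prime_gt_1_nat[OF p] by (auto simp: I_def not_dvd_imp_multiplicity_0 multiplicity_self)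
      finally show "n \<in> {n \<in> {1..N}. multiplicity p n = 1}" using m p0 by (auto simp: I_def Suc_le_eq)
    qed
    have "coeff P 1 * cis (t * ln (real p)) = (\<Sum>m | m \<in> I \<and> p * m \<le> N. b (p * m) * cis (t * ln (real p)))"
      unfolding co im using sum.reindex[OF inj, of b] by (simp add: sum_distrib_right)
    also have "\<dots> = (\<Sum>m | m \<in> I \<and> p * m \<le> N. c (p * m) * cis (- (t * ln (real m))))"
    proof (rule sum.cong[OF refl])
      fix m assume "m \<in> {m\<in>I. p * m \<le> N}"
      then have "ln (real (p * m)) = ln (real p) + ln (real m)" using p0 by (simp add: ln_mult I_def)
      then show "b (p * m) * cis (t * ln (real p)) = c (p * m) * cis (- (t * ln (real m)))"
        unfolding b_def by (simp only: mult.assoc cis_mult) (simp add: algebra_simps)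
    qed
    also have "\<dots> = (\<Sum>m\<in>I. c (p * m) * cis (- (t * ln (real m))))"
      using c by (intro sum.mono_neutral_left) (auto simp: I_def)
    finally show ?thesis .
  qed
  have "dirichlet_sum (pair_prime p e c) {1..N} t = (\<Sum>m\<in>I. pair_prime p e c m * cis (- (t * ln (real m))))"
    unfolding dirichlet_sum_def I_def by (intro sum.mono_neutral_right) (auto simp: pair_prime_def)
  also have "\<dots> = (\<Sum>m\<in>I. b m) + e * (\<Sum>m\<in>I. c (p * m) * cis (- (t * ln (real m))))"
    unfolding sum_distrib_left sum.distrib[symmetric]
    by (intro sum.cong refl) (auto simp: I_def pair_prime_def b_def algebra_simps)
  also have "\<dots> = coeff P 0 + e * (coeff P 1 * cis (t * ln (real p)))" by (simp only: c0 c1)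
  finally have "norm (dirichlet_sum (pair_prime p e c) {1..N} t) \<le> norm (coeff P 0) + norm e * norm (coeff P 1)"
    using norm_triangle_ineq[of "coeff P 0" "e * (coeff P 1 * cis (t * ln (real p)))"] by (simp add: norm_mult)
  then have "norm (dirichlet_sum (pair_prime p e c) {1..N} t) powr q \<le> (norm (coeff P 0) + norm e * norm (coeff P 1)) powr q"
    using q by (intro powr_mono2) auto
  also have "\<dots> \<le> \<kappa> * circle_mean (\<lambda>z. norm (poly P z) powr q)" by (rule low)
  finally show "norm (dirichlet_sum (pair_prime p e c) {1..N} t) powr q \<le> \<kappa> * integral {0..1} (\<lambda>x. norm (dirichlet_sum (twist p x c) {1..N} t) powr q)"
    unfolding tw circle_mean_def .
qed

definition pair_primes :: "nat set \<Rightarrow> (nat \<Rightarrow> complex) \<Rightarrow> (nat \<Rightarrow> complex) \<Rightarrow> nat \<Rightarrow> complex" where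
  "pair_primes A e c m = (if \<exists>p\<in>A. p dvd m then 0 else \<Sum>B\<in>Pow A. (\<Prod>p\<in>B. e p) * c (\<Prod>B * m))"

lemma pair_primes_empty: "pair_primes {} e c = c"
  by (simp add: pair_primes_def fun_eq_iff)

lemma pair_primes_insert:
  assumes A: "finite A" "\<And>r. r \<in> A \<Longrightarrow> prime r" and p: "prime p" "p \<notin> A"
  shows "pair_primes (insert p A) e c = pair_prime p (e p) (pair_primes A e c)"
proof
  fix m
  show "pair_primes (insert p A) e c m = pair_prime p (e p) (pair_primes A e c) m"
  proof (cases "\<exists>r\<in>insert p A. r dvd m")
    case True
    then show ?thesis by (auto simp: pair_primes_def pair_prime_def)
  next
    case False
    then have pm: "\<not> p dvd m" and Am: "\<not> (\<exists>r\<in>A. r dvd m)" by auto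
    have "\<not> r dvd p * m" if "r \<in> A" for r
    proof
      assume "r dvd p * m"
      then have "r dvd p \<or> r dvd m" using A(2)[OF that] prime_dvd_mult_iff by blast
      then show False using primes_dvd_imp_eq[OF A(2)[OF that] p(1)] that p(2) Am by blast
    qed
    then have Apm: "\<not> (\<exists>r\<in>A. r dvd p * m)" by blast
    have "pair_primes (insert p A) e c m = (\<Sum>B\<in>Pow A \<union> insert p ` Pow A. (\<Prod>p\<in>B. e p) * c (\<Prod>B * m))"
      unfolding pair_primes_def Pow_insert using False by simp
    also have "\<dots> = (\<Sum>B\<in>Pow A. (\<Prod>p\<in>B. e p) * c (\<Prod>B * m)) + (\<Sum>B\<in>insert p ` Pow A. (\<Prod>p\<in>B. e p) * c (\<Prod>B * m))"
      using A p by (intro sum.union_disjoint) auto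
    also have "(\<Sum>B\<in>insert p ` Pow A. (\<Prod>p\<in>B. e p) * c (\<Prod>B * m)) = (\<Sum>B\<in>Pow A. (\<Prod>p\<in>insert p B. e p) * c (\<Prod>(insert p B) * m))"
      using p(2) by (subst sum.reindex) (auto simp: inj_on_def o_def)
    also have "\<dots> = (\<Sum>B\<in>Pow A. e p * ((\<Prod>p\<in>B. e p) * c (\<Prod>B * (p * m))))"
    proof (rule sum.cong[OF refl])
      fix B assume "B \<in> Pow A"
      then have "finite B" "p \<notin> B" using A p by (auto intro: finite_subset)
      then show "(\<Prod>p\<in>insert p B. e p) * c (\<Prod>(insert p B) * m) = e p * ((\<Prod>p\<in>B. e p) * c (\<Prod>B * (p * m)))"
        by (simp add: mult_ac)
    qed
    also have "\<dots> = e p * pair_primes A e c (p * m)"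
      using Apm by (simp add: pair_primes_def sum_distrib_left)
    finally show ?thesis using pm Am by (simp add: pair_prime_def pair_primes_def)
  qed
qed

lemma pair_primes_support:
  assumes A: "finite A" "\<And>r. r \<in> A \<Longrightarrow> prime r" and c: "\<And>n. n \<notin> {1..N} \<Longrightarrow> c n = 0" and n: "n \<notin> {1..N}"
  shows "pair_primes A e c n = 0"
proof -
  have "c (\<Prod>B * n) = 0" if "B \<in> Pow A" for B
  proof (rule c)
    have "\<Prod>B > 0" using that A(2) by (intro prod_primes_pos) auto
    then have le: "n \<le> \<Prod>B * n" by simp
    show "\<Prod>B * n \<notin> {1..N}"
    proof (cases "n = 0")
      case False
      then have "N < n" using n by auto
      then have "N < \<Prod>B * n" using le by (rule less_le_trans)
      then show ?thesis by (metis atLeastAtMost_iff leD)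
    qed simp
  qed
  then show ?thesis by (simp add: pair_primes_def)
qed

lemma moment_pair_primes_le:
  assumes A: "finite A" "\<And>r. r \<in> A \<Longrightarrow> prime r" and q: "q > 0" and c: "\<And>n. n \<notin> {1..N} \<Longrightarrow> c n = 0"
    and low: "\<And>p P. p \<in> A \<Longrightarrow> (norm (coeff P 0) + norm (e p) * norm (coeff P 1)) powr q \<le> \<kappa> p * circle_mean (\<lambda>z. norm (poly P z) powr q)"
    and \<kappa>: "\<And>p. \<kappa> p \<ge> 0"
  shows "moment q (pair_primes A e c) {1..N} \<le> (\<Prod>p\<in>A. \<kappa> p) * moment q c {1..N}"
  using A low
proof (induction A rule: finite_induct)
  case empty
  then show ?case by (simp add: pair_primes_empty)
next
  case (insert p A)
  have A: "finite A" "\<And>r. r \<in> A \<Longrightarrow> prime r" "prime p" "p \<notin> A" using insert by auto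
  have "moment q (pair_primes (insert p A) e c) {1..N} = moment q (pair_prime p (e p) (pair_primes A e c)) {1..N}"
    by (simp only: pair_primes_insert[OF A])
  also have "\<dots> \<le> \<kappa> p * moment q (pair_primes A e c) {1..N}"
    using insert.prems(2)[of p] pair_primes_support[OF A(1,2) c]
    by (intro moment_pair_prime_le A q) auto
  also have "\<dots> \<le> \<kappa> p * ((\<Prod>p\<in>A. \<kappa> p) * moment q c {1..N})"
    using insert.prems by (intro mult_left_mono insert.IH \<kappa>) auto
  finally show ?case using insert by (simp add: mult.assoc)
qed

text \<open>
  Once the functional has been applied for all primes up to \<open>N\<close>, only the constant coefficient is left:
  it is the sum of the squarefree coefficients weighted by products of the \<open>e p\<close>.
\<close>
lemma squarefree_functional_le:
  assumes N: "N \<ge> 1" and q: "q > 0"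
    and low: "\<And>p P. prime p \<Longrightarrow> p \<le> N \<Longrightarrow> (norm (coeff P 0) + norm (e p) * norm (coeff P 1)) powr q \<le> \<kappa> p * circle_mean (\<lambda>z. norm (poly P z) powr q)"
    and \<kappa>: "\<And>p. \<kappa> p \<ge> 0"
  shows "norm (\<Sum>B | B \<subseteq> {p. prime p \<and> p \<le> N} \<and> \<Prod>B \<le> N. (\<Prod>p\<in>B. e p) * c (\<Prod>B)) powr q
    \<le> (\<Prod>p | prime p \<and> p \<le> N. \<kappa> p) * moment q c {1..N}"
proof -
  define A where "A = {p. prime p \<and> p \<le> N}"
  have A: "finite A" "\<And>r. r \<in> A \<Longrightarrow> prime r" by (auto simp: A_def)
  define c' where "c' = (\<lambda>n. if n \<in> {1..N} then c n else 0)"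
  define F where "F = pair_primes A e c'"
  have F0: "F m = 0" if "m \<in> {1..N} - {1}" for m
  proof -
    have "m \<noteq> 1" using that by auto
    then obtain p where "prime p" "p dvd m" using prime_factor_nat by blast
    moreover have "p \<le> N" using that calculation(2) by (auto dest!: dvd_imp_le)
    ultimately show ?thesis by (auto simp: F_def pair_primes_def A_def)
  qed
  have F1: "F 1 = (\<Sum>B | B \<subseteq> A \<and> \<Prod>B \<le> N. (\<Prod>p\<in>B. e p) * c (\<Prod>B))"
  proof -
    have "\<not> (\<exists>p\<in>A. p dvd 1)" using A(2) by (metis not_prime_unit)
    then have "F 1 = (\<Sum>B\<in>Pow A. (\<Prod>p\<in>B. e p) * c' (\<Prod>B))"
      unfolding F_def pair_primes_def by simp
    also have "\<dots> = (\<Sum>B | B \<subseteq> A \<and> \<Prod>B \<le> N. (\<Prod>p\<in>B. e p) * c' (\<Prod>B))"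
      using A(1) by (intro sum.mono_neutral_right) (auto simp: c'_def)
    also have "\<dots> = (\<Sum>B | B \<subseteq> A \<and> \<Prod>B \<le> N. (\<Prod>p\<in>B. e p) * c (\<Prod>B))"
    proof (rule sum.cong[OF refl])
      fix B assume B: "B \<in> {B. B \<subseteq> A \<and> \<Prod>B \<le> N}"
      have "\<Prod>B > 0" using B A(2) by (intro prod_primes_pos) auto
      then have "\<Prod>B \<in> {1..N}" using B by (auto simp: Suc_le_eq simp del: prod_pos_nat_iff)
      then show "(\<Prod>p\<in>B. e p) * c' (\<Prod>B) = (\<Prod>p\<in>B. e p) * c (\<Prod>B)" by (simp add: c'_def)
    qed
    finally show ?thesis .
  qed
  have "dirichlet_sum F {1..N} = dirichlet_sum F {1}"
    unfolding dirichlet_sum_def fun_eq_iff using N F0 by (intro allI sum.mono_neutral_right) auto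
  then have "moment q F {1..N} = moment q F {1}" by (simp add: moment_def)
  also have "\<dots> = norm (F 1) powr q" by (rule moment_const[OF q])
  finally have "norm (F 1) powr q = moment q F {1..N}" by simp
  also have "\<dots> \<le> (\<Prod>p\<in>A. \<kappa> p) * moment q c' {1..N}"
    unfolding F_def
  proof (rule moment_pair_primes_le[OF A(1) _ q])
    show "c' n = 0" if "n \<notin> {1..N}" for n using that by (auto simp: c'_def)
    show "prime r" if "r \<in> A" for r by (rule A(2)[OF that])
    show "(norm (coeff P 0) + norm (e p) * norm (coeff P 1)) powr q \<le> \<kappa> p * circle_mean (\<lambda>z. norm (poly P z) powr q)"
      if "p \<in> A" for p P using low that by (simp add: A_def)
    show "\<kappa> p \<ge> 0" for p by (rule \<kappa>)
  qed
  also have "moment q c' {1..N} = moment q c {1..N}"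
    by (simp add: moment_def dirichlet_sum_def c'_def)
  finally show ?thesis unfolding F1 A_def .
qed

section \<open>Lower bounds for the norm\<close>

lemma sum_le_prod_one_plus:
  fixes w :: "'a \<Rightarrow> real"
  assumes "finite A" "\<And>p. p \<in> A \<Longrightarrow> w p \<ge> 0"
  shows "(\<Sum>p\<in>A. w p) \<le> (\<Prod>p\<in>A. 1 + w p)"
proof -
  have "1 + (\<Sum>p\<in>A. w p) \<le> (\<Prod>p\<in>A. 1 + w p)"
    using assms
  proof (induction A rule: finite_induct)
    case (insert p A)
    have "1 + (\<Sum>p\<in>insert p A. w p) = 1 + w p + (\<Sum>p\<in>A. w p)" using insert by simp
    also have "\<dots> \<le> (1 + w p) * (1 + (\<Sum>p\<in>A. w p))"
      using insert.prems sum_nonneg[of A w] by (simp add: algebra_simps)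
    also have "\<dots> \<le> (1 + w p) * (\<Prod>p\<in>A. 1 + w p)"
      using insert by (intro mult_left_mono insert.IH) auto
    finally show ?case using insert by simp
  qed simp
  then show ?thesis by simp
qed

lemma sum_UN_atMost_le:
  fixes f :: "'a \<Rightarrow> real"
  assumes "\<And>k. finite (H k)" "\<And>x. f x \<ge> 0"
  shows "(\<Sum>x\<in>(\<Union>k\<le>n. H k). f x) \<le> (\<Sum>k\<le>(n::nat). \<Sum>x\<in>H k. f x)"
proof (induction n)
  case (Suc n)
  have "(\<Union>k\<le>Suc n. H k) = (\<Union>k\<le>n. H k) \<union> H (Suc n)" by (auto simp: atMost_Suc)
  moreover have "sum f ((\<Union>k\<le>n. H k) \<union> H (Suc n)) \<le> sum f (\<Union>k\<le>n. H k) + sum f (H (Suc n))"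
    using sum.union_inter[of "\<Union>k\<le>n. H k" "H (Suc n)" f] assms sum_nonneg[of "(\<Union>k\<le>n. H k) \<inter> H (Suc n)" f] by simp
  ultimately show ?case using Suc by simp
qed simp

text \<open>
  Take \<open>\<sigma> = 1 / ln N\<close> in Rankin's trick, so that \<open>N^\<sigma> = exp 1\<close>. The assumption then bounds the product
  of \<open>(1 + x_p) / (1 + x_p p^(-\<sigma>))\<close> over \<open>p \<le> N\<close>. No factor is below \<open>1\<close>, and for \<open>p\<^sup>2 > N\<close>, where
  \<open>p^(-\<sigma>) \<le> exp (-1/2)\<close>, the factor exceeds \<open>1\<close> by at least a fixed multiple of \<open>x_p\<close>.
\<close>
lemma upper_half_sum_bounded:
  assumes x: "\<And>p. 0 \<le> x p" "\<And>p. prime p \<Longrightarrow> x p \<le> X" and K: "K > 0" and N: "N \<ge> 2"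
    and B: "(\<Prod>p | prime p \<and> p \<le> N. 1 + x p) \<le> K * sqsum {p. prime p \<and> p \<le> N} N x"
  shows "(\<Sum>p | prime p \<and> p \<le> N \<and> N < p\<^sup>2. x p) \<le> K * exp 1 * (1 + X) / (1 - exp (- (1 / 2)))"
proof -
  define A where "A = {p. prime p \<and> p \<le> N}"
  define H where "H = {p. prime p \<and> p \<le> N \<and> N < p\<^sup>2}"
  have A: "finite A" "\<And>r. r \<in> A \<Longrightarrow> prime r" "H \<subseteq> A" "finite H" by (auto simp: A_def H_def)
  define \<beta> where "\<beta> = exp (- (1 / 2) :: real)"
  have \<beta>: "0 < \<beta>" "\<beta> < 1" by (auto simp: \<beta>_def)
  have X: "X \<ge> 0" using x(1)[of 2] x(2)[of 2] two_is_prime_nat by linarith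
  \<comment> \<open>with this \<open>c0\<close>, \<open>(1 + \<beta> x) (1 + c0 x) \<le> 1 + x\<close> for \<open>0 \<le> x \<le> X\<close>\<close>
  define c0 where "c0 = (1 - \<beta>) / (1 + X)"
  have c0: "c0 > 0" "c0 * (1 + X) = 1 - \<beta>" using \<beta> X by (auto simp: c0_def)
  define \<sigma> where "\<sigma> = 1 / ln (real N)"
  have lN: "ln (real N) > 0" using N by simp
  have \<sigma>: "\<sigma> \<ge> 0" "real N powr \<sigma> = exp 1" using lN N by (auto simp: \<sigma>_def powr_def)
  define y where "y = (\<lambda>p. x p * real p powr (- \<sigma>))"
  have y0: "0 \<le> y p" "y p \<le> x p" if "p \<in> A" for p
  proof -
    have "real p powr (- \<sigma>) \<le> real p powr 0"
      using A(2)[OF that] \<sigma>(1) prime_ge_1_nat[of p] by (intro powr_mono) auto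
    then have "real p powr (- \<sigma>) \<le> 1" using A(2)[OF that] by (simp add: prime_gt_0_nat)
    then have "x p * real p powr (- \<sigma>) \<le> x p * 1" using x(1) by (intro mult_left_mono) auto
    then show "0 \<le> y p" "y p \<le> x p" using x(1) by (auto simp: y_def)
  qed
  have yH: "y p \<le> \<beta> * x p" if "p \<in> H" for p
  proof -
    have p: "prime p" "N < p\<^sup>2" using that by (auto simp: H_def)
    have p0: "real p > 0" using p prime_gt_0_nat by auto
    have "real N \<le> (real p)\<^sup>2" using p(2) by (metis less_imp_le of_nat_le_iff of_nat_power)
    then have "ln (real N) \<le> ln ((real p)\<^sup>2)" using N by (intro ln_mono) auto
    then have "ln (real N) \<le> 2 * ln (real p)" using p0 by (simp add: ln_realpow)
    then have "1 / 2 \<le> \<sigma> * ln (real p)" using lN by (simp add: \<sigma>_def field_simps)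
    then have "real p powr (- \<sigma>) \<le> \<beta>" using p0 by (simp add: powr_def \<beta>_def)
    then have "real p powr (- \<sigma>) * x p \<le> \<beta> * x p" using x(1) by (intro mult_right_mono) auto
    then show ?thesis unfolding y_def by (simp add: mult.commute)
  qed
  have step: "(1 + y p) * (1 + (if p \<in> H then c0 * x p else 0)) \<le> 1 + x p" if "p \<in> A" for p
  proof (cases "p \<in> H")
    case False
    then show ?thesis using y0[OF that] by simp
  next
    case True
    have pr: "x p \<le> X" using x(2) A(2)[OF that] by blast
    have "(1 + y p) * (1 + c0 * x p) \<le> (1 + \<beta> * x p) * (1 + c0 * x p)"
      using yH[OF True] c0 x(1)[of p] by (intro mult_right_mono) auto
    also have "\<dots> = 1 + \<beta> * x p + c0 * (1 + \<beta> * x p) * x p" by (simp add: algebra_simps)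
    also have "\<dots> \<le> 1 + \<beta> * x p + c0 * (1 + X) * x p"
    proof -
      have "\<beta> * x p \<le> 1 * x p" using \<beta> x(1) by (intro mult_right_mono) auto
      then have "1 + \<beta> * x p \<le> 1 + X" using pr by linarith
      then show ?thesis using c0 x(1) by (intro add_left_mono mult_right_mono mult_left_mono) auto
    qed
    also have "\<dots> = 1 + x p" unfolding c0(2) by (simp add: algebra_simps)
    finally show ?thesis using True by simp
  qed
  have "(\<Prod>p\<in>A. 1 + y p) * (\<Prod>p\<in>A. 1 + (if p \<in> H then c0 * x p else 0)) \<le> (\<Prod>p\<in>A. 1 + x p)"
    unfolding prod.distrib[symmetric]
    using step y0 c0 x(1) by (intro prod_mono) (auto intro!: mult_nonneg_nonneg add_nonneg_nonneg)
  also have "\<dots> \<le> K * sqsum A N x" using B by (simp add: A_def)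
  also have "\<dots> \<le> K * (exp 1 * (\<Prod>p\<in>A. 1 + y p))"
    using sqsum_rankin[OF A(1,2) x(1) \<sigma>(1), of N] K \<sigma>(2) unfolding y_def by (intro mult_left_mono) auto
  finally have "(\<Prod>p\<in>A. 1 + (if p \<in> H then c0 * x p else 0)) * (\<Prod>p\<in>A. 1 + y p) \<le> (K * exp 1) * (\<Prod>p\<in>A. 1 + y p)"
    by (simp add: mult_ac)
  moreover have "(\<Prod>p\<in>A. 1 + y p) > 0" using y0 by (intro prod_pos) (auto intro: add_pos_nonneg)
  ultimately have P: "(\<Prod>p\<in>A. 1 + (if p \<in> H then c0 * x p else 0)) \<le> K * exp 1" by simp
  have "c0 * (\<Sum>p\<in>H. x p) = (\<Sum>p\<in>A. if p \<in> H then c0 * x p else 0)"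
    using A(3) A(1) by (simp add: sum.If_cases Int_absorb1 sum_distrib_left)
  also have "\<dots> \<le> K * exp 1"
    using sum_le_prod_one_plus[OF A(1), of "\<lambda>p. if p \<in> H then c0 * x p else 0"] c0 x(1) P by force
  finally have "(\<Sum>p\<in>H. x p) \<le> K * exp 1 / c0" using c0(1) by (simp add: field_simps)
  also have "\<dots> = K * exp 1 * (1 + X) / (1 - \<beta>)" by (simp add: c0_def)
  finally show ?thesis by (simp add: H_def \<beta>_def)
qed

text \<open>
  The primes are covered by the blocks \<open>sqrt M < p \<le> M\<close> with \<open>M = 2^(2^k)\<close>. In each block the sum of
  \<open>x_p\<close> is at most \<open>C\<close>, while \<open>x_p\<close> itself is at most \<open>X M^(-\<eta>/2)\<close>, which is summable over \<open>k\<close>.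
\<close>
lemma sum_squares_bounded:
  assumes x: "\<And>p. 0 \<le> x p" "\<And>p. prime p \<Longrightarrow> x p \<le> X * real p powr (- \<eta>)" and \<eta>: "\<eta> > 0" and X: "X > 0"
    and C: "\<And>N. N \<ge> 2 \<Longrightarrow> (\<Sum>p | prime p \<and> p \<le> N \<and> N < p\<^sup>2. x p) \<le> C"
  shows "\<exists>W. \<forall>N. (\<Sum>p | prime p \<and> p \<le> N. (x p)\<^sup>2) \<le> W"
proof -
  define M where "M = (\<lambda>k::nat. 2 ^ 2 ^ k :: nat)"
  define b where "b = 2 powr (- (\<eta> / 2))"
  have b: "0 < b" "b < 1" using \<eta> by (auto simp: b_def powr_less_one)
  define H where "H = (\<lambda>k. {p. prime p \<and> p \<le> M k \<and> M k < p\<^sup>2})"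
  have M2: "M k \<ge> 2" for k
  proof -
    have "(2::nat) ^ 1 \<le> 2 ^ 2 ^ k" by (intro power_increasing) auto
    then show ?thesis by (simp add: M_def)
  qed
  have finH: "finite (H k)" for k unfolding H_def by (rule finite_subset[of _ "{..M k}"]) auto
  have C0: "C \<ge> 0" using C[of 2] sum_nonneg[of "{p. prime p \<and> p \<le> 2 \<and> 2 < p\<^sup>2}" x] x(1) by force
  have block: "(\<Sum>p\<in>H k. (x p)\<^sup>2) \<le> X * C * b ^ k" for k
  proof -
    have xb: "x p \<le> X * b ^ k" if "p \<in> H k" for p
    proof -
      have p: "prime p" "M k < p\<^sup>2" using that by (auto simp: H_def)
      have p0: "real p > 0" using p prime_gt_0_nat by auto
      have "k \<le> 2 ^ k" by (simp add: less_imp_le)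
      then have "(2::nat) ^ k \<le> M k" unfolding M_def by (intro power_increasing) auto
      then have "(2::nat) ^ k \<le> p\<^sup>2" using p(2) by linarith
      then have "(2::real) ^ k \<le> (real p)\<^sup>2" by (metis of_nat_le_iff of_nat_power of_nat_numeral)
      then have "((real p)\<^sup>2) powr (- (\<eta> / 2)) \<le> (2 ^ k) powr (- (\<eta> / 2))"
        using \<eta> by (intro powr_mono2') auto
      also have "(2 ^ k) powr (- (\<eta> / 2)) = b ^ k"
        by (simp add: b_def powr_powr mult.commute flip: powr_realpow)
      also have "((real p)\<^sup>2) powr (- (\<eta> / 2)) = real p powr (- \<eta>)"
        using p0 by (simp add: powr_powr flip: powr_numeral)
      finally have "X * real p powr (- \<eta>) \<le> X * b ^ k" using X by (intro mult_left_mono) auto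
      then show ?thesis using x(2)[OF p(1)] by linarith
    qed
    have "(\<Sum>p\<in>H k. (x p)\<^sup>2) \<le> (\<Sum>p\<in>H k. X * b ^ k * x p)"
      unfolding power2_eq_square using xb x(1) by (intro sum_mono mult_right_mono) auto
    also have "\<dots> = X * b ^ k * (\<Sum>p\<in>H k. x p)" by (simp add: sum_distrib_left)
    also have "\<dots> \<le> X * b ^ k * C"
      using C[OF M2, of k] X b by (intro mult_left_mono) (auto simp: H_def)
    finally show ?thesis by (simp add: mult_ac)
  qed
  have cover: "\<exists>k\<le>N. p \<in> H k" if p: "prime p" "p \<le> N" for p N
  proof -
    have "N < 2 ^ N" by simp
    also have "(2::nat) ^ N \<le> M N" unfolding M_def by (intro power_increasing) (auto simp: less_imp_le)
    finally have pN: "p \<le> M N" using p by linarith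
    \<comment> \<open>minimality gives \<open>p > M (k - 1)\<close>, and \<open>(M (k - 1))\<^sup>2 = M k\<close>; for \<open>k = 0\<close> the prime is 2\<close>
    define k where "k = (LEAST k. p \<le> M k)"
    have k1: "p \<le> M k" unfolding k_def by (rule LeastI[of _ N]) (rule pN)
    have k2: "k \<le> N" unfolding k_def by (rule Least_le) (rule pN)
    have "M k < p\<^sup>2"
    proof (cases k)
      case 0
      have "2\<^sup>2 \<le> p\<^sup>2" using prime_ge_2_nat[OF p(1)] by (intro power_mono) auto
      then show ?thesis using 0 by (simp add: M_def)
    next
      case (Suc j)
      have "\<not> p \<le> M j" using not_less_Least[of j "\<lambda>k. p \<le> M k"] Suc by (simp add: k_def)
      then have "(M j)\<^sup>2 < p\<^sup>2" by (intro power_strict_mono) auto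
      moreover have "(M j)\<^sup>2 = M k" unfolding M_def Suc by (simp flip: power_mult)
      ultimately show ?thesis by simp
    qed
    then show ?thesis using k1 k2 p by (auto simp: H_def)
  qed
  have "(\<Sum>p | prime p \<and> p \<le> N. (x p)\<^sup>2) \<le> X * C * (1 / (1 - b))" for N
  proof -
    have "(\<Sum>p | prime p \<and> p \<le> N. (x p)\<^sup>2) \<le> (\<Sum>p\<in>(\<Union>k\<in>{..N}. H k). (x p)\<^sup>2)"
      using cover[of _ N] finH by (intro sum_mono2) auto
    also have "\<dots> \<le> (\<Sum>k\<in>{..N}. \<Sum>p\<in>H k. (x p)\<^sup>2)"
      using finH by (intro sum_UN_atMost_le) auto
    also have "\<dots> \<le> (\<Sum>k\<in>{..N}. X * C * b ^ k)" by (intro sum_mono block)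
    also have "\<dots> = X * C * (\<Sum>k\<in>{..N}. b ^ k)" by (simp add: sum_distrib_left)
    also have "\<dots> \<le> X * C * (\<Sum>k. b ^ k)"
      using X C0 b by (intro mult_left_mono sum_le_suminf summable_geometric) auto
    also have "(\<Sum>k. b ^ k) = 1 / (1 - b)" using b by (simp add: suminf_geometric)
    finally show ?thesis .
  qed
  then show ?thesis by blast
qed

lemma one_plus_ge_exp: "y \<ge> 0 \<Longrightarrow> 1 + y \<ge> exp (y - y\<^sup>2)" for y :: real
proof (cases "y \<le> 1")
  case True
  assume y: "y \<ge> 0"
  have "y - y\<^sup>2 \<le> ln (1 + y)" using ln_one_plus_pos_lower_bound[of y] y True by simp
  then have "exp (y - y\<^sup>2) \<le> exp (ln (1 + y))" by simp
  then show ?thesis using y by simp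
next
  case False
  assume y: "y \<ge> 0"
  have "y - y\<^sup>2 = y * (1 - y)" by (simp add: power2_eq_square algebra_simps)
  also have "\<dots> \<le> 0" using False y by (intro mult_nonneg_nonpos) auto
  finally have "exp (y - y\<^sup>2) \<le> 1" by simp
  then show ?thesis using y by linarith
qed

text \<open>
  The functional is applied with \<open>e_p = s cnj (c p)\<close>. Using \<open>e_p = \<alpha> cnj (c p)\<close> instead leads to a lower
  bound of order \<open>exp ((\<alpha> - \<alpha>\<^sup>2/q) \<lambda>)\<close> for the norm, which is largest for \<open>\<alpha> = q/2 = s\<close>. For the finitely many primes where the local inequality is not available \<open>e_p = 0\<close> is used;
  this loses a bounded factor, by \<open>sqsum_union_le\<close>.
\<close>
lemma norm_lower:
  assumes a: "multiplicative_fun a" and B: "condition_B a" and q: "q > 0"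
  shows "(\<lambda>N. mean_norm q (dirichlet_poly a N)) \<in> \<Omega>(\<lambda>N. exp (q * prime_energy a N / 4))"
proof -
  define s where "s = q / 2"
  have s: "s > 0" "q = 2 * s" using q by (auto simp: s_def)
  define c where "c = (\<lambda>n. a n / complex_of_real (sqrt (real n)))"
  have mc: "multiplicative_fun c" unfolding c_def by (rule multiplicative_fun_div_sqrt[OF a])
  define x where "x = (\<lambda>p. (norm (a p))\<^sup>2 / real p)"
  have x0: "x p \<ge> 0" for p by (simp add: x_def)
  have cx: "(norm (c p))\<^sup>2 = x p" for p by (simp add: c_def x_def norm_divide power_divide)
  define Pr where "Pr = (\<lambda>N. {p::nat. prime p \<and> p \<le> N})"
  have Pr: "finite (Pr N)" "\<And>r. r \<in> Pr N \<Longrightarrow> prime r" for N by (auto simp: Pr_def)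
  obtain \<theta> K0 where \<theta>: "\<theta> < 1/2" "K0 > 0" "\<And>p. prime p \<Longrightarrow> norm (a p) \<le> K0 * real p powr \<theta>"
    using B unfolding condition_B_def by blast
  have Br: "\<exists>K>0. \<forall>N\<ge>1. (\<Prod>p\<in>Pr N. 1 + 2 powr r * x p) \<le> K * sqsum (Pr N) N (\<lambda>p. 2 powr r * x p)" for r
  proof -
    obtain K where K: "K > 0" "\<forall>y::real. y \<ge> 1 \<longrightarrow>
        (\<Prod>p | prime p \<and> real p \<le> y. 1 + 2 powr r * (norm (a p))\<^sup>2 / real p)
        \<le> K * (\<Sum>n | n \<ge> 1 \<and> real n \<le> y. real_of_int \<bar>moebius n\<bar> * (norm (a n))\<^sup>2 / real n * real (num_divisors n) powr r)"
      using B unfolding condition_B_def by blast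
    have "(\<Prod>p\<in>Pr N. 1 + 2 powr r * x p) \<le> K * sqsum (Pr N) N (\<lambda>p. 2 powr r * x p)" if "N \<ge> 1" for N
      using K(2)[rule_format, of "real N"] that unfolding squarefree_sum_eq_sqsum[OF a] by (simp add: Pr_def x_def)
    then show ?thesis using K(1) by blast
  qed
  define X where "X = K0\<^sup>2"
  define \<eta> where "\<eta> = 1 - 2 * \<theta>"
  have X: "X > 0" and \<eta>: "\<eta> > 0" using \<theta> by (auto simp: X_def \<eta>_def)
  have xle: "x p \<le> X * real p powr (- \<eta>)" if "prime p" for p
  proof -
    have p0: "real p > 0" using that prime_gt_0_nat by auto
    have "(norm (a p))\<^sup>2 \<le> (K0 * real p powr \<theta>)\<^sup>2" using \<theta>(3)[OF that] by (intro power_mono) auto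
    also have "\<dots> = X * real p powr (2 * \<theta>)" by (simp add: X_def power_mult_distrib power2_eq_square flip: powr_add)
    finally have "x p \<le> X * real p powr (2 * \<theta>) / real p" unfolding x_def by (intro divide_right_mono) auto
    also have "\<dots> = X * real p powr (- \<eta>)"
    proof -
      have "real p powr (- \<eta>) = real p powr (2 * \<theta>) / real p powr 1" unfolding \<eta>_def powr_diff[symmetric] by simp
      then show ?thesis using p0 by simp
    qed
    finally show ?thesis .
  qed
  have xX: "x p \<le> X" if "prime p" for p
  proof -
    have "real p powr (- \<eta>) \<le> real p powr 0" using that \<eta> prime_ge_1_nat[OF that] by (intro powr_mono) auto
    then have "X * real p powr (- \<eta>) \<le> X * 1" using X that by (intro mult_left_mono) (auto simp: prime_gt_0_nat)
    then show ?thesis using xle[OF that] by linarith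
  qed
  obtain K1 where K1: "K1 > 0" "\<And>N. N \<ge> 1 \<Longrightarrow> (\<Prod>p\<in>Pr N. 1 + 2 powr 0 * x p) \<le> K1 * sqsum (Pr N) N (\<lambda>p. 2 powr 0 * x p)"
    using Br[of 0] by blast
  \<comment> \<open>the squares of the \<open>x p\<close> are summable, by condition (B) with \<open>r = 0\<close>\<close>
  have "\<exists>W. \<forall>N. (\<Sum>p | prime p \<and> p \<le> N. (x p)\<^sup>2) \<le> W"
  proof (rule sum_squares_bounded)
    show "x p \<le> X * real p powr (- \<eta>)" if "prime p" for p by (rule xle[OF that])
    fix N :: nat assume N: "N \<ge> 2"
    show "(\<Sum>p | prime p \<and> p \<le> N \<and> N < p\<^sup>2. x p) \<le> K1 * exp 1 * (1 + X) / (1 - exp (- (1 / 2)))"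
    proof (rule upper_half_sum_bounded)
      show "x p \<le> X" if "prime p" for p by (rule xX[OF that])
      show "(\<Prod>p | prime p \<and> p \<le> N. 1 + x p) \<le> K1 * sqsum {p. prime p \<and> p \<le> N} N x"
        using K1(2)[of N] N by (simp add: Pr_def)
    qed (rule x0 K1 N)+
  qed (rule x0 \<eta> X)+
  then obtain W where W: "\<And>N. (\<Sum>p\<in>Pr N. (x p)\<^sup>2) \<le> W"
    unfolding Pr_def by blast
  \<comment> \<open>the local inequality applies to all primes beyond some \<open>P\<close> since \<open>x p\<close> tends to 0\<close>
  from local_lower_bound[OF q] obtain e0 where e0: "e0 > 0" "\<And>p e. 0 \<le> e \<Longrightarrow> e \<le> e0 \<Longrightarrow>
      (norm (coeff p 0) + e * norm (coeff p 1)) powr q \<le> (1 + e\<^sup>2 + 8 * e ^ 4) * circle_mean (\<lambda>z. norm (poly p z) powr q)"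
    by blast
  have "((\<lambda>n. s\<^sup>2 * (X * real n powr (- \<eta>))) \<longlongrightarrow> 0) sequentially" using \<eta> by real_asymp
  moreover have "e0\<^sup>2 > 0" using e0(1) by simp
  ultimately have "\<forall>\<^sub>F n in sequentially. s\<^sup>2 * (X * real n powr (- \<eta>)) < e0\<^sup>2" by (rule order_tendstoD)
  then obtain P where P: "\<And>n. n \<ge> P \<Longrightarrow> s\<^sup>2 * (X * real n powr (- \<eta>)) < e0\<^sup>2" unfolding eventually_sequentially by blast
  define e where "e = (\<lambda>p. if p < P then 0 else of_real s * cnj (c p))"
  have e2: "(norm (e p))\<^sup>2 \<le> s\<^sup>2 * x p" for p
    using s x0[of p] by (simp add: e_def norm_mult power_mult_distrib cx)
  define \<kappa> where "\<kappa> = (\<lambda>p. 1 + (norm (e p))\<^sup>2 + 8 * norm (e p) ^ 4)"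
  have \<kappa>0: "\<kappa> p \<ge> 0" for p by (simp add: \<kappa>_def add_nonneg_nonneg)
  have \<kappa>le: "\<kappa> p \<le> exp (s\<^sup>2 * x p + 8 * s ^ 4 * (x p)\<^sup>2)" for p
  proof -
    have "norm (e p) ^ 4 = ((norm (e p))\<^sup>2)\<^sup>2" by simp
    also have "\<dots> \<le> (s\<^sup>2 * x p)\<^sup>2" using e2 by (intro power_mono) auto
    also have "\<dots> = s ^ 4 * (x p)\<^sup>2" by (simp add: power_mult_distrib)
    finally have "\<kappa> p \<le> 1 + (s\<^sup>2 * x p + 8 * s ^ 4 * (x p)\<^sup>2)" using e2[of p] by (simp add: \<kappa>_def)
    also have "\<dots> \<le> exp (s\<^sup>2 * x p + 8 * s ^ 4 * (x p)\<^sup>2)" by (rule exp_ge_add_one_self)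
    finally show ?thesis .
  qed
  have low: "(norm (coeff Q 0) + norm (e p) * norm (coeff Q 1)) powr q \<le> \<kappa> p * circle_mean (\<lambda>z. norm (poly Q z) powr q)"
    if "prime p" for p Q
  proof -
    have ne: "norm (e p) \<le> e0"
    proof (cases "p < P")
      case True
      then show ?thesis using e0(1) by (simp add: e_def)
    next
      case False
      have "s\<^sup>2 * x p \<le> s\<^sup>2 * (X * real p powr (- \<eta>))" using xle[OF that] by (intro mult_left_mono) auto
      then have "(norm (e p))\<^sup>2 \<le> e0\<^sup>2" using P[of p] False e2[of p] by linarith
      then show ?thesis by (rule power2_le_imp_le) (use e0(1) in simp)
    qed
    show ?thesis using e0(2)[OF norm_ge_zero ne, of Q] unfolding \<kappa>_def .
  qed
  \<comment> \<open>condition (B) is used with \<open>2 powr r = s\<close>\<close>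
  have "2 powr (log 2 s) = s" using s by simp
  then have "\<exists>K>0. \<forall>N\<ge>1. (\<Prod>p\<in>Pr N. 1 + s * x p) \<le> K * sqsum (Pr N) N (\<lambda>p. s * x p)"
    using Br[of "log 2 s"] by (simp only:)
  then obtain K where K: "K > 0" "\<And>N. N \<ge> 1 \<Longrightarrow> (\<Prod>p\<in>Pr N. 1 + s * x p) \<le> K * sqsum (Pr N) N (\<lambda>p. s * x p)"
    by blast
  define R where "R = (1 + s * X) ^ P"
  have "s * X > 0" using s(1) X by (rule mult_pos_pos)
  then have R: "R > 0" unfolding R_def by (intro zero_less_power) linarith
  define c1 where "c1 = exp (- (s\<^sup>2 * W)) / (K * R)"
  have c1: "c1 > 0" using K R by (simp add: c1_def)
  define c2 where "c2 = c1 powr q * exp (- (8 * s ^ 4 * W))"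
  have c2: "c2 > 0" using c1 by (simp add: c2_def)
  have "c2 powr (1 / q) * exp (q * prime_energy a N / 4) \<le> mean_norm q (dirichlet_poly a N)" if N: "N \<ge> 1" for N
  proof -
    define l where "l = prime_energy a N"
    have l: "(\<Sum>p\<in>Pr N. x p) = l" by (simp add: l_def prime_energy_def Pr_def x_def)
    define A2 where "A2 = {p\<in>Pr N. \<not> p < P}"
    define Sx where "Sx = sqsum A2 N (\<lambda>p. s * x p)"
    have lower: "c1 * exp (s * l) \<le> Sx"
    proof -
      have "exp (s * l - s\<^sup>2 * W) \<le> exp (\<Sum>p\<in>Pr N. s * x p - (s * x p)\<^sup>2)"
      proof -
        have "s\<^sup>2 * (\<Sum>p\<in>Pr N. (x p)\<^sup>2) \<le> s\<^sup>2 * W" using W by (intro mult_left_mono) auto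
        then show ?thesis
          by (simp add: sum_subtractf power_mult_distrib l flip: sum_distrib_left)
      qed
      also have "\<dots> = (\<Prod>p\<in>Pr N. exp (s * x p - (s * x p)\<^sup>2))" using Pr by (simp add: exp_sum)
      also have "\<dots> \<le> (\<Prod>p\<in>Pr N. 1 + s * x p)"
        using s x0 by (intro prod_mono conjI one_plus_ge_exp) auto
      also have "\<dots> \<le> K * sqsum (Pr N) N (\<lambda>p. s * x p)" by (rule K(2)[OF N])
      also have "Pr N = {p\<in>Pr N. p < P} \<union> A2" by (auto simp: A2_def)
      also have "K * sqsum ({p\<in>Pr N. p < P} \<union> A2) N (\<lambda>p. s * x p) \<le> K * ((\<Prod>p\<in>{p\<in>Pr N. p < P}. 1 + s * x p) * Sx)"
        unfolding Sx_def using K s x0 Pr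
        by (intro mult_left_mono sqsum_union_le) (auto simp: A2_def prime_gt_0_nat)
      also have "\<dots> \<le> K * (R * Sx)"
      proof -
        have "(\<Prod>p\<in>{p\<in>Pr N. p < P}. 1 + s * x p) \<le> (\<Prod>p\<in>{p\<in>Pr N. p < P}. 1 + s * X)"
          using s x0 xX Pr by (intro prod_mono) (auto intro!: add_nonneg_nonneg mult_left_mono)
        also have "\<dots> = (1 + s * X) ^ card {p\<in>Pr N. p < P}" by simp
        also have "\<dots> \<le> R" unfolding R_def
        proof (rule power_increasing)
          have "card {p\<in>Pr N. p < P} \<le> card {..<P}" by (rule card_mono) auto
          then show "card {p\<in>Pr N. p < P} \<le> P" by simp
        qed (use s X in simp)
        finally show ?thesis
          using K s x0 sqsum_nonneg[of A2 "\<lambda>p. s * x p" N] by (intro mult_left_mono mult_right_mono) (auto simp: Sx_def)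
      qed
      finally have "exp (s * l) * exp (- (s\<^sup>2 * W)) \<le> K * R * Sx" by (simp add: mult.assoc flip: exp_add)
      then show ?thesis using K R by (simp add: c1_def field_simps)
    qed
    have "(\<Sum>B | B \<subseteq> Pr N \<and> \<Prod>B \<le> N. (\<Prod>p\<in>B. e p) * c (\<Prod>B)) = of_real Sx"
    proof -
      have "(\<Prod>p\<in>B. e p) * c (\<Prod>B) = of_real (\<Prod>p\<in>B. if p < P then 0 else s * x p)" if "B \<subseteq> Pr N" for B
      proof -
        have B: "finite B" "\<And>r. r \<in> B \<Longrightarrow> prime r" using that Pr finite_subset by blast+
        have "c (\<Prod>B) = (\<Prod>p\<in>B. c p)" using B by (auto intro!: prod_primes_facts(2)[OF _ _ mc])
        moreover have "cnj (c p) * c p = of_real (x p)" for p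
          unfolding cx[symmetric] complex_norm_square by (rule mult.commute)
        then have "e p * c p = of_real (if p < P then 0 else s * x p)" for p
          by (simp add: e_def mult.assoc)
        ultimately show ?thesis by (simp only: prod.distrib[symmetric] of_real_prod)
      qed
      then have "(\<Sum>B | B \<subseteq> Pr N \<and> \<Prod>B \<le> N. (\<Prod>p\<in>B. e p) * c (\<Prod>B)) =
          of_real (\<Sum>B | B \<subseteq> Pr N \<and> \<Prod>B \<le> N. \<Prod>p\<in>B. if p < P then 0 else s * x p)"
        by (simp only: of_real_sum) (intro sum.cong refl, simp)
      also have "(\<Sum>B | B \<subseteq> Pr N \<and> \<Prod>B \<le> N. \<Prod>p\<in>B. if p < P then 0 else s * x p) =
          (\<Sum>B | B \<subseteq> A2 \<and> \<Prod>B \<le> N. \<Prod>p\<in>B. if p < P then 0 else s * x p)"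
      proof (rule sum.mono_neutral_right)
        show "finite {B. B \<subseteq> Pr N \<and> \<Prod>B \<le> N}" using Pr by simp
        show "\<forall>B\<in>{B. B \<subseteq> Pr N \<and> \<Prod>B \<le> N} - {B. B \<subseteq> A2 \<and> \<Prod>B \<le> N}. (\<Prod>p\<in>B. if p < P then 0 else s * x p) = 0"
        proof
          fix B assume B: "B \<in> {B. B \<subseteq> Pr N \<and> \<Prod>B \<le> N} - {B. B \<subseteq> A2 \<and> \<Prod>B \<le> N}"
          then obtain p where "p \<in> B" "p < P" by (auto simp: A2_def)
          moreover have "finite B" using B Pr by (auto intro: finite_subset)
          ultimately show "(\<Prod>p\<in>B. if p < P then 0 else s * x p) = 0" by (intro prod_zero) auto
        qed
      qed (auto simp: A2_def)
      also have "\<dots> = Sx"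
        unfolding Sx_def sqsum_def by (intro sum.cong prod.cong refl) (auto simp: A2_def)
      finally show ?thesis .
    qed
    moreover have "norm (\<Sum>B | B \<subseteq> Pr N \<and> \<Prod>B \<le> N. (\<Prod>p\<in>B. e p) * c (\<Prod>B)) powr q
        \<le> (\<Prod>p\<in>Pr N. \<kappa> p) * moment q c {1..N}"
      unfolding Pr_def by (rule squarefree_functional_le[OF N q]) (rule low \<kappa>0; assumption)+
    ultimately have "norm (complex_of_real Sx) powr q \<le> (\<Prod>p\<in>Pr N. \<kappa> p) * moment q c {1..N}"
      by (simp only:)
    also have "\<dots> \<le> exp (s\<^sup>2 * l + 8 * s ^ 4 * W) * moment q c {1..N}"
    proof (rule mult_right_mono)
      have "(\<Prod>p\<in>Pr N. \<kappa> p) \<le> (\<Prod>p\<in>Pr N. exp (s\<^sup>2 * x p + 8 * s ^ 4 * (x p)\<^sup>2))"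
        using \<kappa>0 \<kappa>le by (intro prod_mono) auto
      also have "\<dots> = exp (s\<^sup>2 * l + 8 * s ^ 4 * (\<Sum>p\<in>Pr N. (x p)\<^sup>2))"
        using Pr by (simp add: sum.distrib l flip: exp_sum sum_distrib_left)
      also have "\<dots> \<le> exp (s\<^sup>2 * l + 8 * s ^ 4 * W)" using W s by (simp add: mult_left_mono)
      finally show "(\<Prod>p\<in>Pr N. \<kappa> p) \<le> exp (s\<^sup>2 * l + 8 * s ^ 4 * W)" .
      show "0 \<le> moment q c {1..N}" using q by (intro moment_nonneg) auto
    qed
    finally have up: "\<bar>Sx\<bar> powr q \<le> exp (s\<^sup>2 * l + 8 * s ^ 4 * W) * moment q c {1..N}" by simp
    have "c1 powr q * exp (s\<^sup>2 * l + s\<^sup>2 * l) = (c1 * exp (s * l)) powr q"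
      using c1 by (simp add: powr_mult exp_powr s(2) power2_eq_square algebra_simps)
    also have "\<dots> \<le> \<bar>Sx\<bar> powr q" using lower c1 q by (intro powr_mono2) auto
    also note up
    finally have "c1 powr q * exp (s\<^sup>2 * l + s\<^sup>2 * l) * exp (- (s\<^sup>2 * l + 8 * s ^ 4 * W)) \<le>
        exp (s\<^sup>2 * l + 8 * s ^ 4 * W) * moment q c {1..N} * exp (- (s\<^sup>2 * l + 8 * s ^ 4 * W))"
      by (intro mult_right_mono) auto
    also have "\<dots> = moment q c {1..N}" by (simp add: mult.commute mult.left_commute flip: exp_add)
    also have "c1 powr q * exp (s\<^sup>2 * l + s\<^sup>2 * l) * exp (- (s\<^sup>2 * l + 8 * s ^ 4 * W)) = c2 * exp (s\<^sup>2 * l)"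
      by (simp add: c2_def mult.assoc algebra_simps flip: exp_add)
    finally have "(c2 * exp (s\<^sup>2 * l)) powr (1 / q) \<le> moment q c {1..N} powr (1 / q)"
      using q c2 by (intro powr_mono2) auto
    also have "(c2 * exp (s\<^sup>2 * l)) powr (1 / q) = c2 powr (1 / q) * exp (q * l / 4)"
      using c2 s by (simp add: powr_mult exp_powr power2_eq_square)
    finally show ?thesis by (simp add: mean_norm_dirichlet_poly c_def l_def)
  qed
  then have "eventually (\<lambda>N. norm (mean_norm q (dirichlet_poly a N)) \<ge> c2 powr (1 / q) * norm (exp (q * prime_energy a N / 4))) sequentially"
    by (intro eventually_mono[OF eventually_ge_at_top[of 1]]) (auto simp: mean_norm_dirichlet_poly)
  then show ?thesis using c2 by (intro landau_omega.bigI[of "c2 powr (1 / q)"]) auto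
qed

theorem theorem1:
  fixes a :: "nat \<Rightarrow> complex"
  assumes "multiplicative_fun a"
  shows
    "(condition_A a \<longrightarrow>
       (\<forall>q>1. (\<lambda>N. mean_norm q (dirichlet_poly a N)) \<in> O(\<lambda>N. exp (q * prime_energy a N / 4))) \<and>
       ((\<exists>p. prime p \<and> a p \<noteq> 0) \<longrightarrow>
         (\<lambda>N. mean_norm 1 (dirichlet_poly a N))
           \<in> O(\<lambda>N. prime_energy a N * exp (prime_energy a N / 4))) \<and>
       (\<forall>q. 0 < q \<and> q < 1 \<longrightarrow>
         (\<lambda>N. mean_norm q (dirichlet_poly a N)) \<in> O(\<lambda>N. exp (prime_energy a N / 4)))) \<and>
     (condition_B a \<longrightarrow>
       (\<forall>q>0. (\<lambda>N. mean_norm q (dirichlet_poly a N)) \<in> \<Omega>(\<lambda>N. exp (q * prime_energy a N / 4))))"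
proof (intro conjI impI allI)
  assume A: "condition_A a"
  show "(\<lambda>N. mean_norm q (dirichlet_poly a N)) \<in> O(\<lambda>N. exp (q * prime_energy a N / 4))" if "q > 1" for q
    by (rule norm_upper_gt_1[OF assms A that])
  show "(\<lambda>N. mean_norm 1 (dirichlet_poly a N)) \<in> O(\<lambda>N. prime_energy a N * exp (prime_energy a N / 4))"
    if "\<exists>p. prime p \<and> a p \<noteq> 0"
    using that norm_upper_eq_1[OF assms A] by blast
  show "(\<lambda>N. mean_norm q (dirichlet_poly a N)) \<in> O(\<lambda>N. exp (prime_energy a N / 4))" if "0 < q \<and> q < 1" for q
    using that norm_upper_lt_1[OF assms A] by blast
next
  assume B: "condition_B a"
  show "(\<lambda>N. mean_norm q (dirichlet_poly a N)) \<in> \<Omega>(\<lambda>N. exp (q * prime_energy a N / 4))" if "q > 0" for q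
    by (rule norm_lower[OF assms B that])
qed

end
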